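(* Let $p\in\{0,1,\ldots,6\}$, let $\underline{\eta}\in\mathbb{S}$ and let $U$ be a bounded domain in $\mathbb{O}$ such that $U_{\underline{\eta}}$ has smooth boundary $\partial U_{\underline{\eta}}$. If $f\in C^1(\overline{U_{\underline{\eta}}},\mathbb{O})$ satisfies $D_{\underline{\eta}}f(\boldsymbol{y})=0$ for all $\boldsymbol{y}\in U_{\underline{\eta}}$, then $$f(\boldsymbol{x})=\int_{\partial U_{\underline{\eta}}}E_{\boldsymbol{y}}(\boldsymbol{x})\big(\boldsymbol{n}(\boldsymbol{y})f(\boldsymbol{y})\big)\,dS(\boldsymbol{y}),\qquad\boldsymbol{x}\in U_{\underline{\eta}},$$ where $\boldsymbol{n}(\boldsymbol{y})=\sum_{i=0}^pn_i(\boldsymbol{y})e_i+n_{p+1}(\boldsymbol{y})\underline{\eta}$ is the unit exterior normal to $\partial U_{\underline{\eta}}$ at $\boldsymbol{y}$, and $dS$ is the classical Lebesgue surface element in $\mathbb{R}^{p+2}$.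
   Context: $\mathbb{O}$ is the real, non-associative, alternative algebra of octonions with basis $e_0=1,e_1,\ldots,e_7$ and product $e_ie_j=-\delta_{ij}+\sum_k\epsilon_{ijk}e_k$ for $1\le i,j\le 7$, where $\epsilon_{ijk}$ is totally antisymmetric, equals $1$ on the triples $(1,2,3),(1,4,5),(2,4,6),(3,4,7),(5,3,6),(6,1,7),(7,2,5)$, and vanishes on triples that are not permutations of these. $\mathbb{O}$ is identified with $\mathbb{R}^8$ with Euclidean norm $|\cdot|$; conjugation is $\overline{x}=x_0-\sum_{i=1}^7x_ie_i$. A domain is a connected open set. Fix $p\in\{0,\ldots,6\}$. $\mathbb{R}^{p+1}$ denotes the real span of $e_0,\ldots,e_p$, and $\mathbb{S}=\{\sum_{i=p+1}^7x_ie_i:\sum_{i=p+1}^7x_i^2=1\}$. For $U\subseteq\mathbb{O}$ open and $\underline{\eta}\in\mathbb{S}$, $U_{\underline{\eta}}=U\cap(\mathbb{R}^{p+1}\oplus\underline{\eta}\mathbb{R})$ is viewed as an open subset of $\mathbb{R}^{p+2}$ with coordinates $(x_0,\ldots,x_p,r)\leftrightarrow\sum_{i=0}^px_ie_i+r\underline{\eta}$; its boundary and closure are taken in $\mathbb{R}^{p+1}\oplus\underline{\eta}\mathbb{R}$. $D_{\underline{\eta}}f=\sum_{i=0}^pe_i\,\partial_{x_i}f+\underline{\eta}\,\partial_rf$. The Cauchy kernel is $E(\boldsymbol{x})=\frac{1}{\sigma_{p+1}}\frac{\overline{\boldsymbol{x}}}{|\boldsymbol{x}|^{p+2}}$ for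 $\boldsymbol{x}\in\mathbb{O}\setminus\{0\}$, with $\sigma_{p+1}=2\,\Gamma(\tfrac12)^{p+2}/\Gamma(\tfrac{p+2}{2})$ (the area of the unit sphere of $\mathbb{R}^{p+2}$), and $E_{\boldsymbol{y}}(\boldsymbol{x}):=E(\boldsymbol{y}-\boldsymbol{x})$. *)

theory Defs
  imports "HOL-Analysis.Analysis"
begin

section \<open>Octonions\<close>

text \<open>The index type 8 has the elements 0, ..., 7, so component i of an octonion x is
  \<open>x $ of_nat i\<close> for i = 0, ..., 7. The product inherited from the type of vectors is the
  componentwise one and is never used for octonions.\<close>

type_synonym octonion = "real ^ 8"

definition oe :: "nat \<Rightarrow> octonion" where
  "oe i = axis (of_nat i) 1"

definition oct_triples :: "(nat \<times> nat \<times> nat) set" where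
  "oct_triples = {(1,2,3), (1,4,5), (2,4,6), (3,4,7), (5,3,6), (6,1,7), (7,2,5)}"

definition oct_eps :: "nat \<Rightarrow> nat \<Rightarrow> nat \<Rightarrow> real" where
  "oct_eps i j k =
    (if (i,j,k) \<in> oct_triples \<or> (j,k,i) \<in> oct_triples \<or> (k,i,j) \<in> oct_triples then 1
     else if (j,i,k) \<in> oct_triples \<or> (i,k,j) \<in> oct_triples \<or> (k,j,i) \<in> oct_triples then -1
     else 0)"

definition oct_basis_mult :: "nat \<Rightarrow> nat \<Rightarrow> octonion" where
  "oct_basis_mult i j =
    (if i = 0 then oe j
     else if j = 0 then oe i
     else (if i = j then - oe 0 else 0) + (\<Sum>k=1..7. oct_eps i j k *\<^sub>R oe k))"

definition omult :: "octonion \<Rightarrow> octonion \<Rightarrow> octonion"  (infixl "\<odot>" 70) where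
  "x \<odot> y = (\<Sum>i\<le>7. \<Sum>j\<le>7. (x $ of_nat i * y $ of_nat j) *\<^sub>R oct_basis_mult i j)"

definition oconj :: "octonion \<Rightarrow> octonion" where
  "oconj x = (x $ 0) *\<^sub>R oe 0 - (\<Sum>i=1..7. (x $ of_nat i) *\<^sub>R oe i)"


section \<open>Coordinate subspaces\<close>

text \<open>A copy of m-dimensional Euclidean space inside a Euclidean space, given by an orthonormal
  system \<open>b 0, ..., b (m - 1)\<close> of coordinate directions. Boundaries and closures are taken in
  the subspace topology.\<close>

definition coord_space :: "(nat \<Rightarrow> 'a::euclidean_space) \<Rightarrow> nat \<Rightarrow> 'a set" where
  "coord_space b m = span (b ` {..<m})"

definition coord_boundary :: "(nat \<Rightarrow> 'a::euclidean_space) \<Rightarrow> nat \<Rightarrow> 'a set \<Rightarrow> 'a set" where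
  "coord_boundary b m G = top_of_set (coord_space b m) frontier_of G"

definition coord_closure :: "(nat \<Rightarrow> 'a::euclidean_space) \<Rightarrow> nat \<Rightarrow> 'a set \<Rightarrow> 'a set" where
  "coord_closure b m G = top_of_set (coord_space b m) closure_of G"

definition dir_deriv :: "('a::euclidean_space \<Rightarrow> 'b::real_normed_vector) \<Rightarrow> 'a \<Rightarrow> 'a \<Rightarrow> 'b" where
  "dir_deriv f v x = vector_derivative (\<lambda>t. f (x + t *\<^sub>R v)) (at 0)"

text \<open>Functions of class \<open>C\<^sup>1\<close> up to the boundary: the function is continuous on the closure, and
  its first order partial derivatives exist in G and extend continuously to the closure.\<close>

definition C1_closure ::
  "(nat \<Rightarrow> 'a::euclidean_space) \<Rightarrow> nat \<Rightarrow> 'a set \<Rightarrow> ('a \<Rightarrow> 'b::real_normed_vector) \<Rightarrow> bool" where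
  "C1_closure b m G f \<longleftrightarrow>
     continuous_on (coord_closure b m G) f \<and>
     (\<forall>i<m. \<exists>g. continuous_on (coord_closure b m G) g \<and>
        (\<forall>x\<in>G. ((\<lambda>t. f (x + t *\<^sub>R b i)) has_vector_derivative g x) (at 0)))"


section \<open>Smooth boundaries, exterior normal, surface measure\<close>

primrec Ck :: "nat \<Rightarrow> ('a::euclidean_space \<Rightarrow> real) \<Rightarrow> bool" where
  "Ck 0 g \<longleftrightarrow> continuous_on UNIV g"
| "Ck (Suc k) g \<longleftrightarrow>
     g differentiable_on UNIV \<and> (\<forall>v. Ck k (\<lambda>x. frechet_derivative g (at x) v))"

definition C_inf :: "('a::euclidean_space \<Rightarrow> real) \<Rightarrow> bool" where
  "C_inf g \<longleftrightarrow> (\<forall>k. Ck k g)"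

text \<open>Removal of the k-th coordinate. A function of the remaining m - 1 coordinates is
  represented by a function g on the ambient space that is only evaluated at points of the
  form \<open>drop_coord b k y\<close>.\<close>

definition drop_coord :: "(nat \<Rightarrow> 'a::euclidean_space) \<Rightarrow> nat \<Rightarrow> 'a \<Rightarrow> 'a" where
  "drop_coord b k y = y - (y \<bullet> b k) *\<^sub>R b k"

text \<open>Up to relabelling (k) and reorienting (s) the coordinate axes, G lies near each of its
  boundary points strictly on one side of the graph of a smooth function.\<close>

definition smooth_boundary :: "(nat \<Rightarrow> 'a::euclidean_space) \<Rightarrow> nat \<Rightarrow> 'a set \<Rightarrow> bool" where
  "smooth_boundary b m G \<longleftrightarrow>
     (\<forall>x \<in> coord_boundary b m G. \<exists>r>0. \<exists>k<m. \<exists>s\<in>{-1, 1::real}. \<exists>g. C_inf g \<and>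
        G \<inter> ball x r =
          {y \<in> coord_space b m \<inter> ball x r. s * (y \<bullet> b k - g (drop_coord b k y)) > 0})"

text \<open>v is the velocity at y of a curve in S, that is, v is tangent to S at y.\<close>

definition tangent_vector :: "'a::euclidean_space set \<Rightarrow> 'a \<Rightarrow> 'a \<Rightarrow> bool" where
  "tangent_vector S y v \<longleftrightarrow>
     (\<exists>c::real \<Rightarrow> 'a. range c \<subseteq> S \<and> c 0 = y \<and> (c has_vector_derivative v) (at 0))"

definition unit_exterior_normal ::
  "(nat \<Rightarrow> 'a::euclidean_space) \<Rightarrow> nat \<Rightarrow> 'a set \<Rightarrow> 'a \<Rightarrow> 'a" where
  "unit_exterior_normal b m G y =
     (THE n. n \<in> coord_space b m \<and> norm n = 1 \<and>
        (\<forall>v. tangent_vector (coord_boundary b m G) y v \<longrightarrow> n \<bullet> v = 0) \<and>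
        (\<forall>\<^sub>F t in at_right (0::real). y + t *\<^sub>R n \<notin> coord_closure b m G))"

text \<open>Inside the open set W, the set S is the graph of g over the coordinates other than k.\<close>

definition graph_patch ::
  "(nat \<Rightarrow> 'a::euclidean_space) \<Rightarrow> nat \<Rightarrow> 'a set \<Rightarrow> 'a set \<Rightarrow> nat \<Rightarrow> ('a \<Rightarrow> real) \<Rightarrow> bool" where
  "graph_patch b m S W k g \<longleftrightarrow>
     open W \<and> k < m \<and> C_inf g \<and>
     S \<inter> W = {y \<in> coord_space b m \<inter> W. y \<bullet> b k = g (drop_coord b k y)}"

definition base_point :: "(nat \<Rightarrow> 'a::euclidean_space) \<Rightarrow> nat \<Rightarrow> nat \<Rightarrow> (nat \<Rightarrow> real) \<Rightarrow> 'a" where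
  "base_point b m k c = (\<Sum>i\<in>{..<m} - {k}. c i *\<^sub>R b i)"

definition graph_point ::
  "(nat \<Rightarrow> 'a::euclidean_space) \<Rightarrow> nat \<Rightarrow> nat \<Rightarrow> ('a \<Rightarrow> real) \<Rightarrow> (nat \<Rightarrow> real) \<Rightarrow> 'a" where
  "graph_point b m k g c = base_point b m k c + g (base_point b m k c) *\<^sub>R b k"

definition graph_area_density ::
  "(nat \<Rightarrow> 'a::euclidean_space) \<Rightarrow> nat \<Rightarrow> nat \<Rightarrow> ('a \<Rightarrow> real) \<Rightarrow> (nat \<Rightarrow> real) \<Rightarrow> real" where
  "graph_area_density b m k g c =
     sqrt (1 + (\<Sum>i\<in>{..<m} - {k}. (frechet_derivative g (at (base_point b m k c)) (b i))\<^sup>2))"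

text \<open>The surface measure of a smooth hypersurface S: the Borel measure that is concentrated on S
  and is given on every graph patch by the surface element \<open>sqrt (1 + |grad g|^2)\<close> times Lebesgue
  measure in the m - 1 coordinates over which S is a graph. These conditions determine the measure,
  since the hypersurface is covered by countably many patches, and they are consistent, since the
  surface element does not depend on the patch.\<close>

definition is_surface_measure ::
  "(nat \<Rightarrow> 'a::euclidean_space) \<Rightarrow> nat \<Rightarrow> 'a set \<Rightarrow> 'a measure \<Rightarrow> bool" where
  "is_surface_measure b m S M \<longleftrightarrow>
     sets M = sets borel \<and> emeasure M (- S) = 0 \<and>
     (\<forall>W k g A. graph_patch b m S W k g \<longrightarrow> A \<in> sets borel \<longrightarrow> A \<subseteq> W \<longrightarrow>
        emeasure M A =
          (\<integral>\<^sup>+ c. ennreal (graph_area_density b m k g c) * indicator A (graph_point b m k g c)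
             \<partial>(\<Pi>\<^sub>M i\<in>{..<m} - {k}. (lborel :: real measure))))"

definition surface_measure ::
  "(nat \<Rightarrow> 'a::euclidean_space) \<Rightarrow> nat \<Rightarrow> 'a set \<Rightarrow> 'a measure" where
  "surface_measure b m S = (THE M. is_surface_measure b m S M)"


section \<open>Slices of the octonions\<close>

definition slice_sphere :: "nat \<Rightarrow> octonion set" where
  "slice_sphere p = {(\<Sum>i=p+1..7. x i *\<^sub>R oe i) | x. (\<Sum>i=p+1..7. (x i)\<^sup>2) = (1::real)}"

text \<open>The coordinates \<open>(x\<^sub>0, ..., x\<^sub>p, r)\<close>: the coordinate directions are
  \<open>oe 0, ..., oe p, \<eta>\<close>, in this order, and m = p + 2.\<close>

definition slice_frame :: "nat \<Rightarrow> octonion \<Rightarrow> nat \<Rightarrow> octonion" where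
  "slice_frame p \<eta> i = (if i \<le> p then oe i else \<eta>)"

definition slice :: "nat \<Rightarrow> octonion \<Rightarrow> octonion set \<Rightarrow> octonion set" where
  "slice p \<eta> U = U \<inter> coord_space (slice_frame p \<eta>) (p + 2)"

definition slice_boundary :: "nat \<Rightarrow> octonion \<Rightarrow> octonion set \<Rightarrow> octonion set" where
  "slice_boundary p \<eta> U = coord_boundary (slice_frame p \<eta>) (p + 2) (slice p \<eta> U)"

definition slice_D :: "nat \<Rightarrow> octonion \<Rightarrow> (octonion \<Rightarrow> octonion) \<Rightarrow> octonion \<Rightarrow> octonion" where
  "slice_D p \<eta> f x = (\<Sum>i\<le>p. oe i \<odot> dir_deriv f (oe i) x) + \<eta> \<odot> dir_deriv f \<eta> x"

definition slice_normal :: "nat \<Rightarrow> octonion \<Rightarrow> octonion set \<Rightarrow> octonion \<Rightarrow> octonion" where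
  "slice_normal p \<eta> U = unit_exterior_normal (slice_frame p \<eta>) (p + 2) (slice p \<eta> U)"

definition slice_dS :: "nat \<Rightarrow> octonion \<Rightarrow> octonion set \<Rightarrow> octonion measure" where
  "slice_dS p \<eta> U = surface_measure (slice_frame p \<eta>) (p + 2) (slice_boundary p \<eta> U)"

definition sphere_area :: "nat \<Rightarrow> real" where
  "sphere_area p = 2 * Gamma (1/2) ^ (p + 2) / Gamma (real (p + 2) / 2)"

definition cauchy_kernel :: "nat \<Rightarrow> octonion \<Rightarrow> octonion" where
  "cauchy_kernel p x = (1 / sphere_area p) *\<^sub>R ((1 / norm x ^ (p + 2)) *\<^sub>R oconj x)"

end

theory Submission
  imports Defs
begin

text \<open>The integral formula is the divergence theorem for the \<open>m = p + 2\<close> fields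
  \<open>E (y - x) \<odot> (b i \<odot> f y)\<close>, where the \<open>b i\<close> are the
  coordinate directions of the slice. Two observations make this work for octonions, although their
  product is not associative. First, no re-bracketing occurs: the derivative of \<open>f\<close>
  enters through the sum of the terms \<open>E (y - x) \<odot> (b i \<odot> \<partial>\<^sub>i
  f)\<close>, which is zero by the differential equation and linearity, and the derivative of
  \<open>E\<close> enters only through expressions \<open>oconj z \<odot> (z \<odot> f)\<close>,
  which alternativity evaluates to \<open>(z \<bullet> z) f\<close> (lemma
  \<open>oconj_omult_omult\<close>). Second, instead of cutting out a small ball around the
  singularity, the kernel is made linear inside the ball of radius \<open>\<epsilon>\<close>. The
  sum of the divergences is then \<open>f\<close> divided by the volume of this ball inside the ball
  and 0 outside. So the boundary integral is the mean of \<open>f\<close> over every small ball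
  around \<open>x\<close> (lemmas \<open>boundary_integral_eq_ball_integral\<close> and
  \<open>ball_mean_approximates\<close>), which tends to \<open>f x\<close>.

  Most of the work is the divergence theorem itself, for a bounded set with smooth boundary in a
  coordinate subspace. Near a boundary point the set is one side of a graph; a cutoff in the height
  above the graph and Fubini's theorem give the theorem for fields supported there (lemma
  \<open>local_divergence\<close>). The surface measure is specified by its values on all graph
  patches, so its existence requires that two patches define the same measure where they overlap.
  This follows from the local divergence theorem, because its volume side does not depend on the
  patch (lemma \<open>patch_measures_agree_on_ball\<close>). The exterior normal is identified with
  the normalised gradient of the height function (lemma
  \<open>unit_exterior_normal_eq\<close>).\<close>

section \<open>Lebesgue measure on a coordinate subspace\<close>

lemma emeasure_PiM_cube_finite:
  fixes I :: "'i set"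
  assumes "finite I"
  shows "emeasure (Pi\<^sub>M I (\<lambda>_. lborel :: real measure)) {c \<in> space (Pi\<^sub>M I (\<lambda>_. lborel)). \<forall>i\<in>I. \<bar>c i\<bar> \<le> R} < \<infinity>"
proof -
  interpret product_sigma_finite "\<lambda>_::'i. lborel :: real measure" by standard
  have "{c \<in> space (Pi\<^sub>M I (\<lambda>_. lborel)). \<forall>i\<in>I. \<bar>c i\<bar> \<le> R} = (\<Pi>\<^sub>E i\<in>I. {-R..R})"
    by (auto simp: space_PiM PiE_def Pi_def abs_le_iff)
  also have "emeasure (Pi\<^sub>M I (\<lambda>_. lborel)) \<dots> = (\<Prod>i\<in>I. emeasure lborel {-R..R})"
    using assms by (subst emeasure_PiM) auto
  also have "\<dots> < \<infinity>"
    using assms by (auto simp: less_top[symmetric] power_eq_top_ennreal emeasure_lborel_Icc_eq)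
  finally show ?thesis .
qed

text \<open>Reduces the volume of a ball to that of a ball centred at the origin.\<close>

lemma distr_PiM_lborel_translate:
  fixes a :: "'i \<Rightarrow> real"
  assumes "finite I"
  shows "distr (Pi\<^sub>M I (\<lambda>_. lborel :: real measure)) (Pi\<^sub>M I (\<lambda>_. lborel)) (\<lambda>c. \<lambda>i\<in>I. a i + c i) = Pi\<^sub>M I (\<lambda>_. lborel)"
proof -
  interpret product_sigma_finite "\<lambda>_::'i. lborel :: real measure" by standard
  have mf: "(\<lambda>c. \<lambda>i\<in>I. a i + c i) \<in> measurable (Pi\<^sub>M I (\<lambda>_. lborel :: real measure)) (Pi\<^sub>M I (\<lambda>_. lborel))"
    by (rule measurable_restrict) simp
  show ?thesis
  proof (rule PiM_eqI[OF assms])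
    fix A :: "'i \<Rightarrow> real set" assume A: "\<And>i. i \<in> I \<Longrightarrow> A i \<in> sets lborel"
    have eq: "(\<lambda>c. \<lambda>i\<in>I. a i + c i) -` Pi\<^sub>E I A \<inter> space (Pi\<^sub>M I (\<lambda>_. lborel)) = Pi\<^sub>E I (\<lambda>i. (+) (a i) -` A i)"
      by (auto simp: space_PiM PiE_def Pi_def extensional_def)
    have "emeasure lborel ((+) (a i) -` A i) = emeasure lborel (A i)" if "i \<in> I" for i
    proof -
      have "emeasure lborel (A i) = emeasure (distr lborel borel ((+) (a i))) (A i)"
        by (simp add: lborel_distr_plus)
      also have "\<dots> = emeasure lborel ((+) (a i) -` A i)"
        using A[OF that] by (subst emeasure_distr) auto
      finally show ?thesis by simp
    qed
    moreover have "(+) (a i) -` A i \<in> sets lborel" if "i \<in> I" for i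
      using A[OF that] measurable_sets[of "(+) (a i)" borel borel "A i"] by simp
    ultimately show "emeasure (distr (Pi\<^sub>M I (\<lambda>_. lborel)) (Pi\<^sub>M I (\<lambda>_. lborel)) (\<lambda>c. \<lambda>i\<in>I. a i + c i)) (Pi\<^sub>E I A) =
         (\<Prod>i\<in>I. emeasure lborel (A i))"
      using A assms mf by (subst emeasure_distr) (auto simp: eq emeasure_PiM sets_PiM_I_finite)
  qed simp
qed

lemma has_vector_derivative_line:
  fixes F :: "'a::real_normed_vector \<Rightarrow> 'c::real_normed_vector"
  assumes "((\<lambda>t. F (y + t *\<^sub>R v)) has_vector_derivative D) (at 0)" and "y = x + t0 *\<^sub>R v"
  shows "((\<lambda>t. F (x + t *\<^sub>R v)) has_vector_derivative D) (at t0)"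
proof -
  have "((\<lambda>t. t - t0) has_real_derivative 1) (at t0)" by (auto intro!: derivative_eq_intros)
  with assms(1) have "((\<lambda>t. F (y + t *\<^sub>R v)) \<circ> (\<lambda>t. t - t0) has_vector_derivative 1 *\<^sub>R D) (at t0)"
    by (intro vector_diff_chain_at) (auto simp: has_real_derivative_iff_has_vector_derivative)
  moreover have "(\<lambda>t. F (y + t *\<^sub>R v)) \<circ> (\<lambda>t. t - t0) = (\<lambda>t. F (x + t *\<^sub>R v))"

  proof
    fix t
    have "t0 *\<^sub>R v + (t - t0) *\<^sub>R v = t *\<^sub>R v" unfolding scaleR_add_left[symmetric] by simp
    then show "((\<lambda>t. F (y + t *\<^sub>R v)) \<circ> (\<lambda>t. t - t0)) t = F (x + t *\<^sub>R v)"
      by (simp add: assms(2) add.assoc)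
  qed
  ultimately show ?thesis by simp
qed

lemma has_vector_derivative_transform_line:
  assumes "(f has_vector_derivative D) (at (0::real))" "eventually (\<lambda>t. f t = g t) (nhds 0)"
  shows "(g has_vector_derivative D) (at 0)"
proof -
  from eventually_nhds_x_imp_x[OF assms(2)] have "f 0 = g 0" .
  with assms show ?thesis
    unfolding has_vector_derivative_def
    by (intro has_derivative_transform_eventually[OF assms(1)[unfolded has_vector_derivative_def]])
      (auto intro: eventually_mono simp: eventually_nhds_conv_at)
qed

lemma has_real_derivative_locally_const:
  fixes \<phi> :: "'a::real_normed_vector \<Rightarrow> real"
  assumes "((\<lambda>t. \<phi> (y + t *\<^sub>R v)) has_real_derivative D) (at 0)" and N: "open N" "y \<in> N"
    and c: "\<And>z. z \<in> N \<Longrightarrow> \<phi> z = c"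
  shows "D = 0"
proof -
  have "((\<lambda>t. y + t *\<^sub>R v) \<longlongrightarrow> y + 0 *\<^sub>R v) (nhds (0::real))"
    by (intro tendsto_intros filterlim_ident)
  from topological_tendstoD[OF this, of N] N
  have "eventually (\<lambda>t. y + t *\<^sub>R v \<in> N) (nhds 0)" by simp
  then have "eventually (\<lambda>t. \<phi> (y + t *\<^sub>R v) = c) (nhds 0)"
    by (rule eventually_mono) (rule c)
  then have "((\<lambda>t. c) has_real_derivative D) (at 0)"
    using assms(1) DERIV_cong_ev[OF refl, of "\<lambda>t. \<phi> (y + t *\<^sub>R v)" "\<lambda>t. c" 0 D] by simp
  then show ?thesis by (rule DERIV_unique) simp
qed

text \<open>An orthonormal system spans a copy of \<open>m\<close>-dimensional Euclidean space
  inside the ambient space. The dimension has to be a number here and not a type, since it is a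
  parameter of the slices, so that measures on the span are built from products of one-dimensional
  Lebesgue measures.\<close>

locale frame =
  fixes b :: "nat \<Rightarrow> 'a::euclidean_space" and m :: nat
  assumes orth: "\<And>i j. i < m \<Longrightarrow> j < m \<Longrightarrow> b i \<bullet> b j = (if i = j then 1 else 0)"
begin

abbreviation "V \<equiv> coord_space b m"

definition emb :: "(nat \<Rightarrow> real) \<Rightarrow> 'a" where
  "emb c = (\<Sum>i<m. c i *\<^sub>R b i)"

lemma b_in_V: "i < m \<Longrightarrow> b i \<in> V"
  by (auto simp: coord_space_def intro: span_base)

lemma subspace_V: "subspace V" by (simp add: coord_space_def)

lemma closed_V: "closed V" by (simp add: coord_space_def)

lemma V_borel [measurable]: "V \<in> sets borel" using closed_V by auto

lemma openin_borel:
  assumes "openin (top_of_set V) G" shows "G \<in> sets borel"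
  using openin_open[THEN iffD1, OF assms] V_borel by auto

lemma emb_in_V: "emb c \<in> V"
  unfolding emb_def by (intro subspace_sum subspace_V subspace_scale b_in_V) auto

lemma inner_emb: "j < m \<Longrightarrow> emb c \<bullet> b j = c j"
  by (simp add: emb_def inner_sum_left orth if_distrib cong: if_cong)

lemma emb_inner: assumes "y \<in> V" shows "emb (\<lambda>i. y \<bullet> b i) = y"
proof -
  have "y \<in> span (b ` {..<m})" using assms by (simp add: coord_space_def)
  then show ?thesis
  proof (induction rule: span_induct)
    case (step x)
    then obtain j where j: "j < m" "x = b j" by auto
    have "emb (\<lambda>i. b j \<bullet> b i) = (\<Sum>i<m. (if j = i then 1 else 0) *\<^sub>R b i)"
      unfolding emb_def using j by (intro sum.cong) (auto simp: orth)
    also have "\<dots> = b j" using j by (simp add: if_distrib[of "\<lambda>c. c *\<^sub>R _"] cong: if_cong)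
    finally show ?case using j by simp
  next
    case base
    show ?case
      by (auto simp: subspace_def emb_def inner_add_left scaleR_add_left sum.distrib
          scaleR_scaleR[symmetric] scaleR_sum_right[symmetric] simp del: scaleR_scaleR)
  qed
qed

lemma norm_V: assumes "y \<in> V" shows "(norm y)\<^sup>2 = (\<Sum>i<m. (y \<bullet> b i)\<^sup>2)"
proof -
  have "(norm y)\<^sup>2 = emb (\<lambda>i. y \<bullet> b i) \<bullet> y"
    using assms by (simp add: emb_inner dot_square_norm)
  also have "\<dots> = (\<Sum>i<m. (y \<bullet> b i) * (b i \<bullet> y))"
    by (simp only: emb_def inner_sum_left inner_scaleR_left)
  also have "\<dots> = (\<Sum>i<m. (y \<bullet> b i)\<^sup>2)" by (simp add: power2_eq_square inner_commute)
  finally show ?thesis .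
qed

lemma norm_b: "i < m \<Longrightarrow> norm (b i) = 1"
  using orth[of i i] by (simp add: norm_eq_sqrt_inner)

lemma abs_inner_b_le: "i < m \<Longrightarrow> \<bar>y \<bullet> b i\<bar> \<le> norm y"
  using Cauchy_Schwarz_ineq2[of y "b i"] by (simp add: norm_b)

lemma V_eqI: assumes "x \<in> V" "y \<in> V" "\<And>i. i < m \<Longrightarrow> x \<bullet> b i = y \<bullet> b i" shows "x = y"
proof -
  have "emb (\<lambda>i. x \<bullet> b i) = emb (\<lambda>i. y \<bullet> b i)"
    unfolding emb_def using assms(3) by (intro sum.cong) auto
  then show ?thesis using assms by (simp add: emb_inner)
qed

lemma add_in_V: "x \<in> V \<Longrightarrow> i < m \<Longrightarrow> x + t *\<^sub>R b i \<in> V"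
  by (intro subspace_add subspace_V subspace_scale b_in_V)

lemma base_point_in_V: "base_point b m k c \<in> V"
  unfolding base_point_def by (intro subspace_sum subspace_V subspace_scale b_in_V) auto

lemma base_point_inner:
  assumes "k < m" "i < m"
  shows "base_point b m k c \<bullet> b i = (if i = k then 0 else c i)"
proof -
  have "base_point b m k c \<bullet> b i = (\<Sum>j\<in>{..<m}-{k}. c j * (if j = i then 1 else 0))"
    unfolding base_point_def inner_sum_left inner_scaleR_left
    using assms by (intro sum.cong) (auto simp: orth)
  also have "\<dots> = (if i = k then 0 else c i)" using assms by (auto simp: if_distrib cong: if_cong)
  finally show ?thesis .
qed

lemma drop_coord_in_V: "y \<in> V \<Longrightarrow> k < m \<Longrightarrow> drop_coord b k y \<in> V"
  unfolding drop_coord_def by (intro subspace_diff subspace_V subspace_scale b_in_V)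

lemma drop_coord_inner: "k < m \<Longrightarrow> i < m \<Longrightarrow> drop_coord b k y \<bullet> b i = (if i = k then 0 else y \<bullet> b i)"
  by (auto simp: drop_coord_def inner_diff_left orth)

lemma drop_coord_eq_base: "y \<in> V \<Longrightarrow> k < m \<Longrightarrow> drop_coord b k y = base_point b m k (\<lambda>i. y \<bullet> b i)"
  by (rule V_eqI) (auto simp: drop_coord_in_V base_point_in_V base_point_inner drop_coord_inner)

lemma drop_coord_line:
  assumes "k < m"
  shows "drop_coord b k (base_point b m k c + t *\<^sub>R b k) = base_point b m k c"
  using assms by (simp add: drop_coord_def inner_add_left base_point_inner orth)

lemma line_inner: "k < m \<Longrightarrow> (base_point b m k c + t *\<^sub>R b k) \<bullet> b k = t"
  by (simp add: inner_add_left base_point_inner orth)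

lemma emb_upd: assumes "k < m" shows "emb (c(k := t)) = base_point b m k c + t *\<^sub>R b k"
  using assms by (intro V_eqI emb_in_V add_in_V base_point_in_V)
     (auto simp: inner_emb inner_add_left base_point_inner orth)

lemma continuous_drop_coord [continuous_intros]:
  "continuous_on S f \<Longrightarrow> continuous_on S (\<lambda>x. drop_coord b k (f x))"
  unfolding drop_coord_def by (intro continuous_intros)

lemma norm_base_point_le:
  assumes k: "k < m"
  shows "norm (base_point b m k c) \<le> norm (base_point b m k c + t *\<^sub>R b k)"
proof -
  let ?x = "base_point b m k c"
  have "(norm ?x)\<^sup>2 \<le> (norm ?x)\<^sup>2 + t\<^sup>2" by simp
  also have "\<dots> = (norm (?x + t *\<^sub>R b k))\<^sup>2"
    using base_point_inner[OF k k, of c] unfolding power2_norm_eq_inner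
    by (simp add: inner_add_left inner_add_right inner_commute[of "b k" ?x] orth[OF k k] power2_eq_square)
  finally show ?thesis by (rule power2_le_imp_le) simp
qed

text \<open>Lebesgue measure of the span, as a Borel measure on the ambient space that is
  concentrated on the span. In this form functions on the ambient space can be integrated without
  mentioning coordinates.\<close>

definition vol :: "'a measure" where
  "vol = distr (Pi\<^sub>M {..<m} (\<lambda>_. lborel)) borel emb"

abbreviation "base_measure k \<equiv> Pi\<^sub>M ({..<m} - {k}) (\<lambda>_. lborel :: real measure)"

lemma sets_vol [measurable_cong, simp]: "sets vol = sets borel" by (simp add: vol_def)

lemma measurable_emb [measurable]: "emb \<in> borel_measurable (Pi\<^sub>M {..<m} (\<lambda>_. lborel))"
  unfolding emb_def[abs_def]
  by (intro borel_measurable_sum borel_measurable_scaleR borel_measurable_const)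
     (use measurable_component_singleton[of _ "{..<m}" "\<lambda>_. lborel"] in simp)

lemma measurable_base_point [measurable]: "base_point b m k \<in> borel_measurable (base_measure k)"
  unfolding base_point_def[abs_def]
  by (intro borel_measurable_sum borel_measurable_scaleR borel_measurable_const)
     (use measurable_component_singleton[of _ "{..<m}-{k}" "\<lambda>_. lborel"] in simp)

text \<open>The only access to iterated integrals: one coordinate \<open>k\<close> is singled out,
  and the others are the ones over which hypersurfaces are graphs.\<close>

lemma vol_fubini:
  fixes f :: "'a \<Rightarrow> 'c::euclidean_space"
  assumes k: "k < m" and f: "integrable vol f"
  shows "integral\<^sup>L vol f = (\<integral>c. (\<integral>t. f (base_point b m k c + t *\<^sub>R b k) \<partial>lborel) \<partial>base_measure k)"
proof -
  interpret product_sigma_finite "\<lambda>_::nat. lborel :: real measure" by standard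
  have ins: "insert k ({..<m} - {k}) = {..<m}" using k by auto
  have fm: "f \<in> borel_measurable borel" using f by (auto simp: integrable_iff_bounded)
  have "integrable (Pi\<^sub>M {..<m} (\<lambda>_. lborel)) (\<lambda>c. f (emb c))"
    using f fm unfolding vol_def by (subst (asm) integrable_distr_eq) auto
  then have "integral\<^sup>L (Pi\<^sub>M (insert k ({..<m} - {k})) (\<lambda>_. lborel)) (\<lambda>c. f (emb c))
     = (\<integral>c. (\<integral>t. f (emb (c(k := t))) \<partial>lborel) \<partial>base_measure k)"
    by (intro product_integral_insert) (simp_all only: ins, auto)
  note this[unfolded ins]
  then show ?thesis
    using fm unfolding vol_def by (subst integral_distr) (auto simp: emb_upd[OF k])
qed

lemma vol_bounded_finite: assumes "bounded A" "A \<in> sets borel" shows "emeasure vol A < \<infinity>"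
proof -
  from assms obtain R where R: "\<And>y. y \<in> A \<Longrightarrow> norm y \<le> R" by (auto simp: bounded_iff)
  have "emeasure vol A \<le> emeasure (Pi\<^sub>M {..<m} (\<lambda>_. lborel)) {c \<in> space (Pi\<^sub>M {..<m} (\<lambda>_. lborel)). \<forall>i\<in>{..<m}. \<bar>c i\<bar> \<le> R}"
    unfolding vol_def using assms(2)
  proof (subst emeasure_distr; (intro emeasure_mono)?)
    show "emb -` A \<inter> space (Pi\<^sub>M {..<m} (\<lambda>_. lborel)) \<subseteq> {c \<in> space (Pi\<^sub>M {..<m} (\<lambda>_. lborel)). \<forall>i\<in>{..<m}. \<bar>c i\<bar> \<le> R}"
    proof safe
      fix c i assume "emb c \<in> A" "i < m"
      then show "\<bar>c i\<bar> \<le> R" using R[of "emb c"] abs_inner_b_le[of i "emb c"] by (simp add: inner_emb)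
    qed
  qed auto
  also have "\<dots> < \<infinity>" by (rule emeasure_PiM_cube_finite) simp
  finally show ?thesis .
qed

lemma base_measure_bounded_finite:
  assumes k: "k < m"
  shows "emeasure (base_measure k) {c \<in> space (base_measure k). norm (base_point b m k c) \<le> R} < \<infinity>"
proof -
  have "emeasure (base_measure k) {c \<in> space (base_measure k). norm (base_point b m k c) \<le> R} \<le>
     emeasure (base_measure k) {c \<in> space (base_measure k). \<forall>i\<in>{..<m}-{k}. \<bar>c i\<bar> \<le> R}"
  proof (intro emeasure_mono subsetI CollectI conjI ballI)
    fix c i assume "c \<in> {c \<in> space (base_measure k). norm (base_point b m k c) \<le> R}" "i \<in> {..<m} - {k}"
    then show "\<bar>c i\<bar> \<le> R" using abs_inner_b_le[of i "base_point b m k c"] k by (auto simp: base_point_inner)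
  qed auto
  also have "\<dots> < \<infinity>" by (rule emeasure_PiM_cube_finite) simp
  finally show ?thesis .
qed

lemma AE_vol_V: "AE y in vol. y \<in> V"
  unfolding vol_def by (subst AE_distr_iff) (auto simp: emb_in_V)

text \<open>The coordinates of the ball form a translate of a centred ball in the product
  space.\<close>

lemma vol_cball:
  assumes x: "x \<in> V" and r: "r > 0"
  shows "emeasure vol (cball x r) = ennreal (unit_ball_vol (real m) * r ^ m)"
proof -
  let ?L = "Pi\<^sub>M {..<m} (\<lambda>_. lborel :: real measure)"
  let ?T = "\<lambda>c. \<lambda>i\<in>{..<m}. (x \<bullet> b i) + c i"
  have mT: "?T \<in> measurable ?L ?L" by (rule measurable_restrict) simp
  have "emeasure vol (cball x r) = emeasure (distr ?L ?L ?T) (emb -` cball x r \<inter> space ?L)"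
    unfolding vol_def distr_PiM_lborel_translate[OF finite_lessThan] by (subst emeasure_distr) auto
  also have "\<dots> = emeasure ?L (?T -` (emb -` cball x r \<inter> space ?L) \<inter> space ?L)"
    using mT by (subst emeasure_distr) auto
  also have "?T -` (emb -` cball x r \<inter> space ?L) \<inter> space ?L = {f. sqrt (\<Sum>i\<in>{..<m}. (f i)\<^sup>2) \<le> r} \<inter> space ?L"
  proof -
    have "emb (?T c) \<in> cball x r \<longleftrightarrow> sqrt (\<Sum>i\<in>{..<m}. (c i)\<^sup>2) \<le> r" for c
    proof -
      have e: "emb (?T c) = x + emb c"
        using x by (intro V_eqI emb_in_V subspace_add subspace_V) (auto simp: inner_emb inner_add_left)
      have "dist x (emb (?T c)) = sqrt ((norm (emb c))\<^sup>2)" by (simp add: e dist_norm)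
      also have "(norm (emb c))\<^sup>2 = (\<Sum>i\<in>{..<m}. (c i)\<^sup>2)"
        by (subst norm_V) (auto simp: emb_in_V inner_emb)
      finally show ?thesis by (simp only: mem_cball)
    qed
    moreover have "?T c \<in> space ?L" if "c \<in> space ?L" for c by (simp add: space_PiM)
    ultimately show ?thesis by auto
  qed
  also have "emeasure ?L \<dots> = ennreal (unit_ball_vol (real m) * r ^ m)"
    using emeasure_cball_aux[of "{..<m}" r] r by simp
  finally show ?thesis .
qed

lemma integrable_vol_bounded:
  fixes f :: "'a \<Rightarrow> 'c::euclidean_space"
  assumes [measurable]: "f \<in> borel_measurable borel" and "\<And>y. norm (f y) \<le> B" "\<And>y. norm y > R \<Longrightarrow> f y = 0"
  shows "integrable vol f"
proof -
  have "integrable vol (\<lambda>y. indicator (cball 0 R) y *\<^sub>R f y)"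
  proof (rule integrableI_bounded_set_indicator[where B = B])
    show "emeasure vol (cball 0 R) < \<infinity>" by (rule vol_bounded_finite) auto
  qed (use assms(2) in auto)
  also have "(\<lambda>y. indicator (cball 0 R) y *\<^sub>R f y) = f"
    using assms(3) by (auto simp: indicator_def fun_eq_iff)
  finally show ?thesis .
qed

lemma eventually_line_openin:
  assumes "openin (top_of_set V) A" "y \<in> A" "i < m"
  shows "eventually (\<lambda>t. y + t *\<^sub>R b i \<in> A) (nhds 0)"
proof -
  from assms(1) obtain T where T: "open T" "A = V \<inter> T" by (auto simp: openin_open)
  have "((\<lambda>t. y + t *\<^sub>R b i) \<longlongrightarrow> y + 0 *\<^sub>R b i) (nhds 0)"
    by (intro tendsto_intros filterlim_ident)
  then have "eventually (\<lambda>t. y + t *\<^sub>R b i \<in> T) (nhds 0)"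
    using T assms(2) by (auto simp: tendsto_def)
  then show ?thesis using T assms by (auto simp: add_in_V elim!: eventually_mono)
qed

text \<open>On every line in direction \<open>b i\<close> this is the fundamental theorem of
  calculus for a function with compact support, and Fubini does the rest. Finitely many exceptional
  points on each line do no harm; this leaves room for fields with a kink on a sphere, which the
  regularised Cauchy kernel has.\<close>

lemma integral_partial_deriv_eq_0:
  fixes F F' :: "'a \<Rightarrow> 'c::euclidean_space"
  assumes i: "i < m" and A: "openin (top_of_set V) A" and C: "compact C" "C \<subseteq> A"
    and F0: "\<And>y. y \<in> A - C \<Longrightarrow> F y = 0" and F'0: "\<And>y. y \<in> A - C \<Longrightarrow> F' y = 0"
    and cont: "continuous_on A F"
    and der: "\<And>y. y \<in> A - Z \<Longrightarrow> ((\<lambda>t. F (y + t *\<^sub>R b i)) has_vector_derivative F' y) (at 0)"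
    and Z: "\<And>y. finite {t. y + t *\<^sub>R b i \<in> Z}"
    and meas: "(\<lambda>y. indicator A y *\<^sub>R F' y) \<in> borel_measurable borel"
    and bdd: "\<And>y. y \<in> A \<Longrightarrow> norm (F' y) \<le> B"
  shows "(\<integral>y. indicator A y *\<^sub>R F' y \<partial>vol) = 0"
proof -
  define P where "P y = (if y \<in> A then F y else 0)" for y
  define P' where "P' y = indicator A y *\<^sub>R F' y" for y
  from compact_imp_bounded[OF C(1)] obtain R where R: "\<And>y. y \<in> C \<Longrightarrow> norm y \<le> R"
    by (auto simp: bounded_iff)
  have "A \<subseteq> V" using A openin_subset by fastforce
  have VC: "openin (top_of_set V) (V - C)"
    using C \<open>A \<subseteq> V\<close> by (intro openin_diff) (auto intro!: closed_subset compact_imp_closed)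
  have P0: "P y = 0" "P' y = 0" if "y \<notin> C" for y
    using F0[of y] F'0[of y] that by (auto simp: P_def P'_def indicator_def)
  have contP: "continuous_on V P"
  proof -
    have "continuous_on A P" using cont by (rule continuous_on_eq) (auto simp: P_def)
    moreover have "continuous_on (V - C) P"
      by (rule continuous_on_eq[OF continuous_on_const[of _ 0]]) (auto simp: P0)
    moreover have "A \<union> (V - C) = V" using \<open>A \<subseteq> V\<close> C by auto
    ultimately show ?thesis
      using A VC continuous_on_Un_local_open[of A "V - C" P] by simp
  qed
  have derP: "((\<lambda>t. P (y + t *\<^sub>R b i)) has_vector_derivative P' y) (at 0)" if y: "y \<in> V - Z" for y
  proof (cases "y \<in> A")
    case True
    have "((\<lambda>t. F (y + t *\<^sub>R b i)) has_vector_derivative F' y) (at 0)" using y True der by auto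
    then have "((\<lambda>t. P (y + t *\<^sub>R b i)) has_vector_derivative F' y) (at 0)"
      by (rule has_vector_derivative_transform_line)
         (use eventually_line_openin[OF A True i] in \<open>auto elim!: eventually_mono simp: P_def\<close>)
    then show ?thesis using True by (simp add: P'_def)
  next
    case False
    then have "y \<in> V - C" using y C by auto
    from eventually_line_openin[OF VC this i]
    have "((\<lambda>t. P (y + t *\<^sub>R b i)) has_vector_derivative 0) (at 0)"
      by (intro has_vector_derivative_transform_line[OF has_vector_derivative_const[of 0]])
         (auto elim!: eventually_mono simp: P0)
    then show ?thesis using False by (simp add: P'_def)
  qed
  have P'meas[measurable]: "P' \<in> borel_measurable borel" using meas by (simp add: P'_def[abs_def])
  have P'B: "norm (P' y) \<le> \<bar>B\<bar>" for y using bdd[of y] by (auto simp: P'_def indicator_def)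
  have int: "integrable vol P'"
  proof (rule integrable_vol_bounded)
    show "P' y = 0" if "norm y > R" for y using P0(2)[of y] R[of y] that by auto
  qed (use P'B in auto)
  have inner0: "(\<integral>t. P' (base_point b m i c + t *\<^sub>R b i) \<partial>lborel) = 0" for c
  proof -
    let ?x = "base_point b m i c"
    let ?\<phi> = "\<lambda>t. P (?x + t *\<^sub>R b i)" and ?\<phi>' = "\<lambda>t. P' (?x + t *\<^sub>R b i)"
    have out: "?x + t *\<^sub>R b i \<notin> C" if "\<bar>t\<bar> > R" for t
      using abs_inner_b_le[OF i, of "?x + t *\<^sub>R b i"] R[of "?x + t *\<^sub>R b i"] that line_inner[OF i] by auto
    define T where "T = \<bar>R\<bar> + 1"
    have "(?\<phi>' has_integral (?\<phi> T - ?\<phi> (-T))) {-T..T}"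
    proof (rule fundamental_theorem_of_calculus_strong[OF Z[of ?x]])
      show "-T \<le> T" by (simp add: T_def)
      show "(?\<phi> has_vector_derivative ?\<phi>' t) (at t)" if "t \<in> {-T..T} - {t. ?x + t *\<^sub>R b i \<in> Z}" for t
        by (rule has_vector_derivative_line[OF derP refl]) (use that i in \<open>auto simp: add_in_V base_point_in_V\<close>)
      show "continuous_on {-T..T} ?\<phi>"
        by (rule continuous_on_compose2[OF contP]) (auto intro!: continuous_intros add_in_V base_point_in_V i)
    qed
    then have "(?\<phi>' has_integral 0) {-T..T}"
      using out[of T] out[of "-T"] by (auto simp: P0 T_def)
    then have 1: "(?\<phi>' has_integral 0) UNIV"
      by (rule has_integral_on_superset) (auto intro!: P0 out simp: T_def abs_if split: if_splits)
    have "integrable lborel (\<lambda>t. indicator {-T..T} t *\<^sub>R ?\<phi>' t)"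
      by (rule integrableI_bounded_set_indicator[where B = "\<bar>B\<bar>"]) (use P'B in \<open>auto simp: emeasure_lborel_Icc_eq\<close>)
    also have "(\<lambda>t. indicator {-T..T} t *\<^sub>R ?\<phi>' t) = ?\<phi>'"
    proof
      fix t
      have "?\<phi>' t = 0" if "t \<notin> {-T..T}"
        by (rule P0(2), rule out) (use that in \<open>auto simp: T_def abs_if split: if_splits\<close>)
      then show "indicator {-T..T} t *\<^sub>R ?\<phi>' t = ?\<phi>' t" by (auto simp: indicator_def)
    qed
    finally have "(?\<phi>' has_integral (\<integral>t. ?\<phi>' t \<partial>lborel)) UNIV" by (rule has_integral_integral_lborel)
    with 1 show ?thesis by (rule has_integral_unique[symmetric])
  qed
  have "integral\<^sup>L vol P' = 0"
    using vol_fubini[OF i int] by (simp add: inner0)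
  then show ?thesis by (simp add: P'_def[abs_def])
qed

end

section \<open>A smooth step and one-sided graph charts\<close>

text \<open>The elementary function of class \<open>C\<^sup>1\<close> from which all cutoffs are
  made.\<close>

lemma max0_square_deriv: "((\<lambda>t::real. (max 0 t)\<^sup>2) has_real_derivative 2 * max 0 t) (at t)"
proof -
  consider "t > 0" | "t < 0" | "t = 0" by linarith
  then show ?thesis
  proof cases
    case 1
    have "((\<lambda>t::real. t\<^sup>2) has_real_derivative 2 * max 0 t) (at t)"
      using 1 by (auto intro!: derivative_eq_intros)
    moreover have "eventually (\<lambda>t::real. t\<^sup>2 = (max 0 t)\<^sup>2) (nhds t)"
      using eventually_nhds_in_open[OF open_greaterThan, of t 0] 1 by (auto elim!: eventually_mono)
    ultimately show ?thesis using DERIV_cong_ev[OF refl _ refl, of "\<lambda>t. t\<^sup>2" "\<lambda>t. (max 0 t)\<^sup>2" t] by simp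
  next
    case 2
    have "((\<lambda>t::real. 0::real) has_real_derivative 2 * max 0 t) (at t)"
      using 2 by (auto intro!: derivative_eq_intros)
    moreover have "eventually (\<lambda>t::real. 0 = (max 0 t)\<^sup>2) (nhds t)"
      using eventually_nhds_in_open[OF open_lessThan, of t 0] 2 by (auto elim!: eventually_mono)
    ultimately show ?thesis using DERIV_cong_ev[OF refl _ refl, of "\<lambda>t. 0" "\<lambda>t. (max 0 t)\<^sup>2" t] by simp
  next
    case 3
    have "((\<lambda>h::real. (max 0 h)\<^sup>2 / h) \<longlongrightarrow> 0) (at 0)"
    proof (rule Lim_null_comparison)
      show "\<forall>\<^sub>F h::real in at 0. norm ((max 0 h)\<^sup>2 / h) \<le> \<bar>h\<bar>"
        by (intro always_eventually allI) (auto simp: max_def power2_eq_square)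
      show "((\<lambda>h::real. \<bar>h\<bar>) \<longlongrightarrow> 0) (at 0)" by (auto intro!: tendsto_eq_intros)
    qed
    then show ?thesis using 3 by (simp add: DERIV_def)
  qed
qed

text \<open>A function of class \<open>C\<^sup>1\<close> that rises from 0 to 1 between 1 and 2. The
  denominator never vanishes, because the two squares have no common zero.\<close>

definition smooth_step :: "real \<Rightarrow> real" where
  "smooth_step u = (max 0 (u - 1))\<^sup>2 / ((max 0 (u - 1))\<^sup>2 + (max 0 (2 - u))\<^sup>2)"

definition smooth_step' :: "real \<Rightarrow> real" where
  "smooth_step' u = (2 * max 0 (u - 1) * ((max 0 (u - 1))\<^sup>2 + (max 0 (2 - u))\<^sup>2)
      - (max 0 (u - 1))\<^sup>2 * (2 * max 0 (u - 1) - 2 * max 0 (2 - u)))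
    / ((max 0 (u - 1))\<^sup>2 + (max 0 (2 - u))\<^sup>2)\<^sup>2"

lemma smooth_step_denom_pos: "(max 0 (u - 1))\<^sup>2 + (max 0 (2 - u))\<^sup>2 > (0::real)"
proof (cases "u > 1")
  case True
  then have "(max 0 (u - 1))\<^sup>2 > 0" by simp
  then show ?thesis by (simp add: add_pos_nonneg)
next
  case False
  then have "(max 0 (2 - u))\<^sup>2 > 0" by simp
  then show ?thesis by (simp add: add_nonneg_pos)
qed

lemma smooth_step_deriv: "(smooth_step has_real_derivative smooth_step' u) (at u)"
proof -
  note d = smooth_step_denom_pos[of u]
  have 1: "((\<lambda>u. (max 0 (u - 1))\<^sup>2) has_real_derivative 2 * max 0 (u - 1)) (at u)"
    using DERIV_chain2[OF max0_square_deriv, of "\<lambda>u. u - 1" 1 u UNIV]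
    by (simp add: DERIV_diff[OF DERIV_ident DERIV_const, simplified])
  have 2: "((\<lambda>u. (max 0 (2 - u))\<^sup>2) has_real_derivative - 2 * max 0 (2 - u)) (at u)"
    using DERIV_chain2[OF max0_square_deriv, of "\<lambda>u. 2 - u" "-1" u UNIV]
    by (simp add: DERIV_diff[OF DERIV_const DERIV_ident, simplified])
  show ?thesis
    unfolding smooth_step_def[abs_def] smooth_step'_def
    by (rule DERIV_cong[OF DERIV_divide[OF 1 DERIV_add[OF 1 2]]])
       (use d in \<open>auto simp: power2_eq_square\<close>)
qed

lemma smooth_step_0: "u \<le> 1 \<Longrightarrow> smooth_step u = 0"
  and smooth_step_1: "u \<ge> 2 \<Longrightarrow> smooth_step u = 1"
  and smooth_step'_0: "u \<le> 1 \<or> u \<ge> 2 \<Longrightarrow> smooth_step' u = 0"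
  by (auto simp: smooth_step_def smooth_step'_def power2_eq_square)

lemma smooth_step_bounds: "0 \<le> smooth_step u" "smooth_step u \<le> 1"
  using smooth_step_denom_pos[of u] by (auto simp: smooth_step_def divide_le_eq_1)

lemma smooth_step'_nonneg: "0 \<le> smooth_step' u"
proof -
  have "2 * max 0 (u - 1) * ((max 0 (u - 1))\<^sup>2 + (max 0 (2 - u))\<^sup>2)
      - (max 0 (u - 1))\<^sup>2 * (2 * max 0 (u - 1) - 2 * max 0 (2 - u))
     = 2 * max 0 (u - 1) * max 0 (2 - u) * (max 0 (2 - u) + max 0 (u - 1))"
    by (simp add: power2_eq_square algebra_simps)
  also have "\<dots> \<ge> 0" by (intro mult_nonneg_nonneg add_nonneg_nonneg) auto
  finally show ?thesis unfolding smooth_step'_def by simp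
qed

lemma continuous_smooth_step' [continuous_intros]:
  "continuous_on S f \<Longrightarrow> continuous_on S (\<lambda>x. smooth_step' (f x))"
proof -
  assume f: "continuous_on S f"
  have "(max 0 (u - 1))\<^sup>2 + (max 0 (2 - u))\<^sup>2 \<noteq> (0::real)" for u
    by (rule less_imp_neq[OF smooth_step_denom_pos, symmetric])
  then show ?thesis unfolding smooth_step'_def by (intro continuous_intros f) auto
qed

lemma continuous_smooth_step [continuous_intros]:
  "continuous_on S f \<Longrightarrow> continuous_on S (\<lambda>x. smooth_step (f x))"
proof -
  assume f: "continuous_on S f"
  have "(max 0 (u - 1))\<^sup>2 + (max 0 (2 - u))\<^sup>2 \<noteq> (0::real)" for u
    by (rule less_imp_neq[OF smooth_step_denom_pos, symmetric])
  then show ?thesis unfolding smooth_step_def by (intro continuous_intros f) auto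
qed

lemma smooth_step'_measurable [measurable]: "smooth_step' \<in> borel_measurable borel"
  by (intro borel_measurable_continuous_onI continuous_intros)

lemma smooth_step_measurable [measurable]: "smooth_step \<in> borel_measurable borel"
  by (intro borel_measurable_continuous_onI continuous_intros)

lemma smooth_step'_bounded: obtains B where "\<And>u. \<bar>smooth_step' u\<bar> \<le> B"
proof -
  have "compact (smooth_step' ` {1..2})"
    by (intro compact_continuous_image continuous_intros) auto
  then obtain B where B: "\<And>u. u \<in> {1..2} \<Longrightarrow> \<bar>smooth_step' u\<bar> \<le> B"
    using bounded_iff[THEN iffD1, OF compact_imp_bounded] by (metis imageI real_norm_def)
  have "\<bar>smooth_step' u\<bar> \<le> B" for u
    using B[of u] B[of 1] smooth_step'_0[of u] by (cases "u \<in> {1..2}") auto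
  then show ?thesis by (rule that)
qed

text \<open>The derivative of the step is a probability density on the interval from 1 to 2; it
  turns into a one-dimensional approximate identity at the boundary.\<close>

lemma smooth_step'_integral:
  "integrable lborel smooth_step'" "integral\<^sup>L lborel smooth_step' = 1"
proof -
  obtain B where B: "\<And>u. \<bar>smooth_step' u\<bar> \<le> B" by (rule smooth_step'_bounded) blast
  have "integrable lborel (\<lambda>t. indicator {1..2} t *\<^sub>R smooth_step' t)"
    by (rule integrableI_bounded_set_indicator[where B = B]) (use B in \<open>auto simp: emeasure_lborel_Icc_eq\<close>)
  also have "(\<lambda>t. indicator {1..2} t *\<^sub>R smooth_step' t) = smooth_step'"

  proof
    show "indicator {1..2} t *\<^sub>R smooth_step' t = smooth_step' t" for t
      using smooth_step'_0[of t] by (cases "t \<in> {1..2}") auto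
  qed
  finally show i: "integrable lborel smooth_step'" .
  have "(smooth_step' has_integral (smooth_step 2 - smooth_step 1)) {1..2}"
    by (rule fundamental_theorem_of_calculus)
      (auto intro: has_vector_derivative_at_within smooth_step_deriv[unfolded has_real_derivative_iff_has_vector_derivative])
  then have "(smooth_step' has_integral 1) {1..2}" by (simp add: smooth_step_0 smooth_step_1)
  then have "(smooth_step' has_integral 1) UNIV"
    by (rule has_integral_on_superset) (auto intro: smooth_step'_0)
  with has_integral_integral_lborel[OF i] show "integral\<^sup>L lborel smooth_step' = 1"
    by (rule has_integral_unique)
qed

lemma C_inf_has_derivative: "C_inf g \<Longrightarrow> (g has_derivative frechet_derivative g (at x)) (at x)"
proof -
  assume "C_inf g"
  then have "Ck (Suc 0) g" by (simp add: C_inf_def del: Ck.simps)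
  then show ?thesis by (auto simp: differentiable_on_def frechet_derivative_works)
qed

lemma C_inf_continuous: "C_inf g \<Longrightarrow> continuous_on S g"
proof -
  assume "C_inf g"
  then have "Ck 0 g" by (simp add: C_inf_def del: Ck.simps)
  then show ?thesis by (auto intro: continuous_on_subset)
qed

lemma C_inf_continuous_derivative:
  "C_inf g \<Longrightarrow> continuous_on S (\<lambda>x. frechet_derivative g (at x) v)"
proof -
  assume "C_inf g"
  then have "Ck (Suc 0) g" by (simp add: C_inf_def del: Ck.simps)
  then show ?thesis by (auto intro: continuous_on_subset)
qed

context frame
begin

text \<open>The signed vertical distance from the graph of \<open>g\<close>, positive on the side
  selected by \<open>s\<close>.\<close>

definition height :: "nat \<Rightarrow> real \<Rightarrow> ('a \<Rightarrow> real) \<Rightarrow> 'a \<Rightarrow> real" where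
  "height k s g y = s * (y \<bullet> b k - g (drop_coord b k y))"

text \<open>Inside the open set \<open>N\<close>, the set \<open>G\<close> is one side of a graph.
  Allowing open sets instead of balls makes the notion stable under shrinking.\<close>

definition one_sided :: "'a set \<Rightarrow> 'a set \<Rightarrow> nat \<Rightarrow> real \<Rightarrow> ('a \<Rightarrow> real) \<Rightarrow> bool" where
  "one_sided G N k s g \<longleftrightarrow> open N \<and> k < m \<and> s \<in> {-1, 1} \<and> C_inf g \<and>
     G \<inter> N = {y \<in> V \<inter> N. height k s g y > 0}"

text \<open>The \<open>i\<close>-th component of the exterior normal before normalisation, which is
  minus the gradient of the height function. The length of this vector is the density of surface
  measure, so that the unit normal times the surface element is free of square roots.\<close>

definition conormal :: "nat \<Rightarrow> real \<Rightarrow> ('a \<Rightarrow> real) \<Rightarrow> nat \<Rightarrow> 'a \<Rightarrow> real" where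
  "conormal k s g i y = s * (if i = k then - 1 else frechet_derivative g (at (drop_coord b k y)) (b i))"

lemma continuous_height: "C_inf g \<Longrightarrow> continuous_on S (height k s g)"
  unfolding height_def[abs_def]
  by (intro continuous_intros continuous_on_compose2[OF C_inf_continuous[of g UNIV]]) auto

lemma continuous_conormal: "C_inf g \<Longrightarrow> continuous_on S (conormal k s g i)"
  unfolding conormal_def[abs_def]
  by (cases "i = k")
     (auto intro!: continuous_intros continuous_on_compose2[OF C_inf_continuous_derivative[of g UNIV]])

lemma drop_coord_add:
  assumes "i < m" "k < m"
  shows "drop_coord b k (y + t *\<^sub>R b i) = drop_coord b k y + t *\<^sub>R (if i = k then 0 else b i)"
  using assms by (auto simp: drop_coord_def inner_add_left orth algebra_simps)

lemma height_deriv: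
  assumes g: "C_inf g" and i: "i < m" "k < m"
  shows "((\<lambda>t. height k s g (y + t *\<^sub>R b i)) has_real_derivative - conormal k s g i y) (at 0)"
proof -
  let ?e = "if i = k then 0 else b i"
  let ?D = "frechet_derivative g (at (drop_coord b k y))"
  have g': "(g has_derivative ?D) (at (drop_coord b k y + 0 *\<^sub>R ?e))"
    using C_inf_has_derivative[OF g, of "drop_coord b k y"] by simp
  interpret D: bounded_linear ?D using g' by (rule has_derivative_bounded_linear)
  have "((\<lambda>t. drop_coord b k y + t *\<^sub>R ?e) has_derivative (\<lambda>t. t *\<^sub>R ?e)) (at 0)"
    by (auto intro!: derivative_eq_intros)
  from has_derivative_compose[OF this g']
  have 1: "((\<lambda>t. g (drop_coord b k y + t *\<^sub>R ?e)) has_real_derivative ?D ?e) (at 0)"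
    by (simp add: has_field_derivative_def D.scaleR mult.commute[of "?D ?e"] mult_commute_abs)
  have "((\<lambda>t. s * ((y + t *\<^sub>R b i) \<bullet> b k - g (drop_coord b k y + t *\<^sub>R ?e)))
      has_real_derivative s * (b i \<bullet> b k - ?D ?e)) (at 0)"
    using 1 by (auto intro!: derivative_eq_intros simp: inner_add_left)
  also have "s * (b i \<bullet> b k - ?D ?e) = - conormal k s g i y"
    using i by (auto simp: conormal_def orth D.zero)
  finally show ?thesis using i by (simp add: height_def drop_coord_add)
qed

lemma coord_closure_eq: "G \<subseteq> V \<Longrightarrow> coord_closure b m G = closure G"
proof -
  assume G: "G \<subseteq> V"
  have "closure G \<subseteq> V" using closure_minimal[OF G closed_V] .
  then show ?thesis
    using G by (simp add: coord_closure_def closure_of_subtopology Int_absorb1)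
qed

lemma coord_boundary_eq:
  assumes "openin (top_of_set V) G"
  shows "coord_boundary b m G = closure G - G"
proof -
  have "G \<subseteq> V" using openin_subset[OF assms] by simp
  with assms show ?thesis
    using coord_closure_eq[of G] unfolding coord_boundary_def coord_closure_def
    by (simp only: frontier_of_openin)
qed

lemma one_sided_subset:
  assumes "one_sided G N k s g" "open N'" "N' \<subseteq> N"
  shows "one_sided G N' k s g"
proof -
  have "G \<inter> N' = (G \<inter> N) \<inter> N'" using assms by auto
  also have "\<dots> = {y \<in> V \<inter> N'. height k s g y > 0}" using assms by (auto simp: one_sided_def)
  finally show ?thesis using assms by (auto simp: one_sided_def)
qed

text \<open>Points of height 0 are limits of points of positive height on the same vertical line,
  and points of negative height have a neighbourhood that avoids \<open>G\<close>.\<close>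

lemma one_sided_closure:
  assumes G: "one_sided G N k s g" and GV: "openin (top_of_set V) G"
  shows "closure G \<inter> N = {y \<in> V \<inter> N. height k s g y \<ge> 0}"
proof -
  have sub: "G \<subseteq> V" using GV openin_subset by fastforce
  from G have N: "open N" "k < m" "s \<in> {-1,1}" "C_inf g" "G \<inter> N = {y \<in> V \<inter> N. height k s g y > 0}"
    unfolding one_sided_def by blast+
  have s2: "s * s = 1" using N(3) by auto
  show ?thesis
  proof (intro equalityI subsetI)
    fix y assume y: "y \<in> closure G \<inter> N"
    have yV: "y \<in> V" using y closure_minimal[OF sub closed_V] by auto
    have "height k s g y \<ge> 0"
    proof (rule ccontr)
      assume "\<not> ?thesis"
      then have "y \<in> N \<inter> height k s g -` {..<0}" using y by auto
      moreover have "open (N \<inter> height k s g -` {..<0})"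
        by (intro open_Int open_vimage continuous_height N open_lessThan)
      ultimately have "(N \<inter> height k s g -` {..<0}) \<inter> G \<noteq> {}"
        using y open_Int_closure_eq_empty[of "N \<inter> height k s g -` {..<0}" G] by blast
      then obtain z where "z \<in> G" "z \<in> N" "height k s g z < 0" by auto
      moreover have "z \<in> {y \<in> V \<inter> N. height k s g y > 0}"
        using calculation N(5) by blast
      ultimately show False by auto
    qed
    then show "y \<in> {y \<in> V \<inter> N. height k s g y \<ge> 0}" using y yV by auto
  next
    fix y assume y: "y \<in> {y \<in> V \<inter> N. height k s g y \<ge> 0}"
    have inG: "y + (t * s) *\<^sub>R b k \<in> G" if "t > 0" "y + (t * s) *\<^sub>R b k \<in> N" for t
    proof -
      have "height k s g (y + (t * s) *\<^sub>R b k) = height k s g y + t * (s * s)"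
        using N(2) by (simp add: height_def drop_coord_add inner_add_left orth algebra_simps)
      then have "height k s g (y + (t * s) *\<^sub>R b k) > 0" using y that s2 by simp
      then have "y + (t * s) *\<^sub>R b k \<in> G \<inter> N"
        unfolding N(5) using that y N(2) by (auto intro: add_in_V)
      then show ?thesis by auto
    qed
    have lim: "((\<lambda>t. y + (t * s) *\<^sub>R b k) \<longlongrightarrow> y + (0 * s) *\<^sub>R b k) (at_right 0)"
      by (intro tendsto_intros)
    have "eventually (\<lambda>t. y + (t * s) *\<^sub>R b k \<in> N) (at_right 0)"
      using topological_tendstoD[OF lim N(1)] y by simp
    moreover have "eventually (\<lambda>t::real. t > 0) (at_right 0)" by (rule eventually_at_right_less)
    ultimately have "eventually (\<lambda>t. y + (t * s) *\<^sub>R b k \<in> G) (at_right 0)"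
      by eventually_elim (rule inG)
    then have "eventually (\<lambda>t. y + (t * s) *\<^sub>R b k \<in> closure G) (at_right 0)"
      by (rule eventually_mono) (use closure_subset in auto)
    from Lim_in_closed_set[OF closed_closure this _ lim] show "y \<in> closure G \<inter> N"
      using y by simp
  qed
qed

lemma one_sided_boundary:
  assumes G: "one_sided G N k s g" and GV: "openin (top_of_set V) G"
  shows "(closure G - G) \<inter> N = {y \<in> V \<inter> N. y \<bullet> b k = g (drop_coord b k y)}"
proof -
  have GN: "G \<inter> N = {y \<in> V \<inter> N. height k s g y > 0}" and s: "s \<in> {-1, 1}"
    using G unfolding one_sided_def by blast+
  have "(closure G - G) \<inter> N = closure G \<inter> N - G \<inter> N" by blast
  also have "\<dots> = {y \<in> V \<inter> N. height k s g y \<ge> 0} - {y \<in> V \<inter> N. height k s g y > 0}"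
    unfolding one_sided_closure[OF assms] GN ..
  also have "\<dots> = {y \<in> V \<inter> N. y \<bullet> b k = g (drop_coord b k y)}"
    using s by (auto simp: height_def)
  finally show ?thesis .
qed

end

section \<open>The divergence theorem near a boundary point\<close>

context frame
begin

text \<open>The fields to which the divergence theorem applies in direction \<open>b i\<close>:
  continuous up to the boundary, with a bounded measurable partial derivative off the exceptional
  set \<open>Z\<close>.\<close>

definition admissible :: "nat \<Rightarrow> 'a set \<Rightarrow> 'a set \<Rightarrow> ('a \<Rightarrow> 'c::euclidean_space) \<Rightarrow> ('a \<Rightarrow> 'c) \<Rightarrow> bool" where
  "admissible i Z G F F' \<longleftrightarrow> continuous_on (closure G) F \<and>
     (\<forall>y\<in>G - Z. ((\<lambda>t. F (y + t *\<^sub>R b i)) has_vector_derivative F' y) (at 0)) \<and>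
     (\<lambda>y. indicator G y *\<^sub>R F' y) \<in> borel_measurable borel \<and> (\<exists>B. \<forall>y\<in>G. norm (F' y) \<le> B)"

lemma admissibleD:
  assumes "admissible i Z G F F'"
  shows "continuous_on (closure G) F"
    "\<And>y. y \<in> G - Z \<Longrightarrow> ((\<lambda>t. F (y + t *\<^sub>R b i)) has_vector_derivative F' y) (at 0)"
    "(\<lambda>y. indicator G y *\<^sub>R F' y) \<in> borel_measurable borel"
    "\<exists>B. \<forall>y\<in>G. norm (F' y) \<le> B"
  using assms unfolding admissible_def by blast+

text \<open>Multiply \<open>F\<close> by a step function of the height that vanishes for heights
  below \<open>\<delta>\<close> and equals 1 for heights above \<open>2\<delta>\<close>. The product
  has compact support in \<open>G\<close>, so the integral of its partial derivative vanishes. The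
  product rule splits that integral in two. One part tends to the integral of \<open>F'\<close>. In
  the other part the derivative of the step is an approximate identity in the vertical variable, so
  that it tends to the values of \<open>F\<close> on the graph, weighted with the derivative of the
  height. All directions are treated alike.\<close>

lemma local_divergence:
  fixes F F' :: "'a \<Rightarrow> 'c::euclidean_space"
  assumes os: "one_sided G N k s g" and GV: "openin (top_of_set V) G" and bG: "bounded G" and i: "i < m"
    and K: "compact K" "K \<subseteq> N"
    and F0: "\<And>y. y \<in> closure G - K \<Longrightarrow> F y = 0" and F'0: "\<And>y. y \<in> G - K \<Longrightarrow> F' y = 0"
    and Z: "\<And>y. finite {t. y + t *\<^sub>R b i \<in> Z}" and ad: "admissible i Z G F F'"
  shows "(\<integral>y. indicator G y *\<^sub>R F' y \<partial>vol) =
     (\<integral>c. conormal k s g i (base_point b m k c) *\<^sub>R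
        (indicator (closure G \<inter> N) (graph_point b m k g c) *\<^sub>R F (graph_point b m k g c)) \<partial>base_measure k)"
proof -
  note cont = admissibleD(1)[OF ad] and der = admissibleD(2)[OF ad] and meas = admissibleD(3)[OF ad]
  obtain B where bdd: "\<And>y. y \<in> G \<Longrightarrow> norm (F' y) \<le> B" using admissibleD(4)[OF ad] by blast
  define A where "A = G \<inter> N"
  define \<delta> where "\<delta> n = inverse (real (Suc n))" for n
  define \<sigma> where "\<sigma> = height k s g"
  define c0 where "c0 = conormal k s g i"
  define Fc where "Fc y = indicator (closure G \<inter> N) y *\<^sub>R F y" for y
  have \<delta>0: "\<delta> n > 0" for n by (simp add: \<delta>_def)
  have \<delta>lim: "\<delta> \<longlonglongrightarrow> 0" unfolding \<delta>_def by (rule LIMSEQ_inverse_real_of_nat)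
  from os have N: "open N" and k: "k < m" and s: "s \<in> {-1,1}" and g: "C_inf g"
    and GN: "A = {y \<in> V \<inter> N. \<sigma> y > 0}"
    by (auto simp: one_sided_def A_def \<sigma>_def)
  have s2: "s * s = 1" "\<bar>s\<bar> = 1" using s by auto
  have GsubV: "G \<subseteq> V" using GV openin_subset by fastforce
  have clN: "closure G \<inter> N = {y \<in> V \<inter> N. \<sigma> y \<ge> 0}"
    unfolding \<sigma>_def by (rule one_sided_closure[OF os GV])
  have AV: "openin (top_of_set V) A"
    unfolding A_def using GV N by (rule openin_Int_open)
  have [measurable]: "G \<in> sets borel" "A \<in> sets borel" "N \<in> sets borel"
    using openin_borel[OF GV] openin_borel[OF AV] N by auto
  have [measurable]: "\<sigma> \<in> borel_measurable borel" "c0 \<in> borel_measurable borel"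
    unfolding \<sigma>_def c0_def
    by (auto intro!: borel_measurable_continuous_onI continuous_height continuous_conormal g)
  have FcA[measurable]: "(\<lambda>y. indicator A y *\<^sub>R F y) \<in> borel_measurable borel"
    by (rule borel_measurable_continuous_on_indicator)
       (use closure_subset[of G] in \<open>auto intro!: continuous_on_subset[OF cont] simp: A_def\<close>)
  have Fcm[measurable]: "Fc \<in> borel_measurable borel"
    unfolding Fc_def[abs_def] using N
    by (intro borel_measurable_continuous_on_indicator) (auto intro!: continuous_on_subset[OF cont])
  have meas'[measurable]: "(\<lambda>y. indicator A y *\<^sub>R F' y) \<in> borel_measurable borel"
  proof -
    have "(\<lambda>y. indicator A y *\<^sub>R F' y) = (\<lambda>y. indicator N y *\<^sub>R (indicator G y *\<^sub>R F' y))"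
      by (auto simp: A_def indicator_def)
    then show ?thesis using meas by (simp del: scaleR_scaleR)
  qed
  have cG: "compact (closure G)" using bG by simp
  obtain BF where BF: "\<And>y. y \<in> closure G \<Longrightarrow> norm (F y) \<le> BF" "BF \<ge> 0"
    by (rule continuous_on_compact_bound[OF cG cont]) blast
  obtain R where R: "\<And>y. y \<in> closure G \<Longrightarrow> norm y \<le> R" "R \<ge> 0"
    using bounded_pos[THEN iffD1, OF compact_imp_bounded[OF cG]] by (auto intro: less_imp_le)
  obtain BN where BN: "\<And>y. norm y \<le> R \<Longrightarrow> \<bar>c0 y\<bar> \<le> BN"
  proof -
    have "compact (c0 ` cball 0 R)"
      unfolding c0_def by (intro compact_continuous_image continuous_conormal g) auto
    then show ?thesis
      using bounded_iff[THEN iffD1, OF compact_imp_bounded] that by (metis imageI mem_cball_0 real_norm_def)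
  qed
  have BN0: "BN \<ge> 0" using order_trans[OF abs_ge_zero BN[of 0]] R by simp
  obtain Bw where Bw: "\<And>u. \<bar>smooth_step' u\<bar> \<le> Bw" by (rule smooth_step'_bounded) blast
  have outA: "y \<notin> A" if "norm y > R" for y using that R(1)[of y] closure_subset[of G] by (auto simp: A_def)
  have Asub: "A \<subseteq> closure G" using closure_subset[of G] by (auto simp: A_def)
  have FcB: "norm (Fc y) \<le> BF" for y using BF by (auto simp: Fc_def indicator_def)

  \<comment> \<open>the two parts of the derivative of the truncated field; the second one lives on heights between \<open>\<delta>\<close> and \<open>2\<delta>\<close>\<close>
  define I1 where "I1 n y = indicator A y *\<^sub>R (smooth_step (\<sigma> y / \<delta> n) *\<^sub>R F' y)" for n y
  define I2 where "I2 n y = indicator A y *\<^sub>R ((smooth_step' (\<sigma> y / \<delta> n) * c0 y / \<delta> n) *\<^sub>R F y)" for n y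
  have I1b: "norm (I1 n y) \<le> indicator A y * \<bar>B\<bar>" for n y
  proof (cases "y \<in> A")
    case True
    have "smooth_step (\<sigma> y / \<delta> n) * norm (F' y) \<le> 1 * norm (F' y)"
      by (intro mult_right_mono smooth_step_bounds) auto
    also have "\<dots> \<le> \<bar>B\<bar>" using bdd[of y] True by (auto simp: A_def)
    finally show ?thesis using True smooth_step_bounds[of "\<sigma> y / \<delta> n"] by (simp add: I1_def)
  qed (simp add: I1_def)
  have I2b: "norm (I2 n y) \<le> Bw * BN * BF / \<delta> n" for n y
  proof (cases "y \<in> A")
    case True
    have "norm (I2 n y) = \<bar>smooth_step' (\<sigma> y / \<delta> n)\<bar> * \<bar>c0 y\<bar> * norm (F y) / \<delta> n"
      using True \<delta>0[of n] by (simp add: I2_def abs_mult)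
    also have "\<dots> \<le> Bw * BN * BF / \<delta> n"
      using True Asub BF BN[of y] Bw[of "\<sigma> y / \<delta> n"] R \<delta>0[of n] order_trans[OF abs_ge_zero Bw[of 0]]
      order_trans[OF abs_ge_zero BN[of y]]
      by (intro divide_right_mono mult_mono mult_nonneg_nonneg) (auto simp: less_imp_le)
    finally show ?thesis .
  next
    case False
    then show ?thesis using BF BN0 \<delta>0[of n] order_trans[OF abs_ge_zero Bw[of 0]]
      by (simp add: I2_def less_imp_le)
  qed
  have I1m[measurable]: "I1 n \<in> borel_measurable borel" for n
  proof -
    have "I1 n = (\<lambda>y. smooth_step (\<sigma> y / \<delta> n) *\<^sub>R (indicator A y *\<^sub>R F' y))"
      by (auto simp: I1_def fun_eq_iff)
    then show ?thesis by (simp only:) (rule borel_measurable_scaleR[OF _ meas']; measurable)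
  qed
  have I2m[measurable]: "I2 n \<in> borel_measurable borel" for n
  proof -
    have "I2 n = (\<lambda>y. (smooth_step' (\<sigma> y / \<delta> n) * c0 y / \<delta> n) *\<^sub>R (indicator A y *\<^sub>R F y))"
      by (auto simp: I2_def fun_eq_iff)
    then show ?thesis by (simp only:) (rule borel_measurable_scaleR[OF _ FcA]; measurable)
  qed
  have int1: "integrable vol (I1 n)" for n
  proof (rule integrable_vol_bounded[where B = "\<bar>B\<bar>" and R = R])
    show "norm (I1 n y) \<le> \<bar>B\<bar>" for y
      using I1b[of n y] by (rule order_trans) (auto simp: indicator_def)
    show "I1 n y = 0" if "norm y > R" for y using outA[OF that] by (simp add: I1_def)
  qed (rule I1m)
  have int2: "integrable vol (I2 n)" for n
    by (rule integrable_vol_bounded[where B = "Bw * BN * BF / \<delta> n" and R = R, OF I2m I2b])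
       (simp add: I2_def outA)

  have eq: "integral\<^sup>L vol (I1 n) = integral\<^sup>L vol (I2 n)" for n
  proof -
    define Fd where "Fd y = smooth_step (\<sigma> y / \<delta> n) *\<^sub>R F y" for y
    define Fd' where "Fd' y = smooth_step (\<sigma> y / \<delta> n) *\<^sub>R F' y - (smooth_step' (\<sigma> y / \<delta> n) * c0 y / \<delta> n) *\<^sub>R F y" for y
    have dec: "indicator A y *\<^sub>R Fd' y = I1 n y - I2 n y" for y
      by (simp add: Fd'_def I1_def I2_def scaleR_diff_right)
    have "(\<integral>y. indicator A y *\<^sub>R Fd' y \<partial>vol) = 0"
    proof (rule integral_partial_deriv_eq_0[OF i AV, where C = "K \<inter> (V \<inter> \<sigma> -` {\<delta> n..})" and F = Fd and Z = Z
            and B = "\<bar>B\<bar> + Bw * BN * BF / \<delta> n"])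
      have "closed (V \<inter> \<sigma> -` {\<delta> n..})"
        unfolding \<sigma>_def by (intro closed_Int closed_V closed_vimage continuous_height g closed_atLeast)
      then show "compact (K \<inter> (V \<inter> \<sigma> -` {\<delta> n..}))" using K(1) by (rule compact_Int_closed[rotated])
      show "K \<inter> (V \<inter> \<sigma> -` {\<delta> n..}) \<subseteq> A" unfolding GN using K(2) \<delta>0[of n] by (auto intro: less_le_trans)
      have z: "smooth_step (\<sigma> y / \<delta> n) = 0 \<and> smooth_step' (\<sigma> y / \<delta> n) = 0 \<or> (F y = 0 \<and> F' y = 0)"
        if "y \<in> A - K \<inter> (V \<inter> \<sigma> -` {\<delta> n..})" for y
      proof (cases "y \<in> K")
        case True
        then have "\<sigma> y / \<delta> n \<le> 1" using that \<delta>0[of n] GsubV by (auto simp: A_def field_simps)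
        then show ?thesis using smooth_step_0 smooth_step'_0 by auto
      next
        case False
        then show ?thesis using that F0[of y] F'0[of y] Asub by (auto simp: A_def)
      qed
      then show "Fd y = 0" "Fd' y = 0" if "y \<in> A - K \<inter> (V \<inter> \<sigma> -` {\<delta> n..})" for y
        using that by (force simp: Fd_def Fd'_def)+
      show "continuous_on A Fd"
        unfolding Fd_def[abs_def] \<sigma>_def using \<delta>0[of n] Asub
        by (intro continuous_intros continuous_height g continuous_on_subset[OF cont]) auto
      show "((\<lambda>t. Fd (y + t *\<^sub>R b i)) has_vector_derivative Fd' y) (at 0)" if y: "y \<in> A - Z" for y
      proof -
        have 1: "((\<lambda>t. \<sigma> (y + t *\<^sub>R b i) / \<delta> n) has_real_derivative - c0 y / \<delta> n) (at 0)"
          using height_deriv[OF g i k, of s y] \<delta>0[of n] unfolding \<sigma>_def c0_def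
          by (auto intro!: derivative_eq_intros)
        have 2: "((\<lambda>t. smooth_step (\<sigma> (y + t *\<^sub>R b i) / \<delta> n)) has_real_derivative
            smooth_step' (\<sigma> y / \<delta> n) * (- c0 y / \<delta> n)) (at 0)"
          using DERIV_chain2[OF smooth_step_deriv 1] by simp
        have "((\<lambda>t. F (y + t *\<^sub>R b i)) has_vector_derivative F' y) (at 0)"
          using der[of y] y by (auto simp: A_def)
        from has_vector_derivative_scaleR[OF 2 this]
        show ?thesis by (simp add: Fd_def[abs_def] Fd'_def)
      qed
      show "finite {t. y + t *\<^sub>R b i \<in> Z}" for y by (rule Z)
      show "(\<lambda>y. indicator A y *\<^sub>R Fd' y) \<in> borel_measurable borel" unfolding dec by simp
      show "norm (Fd' y) \<le> \<bar>B\<bar> + Bw * BN * BF / \<delta> n" if "y \<in> A" for y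
      proof -
        have "Fd' y = I1 n y - I2 n y" using dec[of y] that by simp
        then show ?thesis using norm_triangle_ineq4[of "I1 n y" "I2 n y"] I1b[of n y] I2b[of n y] that by simp
      qed
    qed
    then show ?thesis unfolding dec using int1 int2 by simp
  qed

  have lim1: "(\<lambda>n. integral\<^sup>L vol (I1 n)) \<longlonglongrightarrow> (\<integral>y. indicator A y *\<^sub>R F' y \<partial>vol)"
  proof (rule integral_dominated_convergence)
    show "integrable vol (\<lambda>y. indicator A y * \<bar>B\<bar>)"
      by (rule integrable_vol_bounded[where B = "\<bar>B\<bar>" and R = R])
         (use outA in \<open>auto simp: indicator_def split: if_splits\<close>)
    show "AE y in vol. (\<lambda>n. I1 n y) \<longlonglongrightarrow> indicator A y *\<^sub>R F' y"
    proof (rule AE_I2)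
      fix y
      show "(\<lambda>n. I1 n y) \<longlonglongrightarrow> indicator A y *\<^sub>R F' y"
      proof (cases "y \<in> A")
        case True
        then have "\<sigma> y / 2 > 0" using GN by auto
        from order_tendstoD(2)[OF \<delta>lim this]
        have "eventually (\<lambda>n. I1 n y = indicator A y *\<^sub>R F' y) sequentially"
        proof (rule eventually_mono)
          fix n assume "\<delta> n < \<sigma> y / 2"
          then have "\<sigma> y / \<delta> n \<ge> 2" using \<delta>0[of n] by (simp add: field_simps)
          then show "I1 n y = indicator A y *\<^sub>R F' y" by (simp add: I1_def smooth_step_1)
        qed
        then show ?thesis by (rule tendsto_eventually)
      qed (simp add: I1_def)
    qed
    show "AE y in vol. norm (I1 n y) \<le> indicator A y * \<bar>B\<bar>" for n using I1b by simp
  qed auto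

  \<comment> \<open>the vertical integral of the second part after the substitution \<open>t = g + s \<delta> u\<close>, which makes the density independent of \<open>\<delta>\<close>\<close>
  define J where "J n c = (\<integral>u. smooth_step' u *\<^sub>R
      Fc (base_point b m k c + (g (base_point b m k c) + s * \<delta> n * u) *\<^sub>R b k) \<partial>lborel)" for n c
  have slice: "(\<integral>t. I2 n (base_point b m k c + t *\<^sub>R b k) \<partial>lborel) = c0 (base_point b m k c) *\<^sub>R J n c" for n c
  proof -
    let ?x = "base_point b m k c"
    have drop: "drop_coord b k (?x + t *\<^sub>R b k) = ?x" "drop_coord b k ?x = ?x" for t
      using drop_coord_line[OF k, of c t] drop_coord_line[OF k, of c 0] by auto
    have c0x: "c0 (?x + t *\<^sub>R b k) = c0 ?x" for t by (simp add: c0_def conormal_def drop)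
    have \<sigma>x: "\<sigma> (?x + t *\<^sub>R b k) = s * (t - g ?x)" for t
      using line_inner[OF k] by (simp add: \<sigma>_def height_def drop)
    have "(\<integral>t. I2 n (?x + t *\<^sub>R b k) \<partial>lborel) =
       \<bar>s * \<delta> n\<bar> *\<^sub>R (\<integral>u. I2 n (?x + (g ?x + s * \<delta> n * u) *\<^sub>R b k) \<partial>lborel)"
      using s \<delta>0[of n] by (intro lborel_integral_real_affine) auto
    also have "(\<lambda>u. I2 n (?x + (g ?x + s * \<delta> n * u) *\<^sub>R b k)) =
       (\<lambda>u. (c0 ?x / \<delta> n) *\<^sub>R (smooth_step' u *\<^sub>R Fc (?x + (g ?x + s * \<delta> n * u) *\<^sub>R b k)))"
    proof
      fix u
      let ?y = "?x + (g ?x + s * \<delta> n * u) *\<^sub>R b k"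
      have "\<sigma> ?y = (s * s) * (\<delta> n * u)" unfolding \<sigma>x by (simp add: mult.assoc)
      then have sy: "\<sigma> ?y = \<delta> n * u" using s2 by simp
      have yV: "?y \<in> V" by (intro add_in_V base_point_in_V k)
      have "smooth_step' u = 0 \<or> (?y \<in> A \<longleftrightarrow> ?y \<in> closure G \<inter> N)"
      proof (cases "u > 1")
        case True
        then have "\<sigma> ?y > 0" unfolding sy using \<delta>0[of n] by simp
        then show ?thesis unfolding GN clN using yV by auto
      qed (simp add: smooth_step'_0)
      then show "I2 n ?y = (c0 ?x / \<delta> n) *\<^sub>R (smooth_step' u *\<^sub>R Fc ?y)"
        using \<delta>0[of n] by (auto simp: I2_def Fc_def c0x sy indicator_def)
    qed
    also have "\<bar>s * \<delta> n\<bar> *\<^sub>R (\<integral>u. (c0 ?x / \<delta> n) *\<^sub>R (smooth_step' u *\<^sub>R Fc (?x + (g ?x + s * \<delta> n * u) *\<^sub>R b k)) \<partial>lborel) = c0 ?x *\<^sub>R J n c"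
      unfolding J_def integral_scaleR_right using s2 \<delta>0[of n] by (simp add: abs_mult)
    finally show ?thesis .
  qed
  have Jint: "integrable lborel (\<lambda>u. smooth_step' u *\<^sub>R Fc (x + (a + d * u) *\<^sub>R b k))" for x a d
    by (rule Bochner_Integration.integrable_bound[OF integrable_mult_right[OF smooth_step'_integral(1), of BF]])
       (auto intro!: AE_I2 mult_mono order_trans[OF FcB abs_ge_self] BF simp: smooth_step'_nonneg abs_mult mult.commute[of BF])
  have Jb: "norm (J n c) \<le> BF" for n c
  proof -
    have "norm (J n c) \<le> (\<integral>u. BF * smooth_step' u \<partial>lborel)"
      unfolding J_def
      by (intro order_trans[OF Bochner_Integration.integral_norm_bound] integral_mono integrable_norm Jint
            integrable_mult_right smooth_step'_integral)
         (auto intro!: mult_mono FcB BF simp: smooth_step'_nonneg abs_mult mult.commute[of BF])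
    also have "\<dots> = BF" using smooth_step'_integral by simp
    finally show ?thesis .
  qed
  have Jlim: "(\<lambda>n. J n c) \<longlonglongrightarrow> Fc (graph_point b m k g c)" for c
  proof -
    let ?x = "base_point b m k c" and ?p = "graph_point b m k g c"
    have drop: "drop_coord b k (?x + t *\<^sub>R b k) = ?x" for t
      using drop_coord_line[OF k, of c t] by auto
    have \<sigma>x: "\<sigma> (?x + t *\<^sub>R b k) = s * (t - g ?x)" for t
      using line_inner[OF k] by (simp add: \<sigma>_def height_def drop)
    have "(\<lambda>n. J n c) \<longlonglongrightarrow> (\<integral>u. smooth_step' u *\<^sub>R Fc ?p \<partial>lborel)"
      unfolding J_def
    proof (rule integral_dominated_convergence)
      show "integrable lborel (\<lambda>u. BF * smooth_step' u)"
        by (intro integrable_mult_right smooth_step'_integral)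
      show "AE u in lborel. norm (smooth_step' u *\<^sub>R Fc (?x + (g ?x + s * \<delta> n * u) *\<^sub>R b k)) \<le> BF * smooth_step' u" for n
        by (auto intro!: AE_I2 mult_mono FcB BF simp: smooth_step'_nonneg abs_mult mult.commute[of BF])
      show "AE u in lborel. (\<lambda>n. smooth_step' u *\<^sub>R Fc (?x + (g ?x + s * \<delta> n * u) *\<^sub>R b k)) \<longlonglongrightarrow> smooth_step' u *\<^sub>R Fc ?p"
      proof (rule AE_I2)
        fix u
        show "(\<lambda>n. smooth_step' u *\<^sub>R Fc (?x + (g ?x + s * \<delta> n * u) *\<^sub>R b k)) \<longlonglongrightarrow> smooth_step' u *\<^sub>R Fc ?p"
        proof (cases "u > 1")
          case False
          then show ?thesis by (simp add: smooth_step'_0)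
        next
          case True
          let ?y = "\<lambda>n. ?x + (g ?x + s * \<delta> n * u) *\<^sub>R b k"
          have ylim: "?y \<longlonglongrightarrow> ?p"
            unfolding graph_point_def by (auto intro!: tendsto_eq_intros \<delta>lim)
          have yV: "?y n \<in> V" for n by (intro add_in_V base_point_in_V k)
          have sy: "\<sigma> (?y n) > 0" for n
          proof -
            have "\<sigma> (?y n) = (s * s) * (\<delta> n * u)" unfolding \<sigma>x by (simp add: mult.assoc)
            then show ?thesis using s2 True \<delta>0[of n] by simp
          qed
          have "(\<lambda>n. Fc (?y n)) \<longlonglongrightarrow> Fc ?p"
          proof (cases "?p \<in> N")
            case True
            have pV: "?p \<in> V" unfolding graph_point_def by (intro add_in_V base_point_in_V k)
            have "\<sigma> ?p = 0" unfolding graph_point_def \<sigma>x by simp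
            then have pcl: "?p \<in> closure G \<inter> N" unfolding clN using pV True by simp
            have ev: "eventually (\<lambda>n. ?y n \<in> closure G \<inter> N) sequentially"
              using topological_tendstoD[OF ylim N True]
            proof (rule eventually_mono)
              fix n assume "?y n \<in> N"
              then show "?y n \<in> closure G \<inter> N" unfolding clN using yV[of n] sy[of n] by auto
            qed
            have "(\<lambda>n. F (?y n)) \<longlonglongrightarrow> F ?p"
              by (rule continuous_on_tendsto_compose[OF cont ylim])
                 (use pcl ev in \<open>auto elim: eventually_mono\<close>)
            moreover have "eventually (\<lambda>n. F (?y n) = Fc (?y n)) sequentially"
              using ev by (rule eventually_mono) (simp add: Fc_def)
            ultimately have "(\<lambda>n. Fc (?y n)) \<longlonglongrightarrow> F ?p" by (rule Lim_transform_eventually)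
            then show ?thesis using pcl by (simp add: Fc_def)
          next
            case False
            then have "?p \<in> - K" using K by auto
            from topological_tendstoD[OF ylim _ this] K(1)
            have "eventually (\<lambda>n. ?y n \<in> - K) sequentially"
              by (auto intro: compact_imp_closed)
            then have "eventually (\<lambda>n. Fc (?y n) = 0) sequentially"
              by (rule eventually_mono) (auto simp: Fc_def indicator_def F0)
            then have "(\<lambda>n. Fc (?y n)) \<longlonglongrightarrow> 0" by (rule tendsto_eventually)
            then show ?thesis using False by (simp add: Fc_def)
          qed
          then show ?thesis by (intro tendsto_intros)
        qed
      qed
    qed auto
    then show ?thesis using smooth_step'_integral by simp
  qed
  have lim2: "(\<lambda>n. integral\<^sup>L vol (I2 n)) \<longlonglongrightarrow> (\<integral>c. c0 (base_point b m k c) *\<^sub>R Fc (graph_point b m k g c) \<partial>base_measure k)"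
  proof -
    have m1: "(\<lambda>c. c0 (base_point b m k c) *\<^sub>R J n c) \<in> borel_measurable (base_measure k)" for n
      unfolding J_def
    proof -
      interpret L: sigma_finite_measure "lborel :: real measure" by standard
      have [measurable]: "g \<in> borel_measurable borel"
        by (intro borel_measurable_continuous_onI C_inf_continuous g)
      show "(\<lambda>c. c0 (base_point b m k c) *\<^sub>R (\<integral>u. smooth_step' u *\<^sub>R
          Fc (base_point b m k c + (g (base_point b m k c) + s * \<delta> n * u) *\<^sub>R b k) \<partial>lborel)) \<in> borel_measurable (base_measure k)"
        by measurable
    qed
    have "(\<lambda>n. \<integral>c. c0 (base_point b m k c) *\<^sub>R J n c \<partial>base_measure k) \<longlonglongrightarrow> (\<integral>c. c0 (base_point b m k c) *\<^sub>R Fc (graph_point b m k g c) \<partial>base_measure k)"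
    proof (rule integral_dominated_convergence)
      let ?B = "{c \<in> space (base_measure k). norm (base_point b m k c) \<le> R}"
      show "(\<lambda>c. c0 (base_point b m k c) *\<^sub>R Fc (graph_point b m k g c)) \<in> borel_measurable (base_measure k)"
      proof -
        have [measurable]: "g \<in> borel_measurable borel"
          by (intro borel_measurable_continuous_onI C_inf_continuous g)
        show ?thesis unfolding graph_point_def by measurable
      qed
      show "integrable (base_measure k) (\<lambda>c. indicator ?B c *\<^sub>R (\<bar>BN\<bar> * BF))"
        by (rule integrable_real_indicator[THEN integrable_scaleR_left]) (use base_measure_bounded_finite[OF k, of R] in auto)
      show "AE c in base_measure k. (\<lambda>n. c0 (base_point b m k c) *\<^sub>R J n c) \<longlonglongrightarrow> c0 (base_point b m k c) *\<^sub>R Fc (graph_point b m k g c)"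
        by (intro AE_I2 tendsto_intros Jlim)
      show "AE c in base_measure k. norm (c0 (base_point b m k c) *\<^sub>R J n c) \<le> indicator ?B c *\<^sub>R (\<bar>BN\<bar> * BF)" for n
      proof (rule AE_I2)
        fix c assume c: "c \<in> space (base_measure k)"
        let ?x = "base_point b m k c"
        show "norm (c0 ?x *\<^sub>R J n c) \<le> indicator ?B c *\<^sub>R (\<bar>BN\<bar> * BF)"
        proof (cases "norm ?x \<le> R")
          case True
          then show ?thesis using c Jb[of n c] BN[of ?x] BF by (auto intro!: mult_mono)
        next
          case False
          have "Fc (?x + t *\<^sub>R b k) = 0" for t
            using R(1)[of "?x + t *\<^sub>R b k"] norm_base_point_le[OF k, of c t] False
            by (auto simp: Fc_def indicator_def)
          then have "J n c = 0" by (simp add: J_def)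
          then show ?thesis using BF by (simp add: indicator_def)
        qed
      qed
    qed (rule m1)
    moreover have "integral\<^sup>L vol (I2 n) = (\<integral>c. c0 (base_point b m k c) *\<^sub>R J n c \<partial>base_measure k)" for n
      using vol_fubini[OF k int2[of n]] by (simp add: slice)
    ultimately show ?thesis by simp
  qed
  have "(\<integral>y. indicator A y *\<^sub>R F' y \<partial>vol) = (\<integral>c. c0 (base_point b m k c) *\<^sub>R Fc (graph_point b m k g c) \<partial>base_measure k)"
    using LIMSEQ_unique[OF lim1 lim2[folded eq]] .
  moreover have "(\<lambda>y. indicator A y *\<^sub>R F' y) = (\<lambda>y. indicator G y *\<^sub>R F' y)"
    using F'0 K by (auto simp: A_def indicator_def fun_eq_iff)
  ultimately show ?thesis by (simp add: c0_def Fc_def)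
qed

end

section \<open>The exterior normal and the surface element of a chart\<close>

context frame
begin

definition slope :: "nat \<Rightarrow> ('a \<Rightarrow> real) \<Rightarrow> 'a \<Rightarrow> real" where
  "slope k g y = sqrt (1 + (\<Sum>i\<in>{..<m} - {k}. (frechet_derivative g (at (drop_coord b k y)) (b i))\<^sup>2))"

definition chart_normal :: "nat \<Rightarrow> real \<Rightarrow> ('a \<Rightarrow> real) \<Rightarrow> 'a \<Rightarrow> 'a" where
  "chart_normal k s g y = (1 / slope k g y) *\<^sub>R emb (\<lambda>i. conormal k s g i y)"

lemma slope_pos: "slope k g y > 0"
  unfolding slope_def by (intro real_sqrt_gt_zero add_pos_nonneg sum_nonneg) auto

lemma continuous_slope: "C_inf g \<Longrightarrow> continuous_on S (slope k g)"
  unfolding slope_def[abs_def]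
  by (intro continuous_intros continuous_on_compose2[OF C_inf_continuous_derivative[of g UNIV]]) auto

lemma chart_normal_in_V: "chart_normal k s g y \<in> V"
  unfolding chart_normal_def by (intro subspace_scale subspace_V emb_in_V)

lemma chart_normal_inner: "i < m \<Longrightarrow> chart_normal k s g y \<bullet> b i = conormal k s g i y / slope k g y"
  by (simp add: chart_normal_def inner_emb)

lemma norm_chart_normal:
  assumes "k < m" "s \<in> {-1, 1}"
  shows "norm (chart_normal k s g y) = 1"
proof -
  let ?d = "\<lambda>i. frechet_derivative g (at (drop_coord b k y)) (b i)"
  have s2: "s\<^sup>2 = 1" using assms by auto
  have "(norm (chart_normal k s g y))\<^sup>2 = (\<Sum>i<m. (conormal k s g i y)\<^sup>2 / (slope k g y)\<^sup>2)"
    by (subst norm_V[OF chart_normal_in_V]) (auto intro!: sum.cong simp: chart_normal_inner power_divide)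
  also have "\<dots> = (\<Sum>i<m. (conormal k s g i y)\<^sup>2) / (slope k g y)\<^sup>2" by (rule sum_divide_distrib[symmetric])
  also have "(\<Sum>i<m. (conormal k s g i y)\<^sup>2) = (conormal k s g k y)\<^sup>2 + (\<Sum>i\<in>{..<m}-{k}. (conormal k s g i y)\<^sup>2)"
    using assms by (intro sum.remove) auto
  also have "\<dots> = 1 + (\<Sum>i\<in>{..<m}-{k}. (?d i)\<^sup>2)"
    using s2 by (auto simp: conormal_def power_mult_distrib intro!: sum.cong)
  also have "\<dots> = (slope k g y)\<^sup>2" unfolding slope_def
    by (rule real_sqrt_pow2[symmetric]) (auto intro!: add_nonneg_nonneg sum_nonneg)
  also have "(slope k g y)\<^sup>2 / (slope k g y)\<^sup>2 = 1" using slope_pos[of k g y] by simp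
  finally have "(norm (chart_normal k s g y))\<^sup>2 = 1\<^sup>2" by simp
  then show ?thesis by (rule power2_eq_imp_eq) auto
qed

text \<open>The gradient of the height function is a multiple of the normal with the opposite sign:
  height decreases towards the exterior.\<close>

lemma height_has_derivative:
  assumes g: "C_inf g" and k: "k < m"
  obtains D where "(height k s g has_derivative D) (at y)"
    "\<And>v. v \<in> V \<Longrightarrow> D v = - slope k g y * (chart_normal k s g y \<bullet> v)"
proof -
  let ?E = "frechet_derivative g (at (drop_coord b k y))"
  let ?D = "\<lambda>v. s * (v \<bullet> b k - ?E (drop_coord b k v))"
  have gE: "(g has_derivative ?E) (at (drop_coord b k y))" by (rule C_inf_has_derivative[OF g])
  interpret E: bounded_linear ?E using gE by (rule has_derivative_bounded_linear)
  have "((\<lambda>y. drop_coord b k y) has_derivative drop_coord b k) (at y)"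
    unfolding drop_coord_def[abs_def] by (auto intro!: derivative_eq_intros)
  from has_derivative_compose[OF this gE]
  have 1: "((\<lambda>x. g (drop_coord b k x)) has_derivative (\<lambda>x. ?E (drop_coord b k x))) (at y)" .
  have "(height k s g has_derivative ?D) (at y)"
    unfolding height_def[abs_def] by (auto intro!: derivative_eq_intros 1)
  moreover have "?D v = - slope k g y * (chart_normal k s g y \<bullet> v)" if v: "v \<in> V" for v
  proof -
    have "?E (drop_coord b k v) = (\<Sum>i\<in>{..<m}-{k}. (v \<bullet> b i) * ?E (b i))"
      unfolding drop_coord_eq_base[OF v k] base_point_def by (simp add: E.sum E.scaleR)
    then have "?D v = s * (v \<bullet> b k) - (\<Sum>i\<in>{..<m}-{k}. s * ((v \<bullet> b i) * ?E (b i)))"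
      by (simp add: right_diff_distrib sum_distrib_left)
    also have "\<dots> = - (conormal k s g k y * (v \<bullet> b k) + (\<Sum>i\<in>{..<m}-{k}. conormal k s g i y * (v \<bullet> b i)))"
      by (auto simp: conormal_def sum_negf[symmetric] algebra_simps intro!: sum.cong)
    also have "conormal k s g k y * (v \<bullet> b k) + (\<Sum>i\<in>{..<m}-{k}. conormal k s g i y * (v \<bullet> b i)) =
       (\<Sum>i<m. conormal k s g i y * (v \<bullet> b i))"
      using k by (intro sum.remove[symmetric]) auto
    also have "\<dots> = slope k g y * (chart_normal k s g y \<bullet> v)"
      using slope_pos[of k g y]
      by (simp add: chart_normal_def emb_def inner_sum_left inner_commute[of "b _" v])
    finally show ?thesis by simp
  qed
  ultimately show ?thesis by (rule that)
qed

text \<open>The height function vanishes along every curve in the boundary, so its derivative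
  annihilates the velocity. The velocity lies in the span because the orthogonal projection fixes
  the curve.\<close>

lemma chart_normal_tangent:
  assumes os: "one_sided G N k s g" and GV: "openin (top_of_set V) G"
    and y: "y \<in> N" and t: "tangent_vector (closure G - G) y v"
  shows "chart_normal k s g y \<bullet> v = 0"
proof -
  have N: "open N" "k < m" "C_inf g" using os unfolding one_sided_def by blast+
  have GsubV: "G \<subseteq> V" using openin_subset[OF GV] by simp
  from t obtain c where c: "range c \<subseteq> closure G - G" "c 0 = y" "(c has_vector_derivative v) (at 0)"
    by (auto simp: tangent_vector_def)
  have cV: "c t \<in> V" for t using c(1) closure_minimal[OF GsubV closed_V] by auto
  define P where "P x = emb (\<lambda>i. x \<bullet> b i)" for x
  have "bounded_linear P" unfolding P_def[abs_def] emb_def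
    by (intro bounded_linear_sum bounded_linear_scaleR_const bounded_linear_inner_left)
  from bounded_linear.has_vector_derivative[OF this c(3)]
  have "((\<lambda>t. P (c t)) has_vector_derivative P v) (at 0)" .
  moreover have "(\<lambda>t. P (c t)) = c" using cV by (auto simp: P_def emb_inner)
  ultimately have "P v = v" using c(3) vector_derivative_unique_at by metis
  then have vV: "v \<in> V" using emb_in_V unfolding P_def by metis
  obtain D where D: "(height k s g has_derivative D) (at y)"
    "\<And>v. v \<in> V \<Longrightarrow> D v = - slope k g y * (chart_normal k s g y \<bullet> v)"
    by (rule height_has_derivative[OF N(3,2)]) blast
  interpret D: bounded_linear D using D(1) by (rule has_derivative_bounded_linear)
  have "(c has_derivative (\<lambda>t. t *\<^sub>R v)) (at 0)" using c(3) by (simp add: has_vector_derivative_def)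
  from has_derivative_compose[OF this, of "height k s g" D] D(1) c(2)
  have "((\<lambda>t. height k s g (c t)) has_derivative (\<lambda>t. D (t *\<^sub>R v))) (at 0)" by simp
  then have 1: "((\<lambda>t. height k s g (c t)) has_real_derivative D v) (at 0)"
    by (simp add: has_field_derivative_def D.scaleR mult_commute_abs)
  have "isCont c 0" using c(3) by (rule has_vector_derivative_continuous)
  then have "(c \<longlongrightarrow> c 0) (nhds 0)" unfolding isCont_def tendsto_at_iff_tendsto_nhds .
  then have "(c \<longlongrightarrow> y) (nhds 0)" using c(2) by simp
  from topological_tendstoD[OF this N(1) y]
  have "eventually (\<lambda>t. height k s g (c t) = 0) (nhds 0)"
  proof (rule eventually_mono)
    fix t assume "c t \<in> N"
    then have "c t \<in> (closure G - G) \<inter> N" using c(1) by auto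
    then show "height k s g (c t) = 0" unfolding one_sided_boundary[OF os GV] by (simp add: height_def)
  qed
  then have "((\<lambda>t. 0) has_real_derivative D v) (at 0)"
    using 1 DERIV_cong_ev[OF refl, of "\<lambda>t. height k s g (c t)" "\<lambda>t. 0" 0 "D v"] by simp
  then have "D v = 0" by (rule DERIV_unique) simp
  then show ?thesis using D(2)[OF vV] slope_pos[of k g y] by simp
qed

text \<open>Height has derivative \<open>- slope\<close> along the normal, so that it is negative
  for a short time along the normal and positive against it.\<close>

lemma chart_normal_line:
  assumes os: "one_sided G N k s g" and GV: "openin (top_of_set V) G"
    and y: "y \<in> (closure G - G) \<inter> N"
  shows "\<forall>\<^sub>F t in at_right 0. y + t *\<^sub>R chart_normal k s g y \<notin> closure G"
    and "\<forall>\<^sub>F t in at_right 0. y + t *\<^sub>R (- chart_normal k s g y) \<in> closure G"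
proof -
  have N: "open N" "k < m" "C_inf g" "s \<in> {-1,1}" and GN: "G \<inter> N = {y \<in> V \<inter> N. height k s g y > 0}"
    using os unfolding one_sided_def by blast+
  let ?n = "chart_normal k s g y"
  have y0: "y \<in> V" "y \<in> N" "height k s g y = 0"
    using y unfolding one_sided_boundary[OF os GV] by (auto simp: height_def)
  obtain D where D: "(height k s g has_derivative D) (at y)"
    "\<And>v. v \<in> V \<Longrightarrow> D v = - slope k g y * (?n \<bullet> v)"
    by (rule height_has_derivative[OF N(3,2)]) blast
  interpret D: bounded_linear D using D(1) by (rule has_derivative_bounded_linear)
  have Dn: "D ?n = - slope k g y"
    using D(2)[OF chart_normal_in_V] norm_chart_normal[OF N(2,4), of g y] by (simp add: dot_square_norm)
  have Dm: "D (- ?n) = slope k g y" using D.scaleR[of "-1" ?n] Dn by simp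
  have der: "((\<lambda>t. height k s g (y + t *\<^sub>R v)) has_real_derivative D v) (at 0)" for v
  proof -
    have "((\<lambda>t::real. y + t *\<^sub>R v) has_derivative (\<lambda>t. t *\<^sub>R v)) (at 0)"
      by (auto intro!: derivative_eq_intros)
    from has_derivative_compose[OF this, of "height k s g" D] D(1)
    show ?thesis by (simp add: has_field_derivative_def D.scaleR mult_commute_abs)
  qed
  have evN: "\<forall>\<^sub>F t in at_right 0. y + t *\<^sub>R v \<in> N" for v
  proof -
    have "((\<lambda>t::real. y + t *\<^sub>R v) \<longlongrightarrow> y + 0 *\<^sub>R v) (at_right 0)" by (intro tendsto_intros)
    then show ?thesis using topological_tendstoD[OF _ N(1)] y0 by simp
  qed
  have inV: "y + t *\<^sub>R v \<in> V" if "v \<in> V" for t v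
    using y0 that by (intro subspace_add subspace_scale subspace_V)
  have ev: "\<forall>\<^sub>F t in at_right (0::real). P t" if "d > 0" "\<And>t. 0 < t \<Longrightarrow> t < d \<Longrightarrow> P t" for P d
    using that by (auto simp: eventually_at_right_field)
  have "\<forall>\<^sub>F t in at_right 0. height k s g (y + t *\<^sub>R ?n) < 0"
    using DERIV_neg_dec_right[OF der[of ?n]] Dn slope_pos[of k g y] y0(3) by (auto intro: ev)
  then show "\<forall>\<^sub>F t in at_right 0. y + t *\<^sub>R ?n \<notin> closure G" using evN[of ?n]
  proof eventually_elim
    case (elim t)
    show ?case
    proof
      assume "y + t *\<^sub>R ?n \<in> closure G"
      then have "y + t *\<^sub>R ?n \<in> closure G \<inter> N" using elim by simp
      then show False unfolding one_sided_closure[OF os GV] using elim by simp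
    qed
  qed
  have "\<forall>\<^sub>F t in at_right 0. 0 < height k s g (y + t *\<^sub>R (- ?n))"
    using DERIV_pos_inc_right[OF der[of "- ?n"]] Dm slope_pos[of k g y] y0(3) by (auto intro: ev)
  then show "\<forall>\<^sub>F t in at_right 0. y + t *\<^sub>R (- ?n) \<in> closure G" using evN[of "- ?n"]
  proof eventually_elim
    case (elim t)
    have "y + t *\<^sub>R (- ?n) \<in> G \<inter> N"
      unfolding GN using elim inV[OF subspace_neg[OF subspace_V chart_normal_in_V]] by simp
    then show ?case using closure_subset by auto
  qed
qed

text \<open>The curve moves the base point in direction \<open>b i\<close> and follows the graph. A
  tangent curve has to stay in the boundary at all times, so it rests at \<open>y\<close> whenever
  it would leave the chart.\<close>

lemma graph_tangent:
  assumes os: "one_sided G N k s g" and GV: "openin (top_of_set V) G"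
    and y: "y \<in> (closure G - G) \<inter> N" and i: "i < m" "i \<noteq> k"
  shows "tangent_vector (closure G - G) y (b i + frechet_derivative g (at (drop_coord b k y)) (b i) *\<^sub>R b k)"
proof -
  have N: "open N" "k < m" "C_inf g" using os unfolding one_sided_def by blast+
  have y0: "y \<in> V" "y \<in> N" "y \<bullet> b k = g (drop_coord b k y)"
    using y unfolding one_sided_boundary[OF os GV] by auto
  let ?x = "drop_coord b k y"
  let ?D = "frechet_derivative g (at ?x)"
  define h where "h t = y + t *\<^sub>R b i + (g (?x + t *\<^sub>R b i) - g ?x) *\<^sub>R b k" for t
  have gD: "(g has_derivative ?D) (at ?x)" by (rule C_inf_has_derivative[OF N(3)])
  interpret D: bounded_linear ?D using gD by (rule has_derivative_bounded_linear)
  have "((\<lambda>t::real. ?x + t *\<^sub>R b i) has_derivative (\<lambda>t. t *\<^sub>R b i)) (at 0)"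
    by (auto intro!: derivative_eq_intros)
  from has_derivative_compose[OF this, of g ?D] gD
  have gt: "((\<lambda>t. g (?x + t *\<^sub>R b i)) has_real_derivative ?D (b i)) (at 0)"
    by (simp add: has_field_derivative_def D.scaleR mult_commute_abs)
  have hd: "(h has_vector_derivative (b i + ?D (b i) *\<^sub>R b k)) (at 0)"
    unfolding h_def[abs_def] by (auto intro!: derivative_eq_intros gt)
  have h0: "h 0 = y" by (simp add: h_def)
  have "isCont h 0" using hd by (rule has_vector_derivative_continuous)
  then have "(h \<longlongrightarrow> h 0) (nhds 0)" unfolding isCont_def tendsto_at_iff_tendsto_nhds .
  then have "(h \<longlongrightarrow> y) (nhds 0)" using h0 by simp
  from topological_tendstoD[OF this N(1) y0(2)]
  have evh: "eventually (\<lambda>t. h t \<in> N) (nhds 0)" .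
  define c where "c t = (if h t \<in> N then h t else y)" for t
  have "range c \<subseteq> closure G - G"
  proof
    fix z assume "z \<in> range c"
    then obtain t where z: "z = c t" by auto
    show "z \<in> closure G - G"
    proof (cases "h t \<in> N")
      case False
      then show ?thesis using y z by (simp add: c_def)
    next
      case True
      have V: "h t \<in> V" unfolding h_def using y0 i N by (intro add_in_V)
      have d: "drop_coord b k (h t) = ?x + t *\<^sub>R b i"
        using i N y0 by (simp add: h_def drop_coord_def inner_add_left orth algebra_simps)
      have "h t \<bullet> b k = y \<bullet> b k + (g (?x + t *\<^sub>R b i) - g ?x)"
        using i N by (simp add: h_def inner_add_left orth)
      then have "h t \<in> (closure G - G) \<inter> N"
        unfolding one_sided_boundary[OF os GV] d using V True y0 d by simp
      then show ?thesis using z True by (simp add: c_def)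
    qed
  qed
  moreover have "c 0 = y" by (simp add: c_def h0)
  moreover have "(c has_vector_derivative (b i + ?D (b i) *\<^sub>R b k)) (at 0)"
    by (rule has_vector_derivative_transform_line[OF hd])
       (use evh in \<open>auto simp: c_def elim!: eventually_mono\<close>)
  ultimately show ?thesis by (auto simp: tangent_vector_def)
qed

text \<open>The tangent vectors of the graph determine a normal vector up to a factor, the norm
  determines the factor up to sign, and the exterior condition excludes the wrong sign.\<close>

lemma unit_exterior_normal_eq:
  assumes os: "one_sided G N k s g" and GV: "openin (top_of_set V) G"
    and y: "y \<in> (closure G - G) \<inter> N"
  shows "unit_exterior_normal b m G y = chart_normal k s g y"
proof -
  have N: "k < m" "s \<in> {-1,1}" using os unfolding one_sided_def by blast+
  have GsubV: "G \<subseteq> V" using openin_subset[OF GV] by simp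
  let ?n = "chart_normal k s g y" and ?r = "slope k g y"
  show ?thesis
    unfolding unit_exterior_normal_def coord_boundary_eq[OF GV] coord_closure_eq[OF GsubV]
  proof (rule the_equality, intro conjI allI impI)
    show "?n \<in> V" by (rule chart_normal_in_V)
    show "norm ?n = 1" by (rule norm_chart_normal[OF N])
    show "?n \<bullet> v = 0" if "tangent_vector (closure G - G) y v" for v
      using chart_normal_tangent[OF os GV _ that] y by simp
    show "\<forall>\<^sub>F t in at_right 0. y + t *\<^sub>R ?n \<notin> closure G" by (rule chart_normal_line[OF os GV y])
  next
    fix n assume n: "n \<in> V \<and> norm n = 1 \<and> (\<forall>v. tangent_vector (closure G - G) y v \<longrightarrow> n \<bullet> v = 0) \<and>
        (\<forall>\<^sub>F t in at_right 0. y + t *\<^sub>R n \<notin> closure G)"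
    \<comment> \<open>the factor is read off from the \<open>k\<close>-th components\<close>
    define a where "a = - (n \<bullet> b k) * s * ?r"
    have s2: "s * s = 1" using N by auto
    have na: "n = a *\<^sub>R ?n"
    proof (rule V_eqI)
      show "n \<in> V" using n by simp
      show "a *\<^sub>R ?n \<in> V" by (intro subspace_scale subspace_V chart_normal_in_V)
      fix i assume i: "i < m"
      have "(a *\<^sub>R ?n) \<bullet> b i = - (n \<bullet> b k) * (s * conormal k s g i y)"
        using slope_pos[of k g y] i by (simp add: a_def chart_normal_inner)
      also have "\<dots> = n \<bullet> b i"
      proof (cases "i = k")
        case True
        then show ?thesis using s2 by (simp add: conormal_def)
      next
        case False
        have "n \<bullet> (b i + frechet_derivative g (at (drop_coord b k y)) (b i) *\<^sub>R b k) = 0"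
          using n graph_tangent[OF os GV y i False] by blast
        moreover have "s * conormal k s g i y = frechet_derivative g (at (drop_coord b k y)) (b i)"
          using False s2 by (simp add: conormal_def mult.assoc[symmetric])
        ultimately show ?thesis by (simp add: inner_add_right algebra_simps)
      qed
      finally show "n \<bullet> b i = (a *\<^sub>R ?n) \<bullet> b i" by simp
    qed
    have "norm (a *\<^sub>R ?n) = 1" using n na by metis
    then have "\<bar>a\<bar> = 1" using norm_chart_normal[OF N, of g y] by simp
    moreover have "a \<noteq> -1"
    proof
      assume "a = -1"
      then have "n = - ?n" using na by simp
      then have "\<forall>\<^sub>F t in at_right (0::real). y + t *\<^sub>R (- ?n) \<notin> closure G" using n by metis
      with chart_normal_line(2)[OF os GV y] have "\<forall>\<^sub>F t in at_right (0::real). False"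
        by eventually_elim auto
      then show False by simp
    qed
    ultimately have "a = 1" by auto
    then show "n = ?n" using na by simp
  qed
qed

text \<open>The measure that the surface element of a single graph defines, with no restriction to
  the open set on which the boundary is this graph.\<close>

definition patch_measure :: "nat \<Rightarrow> ('a \<Rightarrow> real) \<Rightarrow> 'a measure" where
  "patch_measure k g = distr (density (base_measure k) (\<lambda>c. ennreal (graph_area_density b m k g c))) borel (graph_point b m k g)"

lemma sets_patch_measure [measurable_cong, simp]: "sets (patch_measure k g) = sets borel"
  by (simp add: patch_measure_def)

lemma graph_area_density_eq:
  assumes "k < m"
  shows "graph_area_density b m k g c = slope k g (base_point b m k c)"
    "graph_area_density b m k g c = slope k g (graph_point b m k g c)"
proof -
  have "drop_coord b k (base_point b m k c) = base_point b m k c"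
    "drop_coord b k (graph_point b m k g c) = base_point b m k c"
    using drop_coord_line[OF assms, of c 0] drop_coord_line[OF assms, of c] by (auto simp: graph_point_def)
  then show "graph_area_density b m k g c = slope k g (base_point b m k c)"
    "graph_area_density b m k g c = slope k g (graph_point b m k g c)"
    by (simp_all add: slope_def graph_area_density_def)
qed

lemma conormal_graph_point:
  "k < m \<Longrightarrow> conormal k s g i (graph_point b m k g c) = conormal k s g i (base_point b m k c)"
  using drop_coord_line[of k c 0] drop_coord_line[of k c] by (simp add: conormal_def graph_point_def)

lemma measurable_graph:
  assumes "C_inf g" "k < m"
  shows "graph_point b m k g \<in> borel_measurable (base_measure k)"
    "graph_area_density b m k g \<in> borel_measurable (base_measure k)"
proof -
  have [measurable]: "g \<in> borel_measurable borel"
    by (intro borel_measurable_continuous_onI C_inf_continuous assms)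
  have [measurable]: "slope k g \<in> borel_measurable borel"
    by (intro borel_measurable_continuous_onI continuous_slope assms)
  show "graph_point b m k g \<in> borel_measurable (base_measure k)" unfolding graph_point_def[abs_def] by measurable
  show "graph_area_density b m k g \<in> borel_measurable (base_measure k)"
    unfolding graph_area_density_eq(1)[OF assms(2), abs_def] by measurable
qed

lemma emeasure_patch_measure:
  assumes "C_inf g" "k < m" "A \<in> sets borel"
  shows "emeasure (patch_measure k g) A =
    (\<integral>\<^sup>+ c. ennreal (graph_area_density b m k g c) * indicator A (graph_point b m k g c) \<partial>base_measure k)"
proof -
  note [measurable] = measurable_graph[OF assms(1,2)] assms(3)
  have "emeasure (patch_measure k g) A =
     emeasure (density (base_measure k) (\<lambda>c. ennreal (graph_area_density b m k g c))) (graph_point b m k g -` A \<inter> space (base_measure k))"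
    unfolding patch_measure_def by (subst emeasure_distr) auto
  also have "\<dots> = (\<integral>\<^sup>+ c. ennreal (graph_area_density b m k g c) * indicator (graph_point b m k g -` A \<inter> space (base_measure k)) c \<partial>base_measure k)"
    by (subst emeasure_density) auto
  also have "\<dots> = (\<integral>\<^sup>+ c. ennreal (graph_area_density b m k g c) * indicator A (graph_point b m k g c) \<partial>base_measure k)"
    by (intro nn_integral_cong) (auto simp: indicator_def)
  finally show ?thesis .
qed

lemma patch_measure_integral:
  fixes f :: "'a \<Rightarrow> 'c::euclidean_space"
  assumes g: "C_inf g" "k < m" and f[measurable]: "f \<in> borel_measurable borel"
  shows "integral\<^sup>L (patch_measure k g) f =
      (\<integral>c. slope k g (base_point b m k c) *\<^sub>R f (graph_point b m k g c) \<partial>base_measure k)"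
    and "integrable (patch_measure k g) f \<longleftrightarrow>
      integrable (base_measure k) (\<lambda>c. slope k g (base_point b m k c) *\<^sub>R f (graph_point b m k g c))"
proof -
  note [measurable] = measurable_graph[OF g]
  note d = graph_area_density_eq(1)[OF g(2)]
  have [measurable]: "slope k g \<in> borel_measurable borel"
    by (intro borel_measurable_continuous_onI continuous_slope g)
  have nn: "0 \<le> graph_area_density b m k g c" for c by (simp add: d less_imp_le[OF slope_pos])
  show "integral\<^sup>L (patch_measure k g) f =
      (\<integral>c. slope k g (base_point b m k c) *\<^sub>R f (graph_point b m k g c) \<partial>base_measure k)"
    unfolding patch_measure_def
    by (subst integral_distr, simp, simp, subst integral_density) (auto simp: nn d[symmetric])
  show "integrable (patch_measure k g) f \<longleftrightarrow>
      integrable (base_measure k) (\<lambda>c. slope k g (base_point b m k c) *\<^sub>R f (graph_point b m k g c))"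
    unfolding patch_measure_def
    by (subst integrable_distr_eq, simp, simp, subst integrable_density) (auto simp: nn d[symmetric])
qed

lemma integrable_patch_measure_bounded:
  fixes f :: "'a \<Rightarrow> 'c::euclidean_space"
  assumes g: "C_inf g" "k < m" and f[measurable]: "f \<in> borel_measurable borel"
    and B: "\<And>y. norm (f y) \<le> B" and R: "\<And>y. norm y > R \<Longrightarrow> f y = 0"
  shows "integrable (patch_measure k g) f"
proof -
  note [measurable] = measurable_graph[OF g]
  have [measurable]: "slope k g \<in> borel_measurable borel"
    by (intro borel_measurable_continuous_onI continuous_slope g)
  let ?B = "{c \<in> space (base_measure k). norm (base_point b m k c) \<le> R}"
  have "compact (slope k g ` cball 0 R)"
    by (intro compact_continuous_image continuous_slope g) auto
  then obtain C where C: "\<And>y. norm y \<le> R \<Longrightarrow> \<bar>slope k g y\<bar> \<le> C"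
    using bounded_iff[THEN iffD1, OF compact_imp_bounded] by (metis imageI mem_cball_0 real_norm_def)
  have B0: "B \<ge> 0" using order_trans[OF norm_ge_zero B[of 0]] .
  have "integrable (base_measure k) (\<lambda>c. slope k g (base_point b m k c) *\<^sub>R f (graph_point b m k g c))"
  proof (rule Bochner_Integration.integrable_bound)
    show "integrable (base_measure k) (\<lambda>c. indicator ?B c *\<^sub>R (\<bar>C\<bar> * B))"
      by (rule integrable_real_indicator[THEN integrable_scaleR_left]) (use base_measure_bounded_finite[OF g(2), of R] in auto)
    show "AE c in base_measure k. norm (slope k g (base_point b m k c) *\<^sub>R f (graph_point b m k g c))
         \<le> norm (indicator ?B c *\<^sub>R (\<bar>C\<bar> * B))"
    proof (rule AE_I2)
      fix c assume c: "c \<in> space (base_measure k)"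
      let ?x = "base_point b m k c" and ?p = "graph_point b m k g c"
      show "norm (slope k g ?x *\<^sub>R f ?p) \<le> norm (indicator ?B c *\<^sub>R (\<bar>C\<bar> * B))"
      proof (cases "norm ?x \<le> R")
        case True
        then show ?thesis using c C[of ?x] B[of ?p] B0 by (auto intro!: mult_mono simp: abs_mult)
      next
        case False
        then have "norm ?p > R"
          using norm_base_point_le[OF g(2), of c "g ?x"] by (simp add: graph_point_def)
        then have "f ?p = 0" using R by simp
        then show ?thesis by simp
      qed
    qed
  qed measurable
  then show ?thesis using patch_measure_integral(2)[OF g f] by simp
qed

lemma graph_point_in_V: "k < m \<Longrightarrow> graph_point b m k g c \<in> V"
  unfolding graph_point_def by (intro add_in_V base_point_in_V)

lemma graph_point_on_graph:
  "k < m \<Longrightarrow> graph_point b m k g c \<bullet> b k = g (drop_coord b k (graph_point b m k g c))"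
  using drop_coord_line[of k c] line_inner[of k c] by (simp add: graph_point_def)

text \<open>The conormal is the unit normal times the surface element; the formula now mentions the
  chart only through its surface measure.\<close>

lemma local_divergence_measure:
  fixes F F' :: "'a \<Rightarrow> 'c::euclidean_space"
  assumes os: "one_sided G N k s g" and GV: "openin (top_of_set V) G" and bG: "bounded G" and i: "i < m"
    and K: "compact K" "K \<subseteq> N"
    and F0: "\<And>y. y \<in> closure G - K \<Longrightarrow> F y = 0" and F'0: "\<And>y. y \<in> G - K \<Longrightarrow> F' y = 0"
    and Z: "\<And>y. finite {t. y + t *\<^sub>R b i \<in> Z}" and ad: "admissible i Z G F F'"
  defines "f \<equiv> (\<lambda>y. indicator ((closure G - G) \<inter> N) y *\<^sub>R ((unit_exterior_normal b m G y \<bullet> b i) *\<^sub>R F y))"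
  shows "(\<integral>y. indicator G y *\<^sub>R F' y \<partial>vol) = integral\<^sup>L (patch_measure k g) f"
    and "integrable (patch_measure k g) f" and "f \<in> borel_measurable borel"
proof -
  note cont = admissibleD(1)[OF ad]
  have N: "open N" "k < m" "C_inf g" "s \<in> {-1,1}" using os unfolding one_sided_def by blast+
  note NN = N(3,2)
  define T where "T = (closure G - G) \<inter> N"
  have GB: "G \<in> sets borel" by (rule openin_borel[OF GV])
  have T[measurable]: "T \<in> sets borel"
    unfolding T_def by (rule sets.Int[OF sets.Diff[OF borel_closed[OF closed_closure] GB] borel_open[OF N(1)]])
  have f_eq: "f y = (conormal k s g i y / slope k g y) *\<^sub>R (indicator T y *\<^sub>R F y)" for y
    using unit_exterior_normal_eq[OF os GV, of y] chart_normal_inner[OF i]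
    by (auto simp: f_def T_def indicator_def)
  have Fm: "(\<lambda>y. indicator T y *\<^sub>R F y) \<in> borel_measurable borel"
  proof (rule borel_measurable_continuous_on_indicator[OF T])
    show "continuous_on T F" by (rule continuous_on_subset[OF cont]) (auto simp: T_def)
  qed
  have sl: "slope k g y \<noteq> 0" for y using slope_pos[of k g y] by simp
  have "(\<lambda>y. conormal k s g i y / slope k g y) \<in> borel_measurable borel"
    by (intro borel_measurable_continuous_onI continuous_intros continuous_conormal continuous_slope N)
       (use sl in auto)
  from borel_measurable_scaleR[OF this Fm] show fm[measurable]: "f \<in> borel_measurable borel"
    unfolding f_eq[abs_def] .
  have cG: "compact (closure G)" using bG by simp
  have T_graph: "graph_point b m k g c \<in> T \<longleftrightarrow> graph_point b m k g c \<in> closure G \<inter> N" for c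
    unfolding T_def one_sided_boundary[OF os GV] one_sided_closure[OF os GV]
    using graph_point_on_graph[OF N(2)] graph_point_in_V[OF N(2)] by (auto simp: height_def)
  have "(\<integral>y. indicator G y *\<^sub>R F' y \<partial>vol) =
     (\<integral>c. conormal k s g i (base_point b m k c) *\<^sub>R
        (indicator (closure G \<inter> N) (graph_point b m k g c) *\<^sub>R F (graph_point b m k g c)) \<partial>base_measure k)"
    by (rule local_divergence[OF os GV bG i K F0 F'0 Z ad])
  also have "\<dots> = (\<integral>c. slope k g (base_point b m k c) *\<^sub>R f (graph_point b m k g c) \<partial>base_measure k)"
  proof (rule Bochner_Integration.integral_cong[OF refl])
    fix c
    have "slope k g (graph_point b m k g c) = slope k g (base_point b m k c)"
      using graph_area_density_eq[OF N(2), of g c] by simp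
    then show "conormal k s g i (base_point b m k c) *\<^sub>R
        (indicator (closure G \<inter> N) (graph_point b m k g c) *\<^sub>R F (graph_point b m k g c)) =
       slope k g (base_point b m k c) *\<^sub>R f (graph_point b m k g c)"
      using sl[of "base_point b m k c"] T_graph[of c]
      by (simp add: f_eq conormal_graph_point[OF N(2)] indicator_def)
  qed
  also have "\<dots> = integral\<^sup>L (patch_measure k g) f" by (rule patch_measure_integral(1)[OF NN fm, symmetric])
  finally show "(\<integral>y. indicator G y *\<^sub>R F' y \<partial>vol) = integral\<^sup>L (patch_measure k g) f" .
  obtain R where R: "\<And>y. y \<in> closure G \<Longrightarrow> norm y \<le> R"
    using compact_imp_bounded[OF cG] by (auto simp: bounded_iff)
  obtain BF where BF: "\<And>y. y \<in> closure G \<Longrightarrow> norm (F y) \<le> BF"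
    using compact_imp_bounded[OF compact_continuous_image[OF cont cG]] by (auto simp: bounded_iff)
  show "integrable (patch_measure k g) f"
  proof (rule integrable_patch_measure_bounded[OF NN fm, where B = "\<bar>BF\<bar>" and R = R])
    show "norm (f y) \<le> \<bar>BF\<bar>" for y
    proof (cases "y \<in> T")
      case True
      have "norm (f y) = \<bar>chart_normal k s g y \<bullet> b i\<bar> * norm (F y)"
        using True chart_normal_inner[OF i] by (simp add: f_eq)
      also have "\<dots> \<le> 1 * \<bar>BF\<bar>"
        using abs_inner_b_le[OF i, of "chart_normal k s g y"] norm_chart_normal[OF N(2,4)] True
        by (intro mult_mono order_trans[OF BF abs_ge_self]) (auto simp: T_def)
      finally show ?thesis by simp
    qed (simp add: f_eq)
    show "f y = 0" if "norm y > R" for y using R[of y] that by (auto simp: f_def indicator_def)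
  qed
qed

end

section \<open>Charts give the same surface measure\<close>

text \<open>The smoothness of a test function or a cutoff that matters when the divergence theorem
  is applied in the single direction \<open>v\<close>.\<close>

definition C1_dir :: "'a::euclidean_space \<Rightarrow> ('a \<Rightarrow> real) \<Rightarrow> bool" where
  "C1_dir v \<phi> \<longleftrightarrow> continuous_on UNIV \<phi> \<and>
     (\<exists>\<phi>'. continuous_on UNIV \<phi>' \<and> (\<forall>y. ((\<lambda>t. \<phi> (y + t *\<^sub>R v)) has_real_derivative \<phi>' y) (at 0)))"

lemma C1_dirI:
  assumes "continuous_on UNIV \<phi>" "continuous_on UNIV \<phi>'"
    "\<And>y. ((\<lambda>t. \<phi> (y + t *\<^sub>R v)) has_real_derivative \<phi>' y) (at 0)"
  shows "C1_dir v \<phi>"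
  using assms unfolding C1_dir_def by blast

lemma C1_dirE:
  assumes "C1_dir v \<phi>"
  obtains \<phi>' where "continuous_on UNIV \<phi>" "continuous_on UNIV \<phi>'"
    "\<And>y. ((\<lambda>t. \<phi> (y + t *\<^sub>R v)) has_real_derivative \<phi>' y) (at 0)"
  using assms unfolding C1_dir_def by blast

lemma C1_dir_const: "C1_dir v (\<lambda>_. c)"
  by (rule C1_dirI[where \<phi>' = "\<lambda>_. 0"]) (auto intro!: continuous_intros)

lemma C1_dir_inner: "C1_dir v (\<lambda>y. (y - a) \<bullet> e)"
proof (rule C1_dirI[where \<phi>' = "\<lambda>_. v \<bullet> e"])
  fix y
  have "(\<lambda>t. (y + t *\<^sub>R v - a) \<bullet> e) = (\<lambda>t. (y - a) \<bullet> e + t * (v \<bullet> e))"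
    by (simp add: inner_diff_left inner_add_left algebra_simps)
  then show "((\<lambda>t. (y + t *\<^sub>R v - a) \<bullet> e) has_real_derivative v \<bullet> e) (at 0)"
    by (auto intro!: derivative_eq_intros)
qed (intro continuous_intros)+

lemma C1_dir_dist_square: "C1_dir v (\<lambda>y. (y - a) \<bullet> (y - a))"
proof (rule C1_dirI[where \<phi>' = "\<lambda>y. 2 * ((y - a) \<bullet> v)"])
  fix y
  have "(\<lambda>t. (y + t *\<^sub>R v - a) \<bullet> (y + t *\<^sub>R v - a)) =
      (\<lambda>t. (y - a) \<bullet> (y - a) + t * (2 * ((y - a) \<bullet> v)) + t\<^sup>2 * (v \<bullet> v))"
    by (simp add: inner_diff_left inner_add_left inner_diff_right inner_add_right inner_commute
        algebra_simps power2_eq_square)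
  then show "((\<lambda>t. (y + t *\<^sub>R v - a) \<bullet> (y + t *\<^sub>R v - a)) has_real_derivative 2 * ((y - a) \<bullet> v)) (at 0)"
    by (auto intro!: derivative_eq_intros)
qed (intro continuous_intros)+

lemma C1_dir_mult:
  assumes "C1_dir v \<phi>" "C1_dir v \<psi>"
  shows "C1_dir v (\<lambda>y. \<phi> y * \<psi> y)"
proof -
  obtain \<phi>' where p: "continuous_on UNIV \<phi>" "continuous_on UNIV \<phi>'"
    "\<And>y. ((\<lambda>t. \<phi> (y + t *\<^sub>R v)) has_real_derivative \<phi>' y) (at 0)" using assms(1) by (rule C1_dirE) blast
  obtain \<psi>' where q: "continuous_on UNIV \<psi>" "continuous_on UNIV \<psi>'"
    "\<And>y. ((\<lambda>t. \<psi> (y + t *\<^sub>R v)) has_real_derivative \<psi>' y) (at 0)" using assms(2) by (rule C1_dirE) blast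
  show ?thesis
  proof (rule C1_dirI[where \<phi>' = "\<lambda>y. \<phi>' y * \<psi> y + \<psi>' y * \<phi> y"])
    show "((\<lambda>t. \<phi> (y + t *\<^sub>R v) * \<psi> (y + t *\<^sub>R v)) has_real_derivative \<phi>' y * \<psi> y + \<psi>' y * \<phi> y) (at 0)" for y
      using DERIV_mult[OF p(3) q(3), of y y] by simp
  qed (intro continuous_intros p q)+
qed

lemma C1_dir_prod:
  "(\<And>i. i \<in> I \<Longrightarrow> C1_dir v (\<phi> i)) \<Longrightarrow> C1_dir v (\<lambda>y. \<Prod>i\<in>I. \<phi> i y)"
  by (induction I rule: infinite_finite_induct) (auto intro: C1_dir_const C1_dir_mult)

lemma C1_dir_compose:
  assumes "C1_dir v \<phi>" and h: "\<And>u. (h has_real_derivative h' u) (at u)" "continuous_on UNIV h'"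
  shows "C1_dir v (\<lambda>y. h (\<phi> y))"
proof -
  obtain \<phi>' where p: "continuous_on UNIV \<phi>" "continuous_on UNIV \<phi>'"
    "\<And>y. ((\<lambda>t. \<phi> (y + t *\<^sub>R v)) has_real_derivative \<phi>' y) (at 0)" using assms(1) by (rule C1_dirE) blast
  have hc: "continuous_on UNIV h" by (rule DERIV_continuous_on[of UNIV h h']) (use h in auto)
  show ?thesis
  proof (rule C1_dirI[where \<phi>' = "\<lambda>y. h' (\<phi> y) * \<phi>' y"])
    show "((\<lambda>t. h (\<phi> (y + t *\<^sub>R v))) has_real_derivative h' (\<phi> y) * \<phi>' y) (at 0)" for y
      using DERIV_chain2[OF h(1) p(3)[of y]] by simp
    show "continuous_on UNIV (\<lambda>y. h (\<phi> y))" by (rule continuous_on_compose2[OF hc p(1)]) auto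
    show "continuous_on UNIV (\<lambda>y. h' (\<phi> y) * \<phi>' y)"
      by (intro continuous_intros p continuous_on_compose2[OF h(2) p(1)]) auto
  qed
qed

lemma C1_dir_max0_square: "C1_dir v \<phi> \<Longrightarrow> C1_dir v (\<lambda>y. (max 0 (\<phi> y))\<^sup>2)"
  by (rule C1_dir_compose[OF _ max0_square_deriv]) (auto intro!: continuous_intros)

lemma C1_dir_saturate:
  assumes "C1_dir v \<phi>" and pos: "\<And>y. \<phi> y \<ge> 0" and e: "e > 0"
  shows "C1_dir v (\<lambda>y. \<phi> y / (\<phi> y + e))"
proof -
  obtain \<phi>' where p: "continuous_on UNIV \<phi>" "continuous_on UNIV \<phi>'"
    "\<And>y. ((\<lambda>t. \<phi> (y + t *\<^sub>R v)) has_real_derivative \<phi>' y) (at 0)" using assms(1) by (rule C1_dirE) blast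
  have nz: "\<phi> y + e \<noteq> 0" for y using pos[of y] e by simp
  show ?thesis
  proof (rule C1_dirI[where \<phi>' = "\<lambda>y. (\<phi>' y * (\<phi> y + e) - \<phi> y * \<phi>' y) / ((\<phi> y + e) * (\<phi> y + e))"])
    fix y
    have 1: "((\<lambda>t. \<phi> (y + t *\<^sub>R v) + e) has_real_derivative \<phi>' y) (at 0)"
      using DERIV_add[OF p(3)[of y] DERIV_const[of e]] by simp
    show "((\<lambda>t. \<phi> (y + t *\<^sub>R v) / (\<phi> (y + t *\<^sub>R v) + e)) has_real_derivative
       (\<phi>' y * (\<phi> y + e) - \<phi> y * \<phi>' y) / ((\<phi> y + e) * (\<phi> y + e))) (at 0)"
      using DERIV_divide[OF p(3)[of y] 1] nz by simp
  qed (intro continuous_intros p, use nz in auto)+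
qed

definition bump :: "'a::euclidean_space \<Rightarrow> real \<Rightarrow> 'a \<Rightarrow> real" where
  "bump x r y = (max 0 (r\<^sup>2 - (y - x) \<bullet> (y - x)))\<^sup>2"

lemma bump_nonneg: "0 \<le> bump x r y" by (simp add: bump_def)

lemma C1_dir_bump: "C1_dir v (bump x r)"
proof -
  have "C1_dir v (\<lambda>y. (max 0 ((\<lambda>u. r\<^sup>2 - u) ((y - x) \<bullet> (y - x))))\<^sup>2)"
    by (intro C1_dir_max0_square C1_dir_compose[OF C1_dir_dist_square, where h' = "\<lambda>_. -1"])
       (auto intro!: derivative_eq_intros)
  then show ?thesis unfolding bump_def[abs_def] .
qed

lemma bump_pos_iff: "r > 0 \<Longrightarrow> bump x r y > 0 \<longleftrightarrow> y \<in> ball x r"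
proof -
  assume r: "r > 0"
  have "(y - x) \<bullet> (y - x) < r\<^sup>2 \<longleftrightarrow> norm (y - x) < r"
    unfolding power2_norm_eq_inner[symmetric] using r
    by (metis norm_ge_zero power2_less_imp_less power_strict_mono less_imp_le zero_less_numeral)
  then show ?thesis by (auto simp: bump_def dist_norm norm_minus_commute max_def)
qed

lemma bump_eq_0: "r > 0 \<Longrightarrow> y \<notin> ball x r \<Longrightarrow> bump x r y = 0"
  using bump_pos_iff[of r x y] bump_nonneg[of x r y] by linarith

text \<open>Continuously differentiable and positive exactly on a box. Boxes form an
  intersection-stable generator of the Borel sets, which balls do not.\<close>

definition box_fun :: "'a::euclidean_space \<Rightarrow> 'a \<Rightarrow> 'a \<Rightarrow> real" where
  "box_fun l u y = (\<Prod>e\<in>Basis. (max 0 ((y - l) \<bullet> e))\<^sup>2 * (max 0 ((y - u) \<bullet> (- e)))\<^sup>2)"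

lemma box_fun_nonneg: "0 \<le> box_fun l u y"
  unfolding box_fun_def by (intro prod_nonneg) auto

lemma C1_dir_box_fun: "C1_dir v (box_fun l u)"
  unfolding box_fun_def[abs_def]
  by (intro C1_dir_prod C1_dir_mult C1_dir_max0_square C1_dir_inner)

lemma box_fun_pos_iff: "box_fun l u y > 0 \<longleftrightarrow> y \<in> box l u"
proof
  assume "y \<in> box l u"
  then show "box_fun l u y > 0"
    unfolding box_fun_def by (intro prod_pos) (auto simp: mem_box inner_diff_left)
next
  assume "box_fun l u y > 0"
  then have "box_fun l u y \<noteq> 0" by simp
  then have nz: "(max 0 ((y - l) \<bullet> e))\<^sup>2 * (max 0 ((y - u) \<bullet> (- e)))\<^sup>2 \<noteq> 0" if "e \<in> Basis" for e
    using that unfolding box_fun_def by (auto simp: prod_zero_iff)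
  show "y \<in> box l u"
    unfolding mem_box
  proof (intro ballI conjI)
    fix e :: 'a assume e: "e \<in> Basis"
    show "l \<bullet> e < y \<bullet> e"
      using nz[OF e] by (cases "l \<bullet> e < y \<bullet> e") (auto simp: inner_diff_left max_def split: if_splits)
    show "y \<bullet> e < u \<bullet> e"
      using nz[OF e] by (cases "y \<bullet> e < u \<bullet> e") (auto simp: inner_diff_left max_def split: if_splits)
  qed
qed

lemma finite_measure_eq_by_boxes:
  fixes M1 M2 :: "'a::euclidean_space measure"
  assumes s: "sets M1 = sets borel" "sets M2 = sets borel"
    and eq: "\<And>l u. emeasure M1 (box l u) = emeasure M2 (box l u)"
    and fin: "\<And>l u. emeasure M1 (box l u) \<noteq> \<infinity>"
  shows "M1 = M2"
proof (rule measure_eqI_generator_eq)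
  let ?E = "range (\<lambda>(a, b). box a b::'a set)"
  show "Int_stable ?E" by (auto simp: Int_stable_def box_Int_box)
  show "?E \<subseteq> Pow UNIV" "sets M1 = sigma_sets UNIV ?E" "sets M2 = sigma_sets UNIV ?E"
    by (simp_all add: borel_eq_box s)
  let ?A = "\<lambda>n::nat. box (- (real n *\<^sub>R One)) (real n *\<^sub>R One) :: 'a set"
  show "range ?A \<subseteq> ?E" "(\<Union>i. ?A i) = UNIV" unfolding UN_box_eq_UNIV by auto
  show "emeasure M1 (?A i) \<noteq> \<infinity>" for i by (rule fin)
  show "emeasure M1 X = emeasure M2 X" if "X \<in> ?E" for X using that eq by auto
qed

text \<open>By Lindelof the cover may be taken countable, and then disjoint pieces add up.\<close>

lemma emeasure_eq_by_open_cover: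
  fixes M1 M2 :: "'a::second_countable_topology measure"
  assumes s: "sets M1 = sets borel" "sets M2 = sets borel"
    and op: "\<And>B. B \<in> \<B> \<Longrightarrow> open B"
    and eq: "\<And>B A. B \<in> \<B> \<Longrightarrow> A \<in> sets borel \<Longrightarrow> A \<subseteq> B \<Longrightarrow> emeasure M1 A = emeasure M2 A"
    and A: "A \<in> sets borel" "A \<subseteq> \<Union>\<B>"
  shows "emeasure M1 A = emeasure M2 A"
proof -
  obtain \<B>' where B': "\<B>' \<subseteq> \<B>" "countable \<B>'" "\<Union>\<B>' = \<Union>\<B>" using Lindelof[OF op] by blast
  show ?thesis
  proof (cases "\<B>' = {}")
    case True
    then have "A = {}" using A B' by auto
    then show ?thesis by simp
  next
    case False
    define B where "B = from_nat_into \<B>'"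
    have rB: "range B = \<B>'" unfolding B_def by (rule range_from_nat_into[OF False B'(2)])
    define D where "D n = A \<inter> disjointed B n" for n
    have BB: "B n \<in> \<B>" for n using rB B'(1) by auto
    have ob: "B n \<in> sets borel" for n using op[OF BB] by auto
    have Dm: "D n \<in> sets borel" for n
      unfolding D_def disjointed_def by (intro sets.Int sets.Diff sets.finite_UN A ob) auto
    have Dsub: "D n \<subseteq> B n" for n unfolding D_def using disjointed_subset[of B n] by auto
    have dis: "disjoint_family D"
      using disjoint_family_disjointed[of B] by (auto simp: disjoint_family_on_def D_def)
    have UD: "(\<Union>n. D n) = A"
    proof -
      have "(\<Union>n. disjointed B n) = \<Union>\<B>" unfolding UN_disjointed_eq using rB B'(3) by auto
      then show ?thesis using A(2) by (auto simp: D_def)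
    qed
    have rD: "range D \<subseteq> sets M1" "range D \<subseteq> sets M2" using Dm s by auto
    have "emeasure M1 A = (\<Sum>n. emeasure M1 (D n))"
      using suminf_emeasure[OF rD(1) dis] UD by simp
    also have "\<dots> = (\<Sum>n. emeasure M2 (D n))"
      using eq[OF BB Dm Dsub] by simp
    also have "\<dots> = emeasure M2 A"
      using suminf_emeasure[OF rD(2) dis] UD by simp
    finally show ?thesis .
  qed
qed

context frame
begin

lemma patch_measure_restrict:
  assumes p: "graph_patch b m S W k g" and A: "A \<in> sets borel" "A \<subseteq> W" and S: "S \<in> sets borel"
  shows "emeasure (patch_measure k g) A = emeasure (patch_measure k g) (A \<inter> S)"
proof -
  have k: "k < m" "C_inf g" and SW: "S \<inter> W = {y \<in> V \<inter> W. y \<bullet> b k = g (drop_coord b k y)}"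
    using p unfolding graph_patch_def by blast+
  have "indicator A (graph_point b m k g c) = (indicator (A \<inter> S) (graph_point b m k g c) :: ennreal)" for c
  proof -
    have "graph_point b m k g c \<in> S \<inter> W" if "graph_point b m k g c \<in> A"
      unfolding SW using graph_point_in_V[OF k(1)] graph_point_on_graph[OF k(1)] that A(2) by auto
    then show ?thesis by (auto simp: indicator_def)
  qed
  then show ?thesis
    using A S emeasure_patch_measure[OF k(2,1), of A] emeasure_patch_measure[OF k(2,1), of "A \<inter> S"] by simp
qed

lemma one_sided_imp_patch:
  assumes "one_sided G N k s g" "openin (top_of_set V) G"
  shows "graph_patch b m (closure G - G) N k g"
  using one_sided_boundary[OF assms] assms(1) unfolding graph_patch_def one_sided_def by blast

text \<open>Two charts of the same boundary have the same surface measure. Instead of transforming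
  one graph parametrisation into the other, apply the divergence theorem in direction \<open>b
  k1\<close> in both charts to the same test function: the volume integral does not know the chart.
  Hence both measures give the same integral of the test function times the \<open>k1\<close>-th
  component of the normal. This component is the same function in both charts and has no zeros in
  the first one, so it can be divided out.\<close>

lemma patch_measures_agree_on_ball:
  assumes os1: "one_sided G N k1 s1 g1" and os2: "one_sided G N k2 s2 g2"
    and GV: "openin (top_of_set V) G" and bG: "bounded G"
    and r: "r > 0" "cball x r \<subseteq> N" and A: "A \<in> sets borel" "A \<subseteq> ball x r"
  shows "emeasure (patch_measure k1 g1) A = emeasure (patch_measure k2 g2) A"
proof -
  define \<mu>1 where "\<mu>1 = patch_measure k1 g1"
  define \<mu>2 where "\<mu>2 = patch_measure k2 g2"
  have sets12[measurable_cong, simp]: "sets \<mu>1 = sets borel" "sets \<mu>2 = sets borel" by (simp_all add: \<mu>1_def \<mu>2_def)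
  have [simp]: "space \<mu>1 = UNIV" "space \<mu>2 = UNIV"
    using sets_eq_imp_space_eq[OF sets12(1)] sets_eq_imp_space_eq[OF sets12(2)] by auto
  have N: "open N" "k1 < m" "C_inf g1" "s1 \<in> {-1,1}" using os1 unfolding one_sided_def by blast+
  have s2: "s1 * s1 = 1" using N(4) by auto
  define T where "T = (closure G - G) \<inter> N"
  have GB: "G \<in> sets borel" by (rule openin_borel[OF GV])
  have SB: "closure G - G \<in> sets borel" by (intro sets.Diff borel_closed closed_closure GB)
  have T[measurable]: "T \<in> sets borel"
    unfolding T_def by (rule sets.Int[OF SB borel_open[OF N(1)]])
  have slm[measurable]: "slope k1 g1 \<in> borel_measurable borel"
    by (intro borel_measurable_continuous_onI continuous_slope N)
  have normal: "unit_exterior_normal b m G y \<bullet> b k1 = - s1 / slope k1 g1 y" if "y \<in> T" for y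
    using unit_exterior_normal_eq[OF os1 GV, of y] that chart_normal_inner[OF N(2)]
    by (simp add: T_def conormal_def)

  have test: "integral\<^sup>L \<mu>1 (\<lambda>y. indicator T y * \<phi> y / slope k1 g1 y) = integral\<^sup>L \<mu>2 (\<lambda>y. indicator T y * \<phi> y / slope k1 g1 y)"
    "integrable \<mu>1 (\<lambda>y. indicator T y * \<phi> y / slope k1 g1 y)"
    "integrable \<mu>2 (\<lambda>y. indicator T y * \<phi> y / slope k1 g1 y)"
    if C1: "C1_dir (b k1) \<phi>" and \<phi>0: "\<And>y. y \<notin> cball x r \<Longrightarrow> \<phi> y = 0" for \<phi>
  proof -
    obtain \<phi>' where p: "continuous_on UNIV \<phi>" "continuous_on UNIV \<phi>'"
      "\<And>y. ((\<lambda>t. \<phi> (y + t *\<^sub>R b k1)) has_real_derivative \<phi>' y) (at 0)" using C1 by (rule C1_dirE) blast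
    have \<phi>'0: "\<phi>' y = 0" if y: "y \<notin> cball x r" for y
      using has_real_derivative_locally_const[OF p(3), of "- cball x r" y 0] \<phi>0 y by (simp add: open_Compl)
    have cG: "compact (closure G)" using bG by simp
    obtain B where B: "\<And>y. y \<in> closure G \<Longrightarrow> norm (\<phi>' y) \<le> B"
      using continuous_on_compact_bound[OF cG continuous_on_subset[OF p(2) subset_UNIV]] by blast
    let ?f = "\<lambda>y. indicator T y *\<^sub>R ((unit_exterior_normal b m G y \<bullet> b k1) *\<^sub>R \<phi> y)"
    have m1: "(\<lambda>y. indicator G y *\<^sub>R \<phi>' y) \<in> borel_measurable borel"
      by (intro borel_measurable_continuous_on_indicator GB continuous_on_subset[OF p(2)]) auto
    have fin: "finite {t. y + t *\<^sub>R b k1 \<in> {}}" for y by simp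
    have der: "((\<lambda>t. \<phi> (y + t *\<^sub>R b k1)) has_vector_derivative \<phi>' y) (at 0)" for y
      using p(3)[of y] by (simp add: has_real_derivative_iff_has_vector_derivative)
    have bd: "norm (\<phi>' y) \<le> B" if "y \<in> G" for y using B closure_subset that by blast
    have ad: "admissible k1 {} G \<phi> \<phi>'"
      unfolding admissible_def using der m1 bd continuous_on_subset[OF p(1)] by auto
    note L1 = local_divergence_measure[OF os1 GV bG N(2) compact_cball r(2) _ _ fin ad, folded \<mu>1_def T_def]
    note L2 = local_divergence_measure[OF os2 GV bG N(2) compact_cball r(2) _ _ fin ad, folded \<mu>2_def T_def]
    have f1: "integral\<^sup>L \<mu>1 ?f = integral\<^sup>L \<mu>2 ?f" "integrable \<mu>1 ?f" "integrable \<mu>2 ?f"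
      using L1(1) L2(1) L1(2) L2(2) by (simp_all add: \<phi>0 \<phi>'0)
    have "(- s1) *\<^sub>R ?f y = indicator T y * \<phi> y / slope k1 g1 y" for y
    proof (cases "y \<in> T")
      case True
      have "(- s1) *\<^sub>R ?f y = (s1 * s1) * (\<phi> y / slope k1 g1 y)" using normal[OF True] True by simp
      then show ?thesis using True s2 by simp
    qed simp
    then have eq: "(\<lambda>y. indicator T y * \<phi> y / slope k1 g1 y) = (\<lambda>y. (- s1) *\<^sub>R ?f y)" by auto
    show "integral\<^sup>L \<mu>1 (\<lambda>y. indicator T y * \<phi> y / slope k1 g1 y) = integral\<^sup>L \<mu>2 (\<lambda>y. indicator T y * \<phi> y / slope k1 g1 y)"
      unfolding eq integral_scaleR_right f1(1) ..
    show "integrable \<mu>1 (\<lambda>y. indicator T y * \<phi> y / slope k1 g1 y)"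
      "integrable \<mu>2 (\<lambda>y. indicator T y * \<phi> y / slope k1 g1 y)"
      unfolding eq by (intro integrable_scaleR_right f1)+
  qed

  \<comment> \<open>the absolute value of the \<open>k1\<close>-th component of the normal is 1 / slope; the bump localises to the ball, on which the
    weight \<open>p\<close> is positive\<close>
  define p where "p y = indicator T y * bump x r y / slope k1 g1 y" for y
  have p0: "p y \<ge> 0" for y
    unfolding p_def by (intro divide_nonneg_nonneg mult_nonneg_nonneg bump_nonneg less_imp_le[OF slope_pos]) auto
  have bc: "continuous_on UNIV (bump x r)" using C1_dir_bump[of "b k1" x r] by (auto simp: C1_dir_def)
  have bm[measurable]: "bump x r \<in> borel_measurable borel"
    by (rule borel_measurable_continuous_onI[OF bc])
  have pm[measurable]: "p \<in> borel_measurable borel" unfolding p_def[abs_def] by measurable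
  define \<nu>1 where "\<nu>1 = density \<mu>1 (\<lambda>y. ennreal (p y))"
  define \<nu>2 where "\<nu>2 = density \<mu>2 (\<lambda>y. ennreal (p y))"
  have bump0: "bump x r y = 0" if "y \<notin> cball x r" for y
    using that r by (intro bump_eq_0) auto
  have pint: "integrable \<mu>1 p" using test(2)[OF C1_dir_bump bump0] by (simp add: p_def[abs_def])

  have box_lim: "(\<lambda>n. ennreal (\<integral>y. p y * (box_fun l u y / (box_fun l u y + inverse (real (Suc n)))) \<partial>\<mu>)) \<longlonglongrightarrow> emeasure (density \<mu> (\<lambda>y. ennreal (p y))) (box l u)"
    if \<mu>: "\<mu> = \<mu>1 \<or> \<mu> = \<mu>2" for l u \<mu>
  proof -
    have [measurable_cong, simp]: "sets \<mu> = sets borel" using \<mu> by auto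
    define h where "h n y = box_fun l u y / (box_fun l u y + inverse (real (Suc n)))" for n y
    have hC: "C1_dir (b k1) (h n)" for n unfolding h_def[abs_def]
      by (rule C1_dir_saturate[OF C1_dir_box_fun box_fun_nonneg]) simp
    have [measurable]: "h n \<in> borel_measurable borel" for n
      using hC[of n] by (intro borel_measurable_continuous_onI) (auto simp: C1_dir_def)
    have den: "box_fun l u y + inverse (real (Suc n)) > 0" for y n
      by (intro add_nonneg_pos box_fun_nonneg) simp
    have h0: "h n y \<ge> 0" for n y unfolding h_def by (intro divide_nonneg_nonneg box_fun_nonneg less_imp_le[OF den])
    have int: "integrable \<mu> (\<lambda>y. p y * h n y)" for n
    proof -
      have "C1_dir (b k1) (\<lambda>y. bump x r y * h n y)" by (intro C1_dir_mult C1_dir_bump hC)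
      from test(2,3)[OF this] bump0 \<mu>
      have "integrable \<mu> (\<lambda>y. indicator T y * (bump x r y * h n y) / slope k1 g1 y)" by auto
      then show ?thesis by (simp add: p_def mult.assoc)
    qed
    have "(\<lambda>n. \<integral>\<^sup>+y. ennreal (p y * h n y) \<partial>\<mu>) \<longlonglongrightarrow> (\<integral>\<^sup>+y. ennreal (p y) * indicator (box l u) y \<partial>\<mu>)"
    proof (rule nn_integral_LIMSEQ)
      show "incseq (\<lambda>n y. ennreal (p y * h n y))"
      proof (intro incseq_SucI le_funI ennreal_leI mult_left_mono p0)
        fix n y
        have "inverse (real (Suc (Suc n))) \<le> inverse (real (Suc n))" by (simp add: field_simps)
        then show "h n y \<le> h (Suc n) y"
          unfolding h_def by (intro divide_left_mono box_fun_nonneg mult_pos_pos den) simp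
      qed
      show "(\<lambda>n. ennreal (p y * h n y)) \<longlonglongrightarrow> ennreal (p y) * indicator (box l u) y" for y
      proof (cases "y \<in> box l u")
        case True
        then have q: "box_fun l u y > 0" by (simp add: box_fun_pos_iff)
        have "(\<lambda>n. h n y) \<longlonglongrightarrow> box_fun l u y / (box_fun l u y + 0)"
          unfolding h_def by (intro tendsto_intros LIMSEQ_inverse_real_of_nat) (use q in simp)
        then have "(\<lambda>n. p y * h n y) \<longlonglongrightarrow> p y * 1" using q by (intro tendsto_intros) simp
        then have "(\<lambda>n. ennreal (p y * h n y)) \<longlonglongrightarrow> ennreal (p y)" by (intro tendsto_ennrealI) simp
        then show ?thesis using True by simp
      next
        case False
        then have "box_fun l u y = 0" using box_fun_pos_iff[of l u y] box_fun_nonneg[of l u y] by linarith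
        then show ?thesis using False by (simp add: h_def)
      qed
    qed measurable
    moreover have "(\<integral>\<^sup>+y. ennreal (p y * h n y) \<partial>\<mu>) = ennreal (\<integral>y. p y * h n y \<partial>\<mu>)" for n
      by (rule nn_integral_eq_integral[OF int]) (intro AE_I2 mult_nonneg_nonneg p0 h0)
    moreover have "(\<integral>\<^sup>+y. ennreal (p y) * indicator (box l u) y \<partial>\<mu>) = emeasure (density \<mu> (\<lambda>y. ennreal (p y))) (box l u)"
      by (subst emeasure_density) auto
    ultimately show ?thesis by (simp add: h_def)
  qed
  have int_eq: "(\<integral>y. p y * (box_fun l u y / (box_fun l u y + inverse (real (Suc n)))) \<partial>\<mu>1) =
    (\<integral>y. p y * (box_fun l u y / (box_fun l u y + inverse (real (Suc n)))) \<partial>\<mu>2)" for l u n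
  proof -
    have "C1_dir (b k1) (\<lambda>y. bump x r y * (box_fun l u y / (box_fun l u y + inverse (real (Suc n)))))"
      by (intro C1_dir_mult C1_dir_bump C1_dir_saturate C1_dir_box_fun box_fun_nonneg) simp
    from test(1)[OF this] bump0 show ?thesis by (simp add: p_def mult_ac)
  qed
  have "\<nu>1 = \<nu>2"
  proof (rule finite_measure_eq_by_boxes)
    show "sets \<nu>1 = sets borel" "sets \<nu>2 = sets borel" by (simp_all add: \<nu>1_def \<nu>2_def)
    show "emeasure \<nu>1 (box l u) = emeasure \<nu>2 (box l u)" for l u
      unfolding \<nu>1_def \<nu>2_def
      using LIMSEQ_unique[OF box_lim[of \<mu>1 l u, unfolded int_eq] box_lim[of \<mu>2 l u]] by simp
    show "emeasure \<nu>1 (box l u) \<noteq> \<infinity>" for l u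
    proof -
      have "emeasure \<nu>1 (box l u) \<le> emeasure \<nu>1 (space \<nu>1)" by (rule emeasure_space)
      also have "\<dots> = (\<integral>\<^sup>+y. ennreal (p y) \<partial>\<mu>1)" unfolding \<nu>1_def by (subst emeasure_density) auto
      also have "\<dots> = ennreal (integral\<^sup>L \<mu>1 p)" by (rule nn_integral_eq_integral[OF pint]) (simp add: p0)
      finally show ?thesis by (auto simp: top_unique)
    qed
  qed
  have rec: "emeasure \<mu> (A \<inter> T) = (\<integral>\<^sup>+y. indicator (A \<inter> T) y * ennreal (1 / p y) \<partial>density \<mu> (\<lambda>y. ennreal (p y)))"
    if [measurable_cong, simp]: "sets \<mu> = sets borel" for \<mu>
  proof -
    note [measurable] = A(1)
    have "(\<integral>\<^sup>+y. indicator (A \<inter> T) y * ennreal (1 / p y) \<partial>density \<mu> (\<lambda>y. ennreal (p y)))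
       = (\<integral>\<^sup>+y. ennreal (p y) * (indicator (A \<inter> T) y * ennreal (1 / p y)) \<partial>\<mu>)"
      by (subst nn_integral_density) auto
    also have "\<dots> = (\<integral>\<^sup>+y. indicator (A \<inter> T) y \<partial>\<mu>)"
    proof (rule nn_integral_cong)
      fix y
      show "ennreal (p y) * (indicator (A \<inter> T) y * ennreal (1 / p y)) = indicator (A \<inter> T) y"
      proof (cases "y \<in> A \<inter> T")
        case True
        then have "bump x r y > 0" using A(2) r(1) bump_pos_iff[of r x y] by auto
        then have "p y > 0" using True slope_pos[of k1 g1 y] by (simp add: p_def)
        then show ?thesis using True by (simp add: ennreal_mult[symmetric])
      qed simp
    qed
    also have "\<dots> = emeasure \<mu> (A \<inter> T)" using A(1) T by (subst nn_integral_indicator) auto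
    finally show ?thesis by simp
  qed
  have AN: "A \<subseteq> N" using A(2) r(2) ball_subset_cball by blast
  then have AT: "A \<inter> T = A \<inter> (closure G - G)" by (auto simp: T_def)
  have "emeasure \<mu>1 A = emeasure \<mu>1 (A \<inter> T)"
    unfolding \<mu>1_def AT by (rule patch_measure_restrict[OF one_sided_imp_patch[OF os1 GV] A(1) AN SB])
  also have "\<dots> = emeasure \<mu>2 (A \<inter> T)"
    using rec[OF sets12(1)] rec[OF sets12(2)] \<open>\<nu>1 = \<nu>2\<close> by (simp add: \<nu>1_def \<nu>2_def)
  also have "\<dots> = emeasure \<mu>2 A"
    unfolding \<mu>2_def AT by (rule patch_measure_restrict[OF one_sided_imp_patch[OF os2 GV] A(1) AN SB, symmetric])
  finally show ?thesis by (simp add: \<mu>1_def \<mu>2_def)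
qed

end

section \<open>Existence and uniqueness of the surface measure\<close>

context frame
begin

lemma linear_drop_coord: "linear (drop_coord b k)"
  unfolding drop_coord_def
  by (intro linear_compose_sub linear_id[unfolded id_def] bounded_linear.linear[OF bounded_linear_scaleR_const]
      bounded_linear_inner_left)

lemma connected_avoiding_boundary:
  assumes GV: "openin (top_of_set V) G" and C: "convex C" "C \<subseteq> V" "C \<inter> (closure G - G) = {}"
    and x: "x \<in> C" and y: "y \<in> C"
  shows "x \<in> G \<longleftrightarrow> y \<in> G"
proof (rule ccontr)
  assume ne: "\<not> ?thesis"
  have "C \<inter> G \<noteq> {}" "C - G \<noteq> {}" using ne x y by auto
  moreover have "connectedin (top_of_set V) C" using C(2) convex_connected[OF C(1)] by (simp add: connectedin_subtopology connectedin_iff_connected)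
  ultimately have "C \<inter> (top_of_set V frontier_of G) \<noteq> {}" by (intro connectedin_Int_frontier_of)
  then show False using C(3) coord_boundary_eq[OF GV] by (simp add: coord_boundary_def)
qed

text \<open>The definition of surface measure quantifies over all graph patches of the boundary,
  with no mention of the sides. In a flat cylinder around a boundary point the parts above and below
  the graph are connected, so each lies in \<open>G\<close> or avoids it. Some points near
  \<open>y\<close> are in \<open>G\<close> and some are exterior, by the one-sided chart that is
  known to exist, so that exactly one of the parts is in \<open>G\<close>.\<close>

lemma patch_imp_one_sided:
  assumes GV: "openin (top_of_set V) G" and os: "one_sided G N0 k0 s0 g0"
    and p: "graph_patch b m (closure G - G) W k g" and y: "y \<in> closure G - G" "y \<in> W" "y \<in> N0"
  obtains N s where "y \<in> N" "N \<subseteq> W" "N \<subseteq> N0" "one_sided G N k s g"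
proof -
  have W: "open W" "k < m" "C_inf g"
    and SW: "(closure G - G) \<inter> W = {y \<in> V \<inter> W. y \<bullet> b k = g (drop_coord b k y)}"
    using p unfolding graph_patch_def by blast+
  have N0: "open N0" "k0 < m" "C_inf g0" "s0 \<in> {-1,1}" using os unfolding one_sided_def by blast+
  have yV: "y \<in> V" and yg: "y \<bullet> b k = g (drop_coord b k y)" using y SW by blast+
  obtain e where e: "e > 0" "ball y e \<subseteq> W \<inter> N0"
    using open_contains_ball[of "W \<inter> N0"] W(1) N0(1) y by blast
  define h where "h = e / 2"
  have h0: "h > 0" using e by (simp add: h_def)
  have "isCont g (drop_coord b k y)"
    using C_inf_continuous[OF W(3), of UNIV] by (simp add: continuous_on_eq_continuous_at)
  then obtain d0 where d0: "d0 > 0" "\<And>u. dist u (drop_coord b k y) < d0 \<Longrightarrow> dist (g u) (g (drop_coord b k y)) < h / 2"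
    using h0 unfolding continuous_at_eps_delta by (metis half_gt_zero)
  define d where "d = min d0 h"
  have d: "d > 0" "d \<le> h" "d \<le> d0" using d0 h0 by (auto simp: d_def)
  \<comment> \<open>the cylinder is so flat in the horizontal directions that the graph stays in its middle half\<close>
  define N where "N = drop_coord b k -` ball (drop_coord b k y) d \<inter> (\<lambda>z. z \<bullet> b k) -` ball (y \<bullet> b k) h"
  have oN: "open N" unfolding N_def
    by (intro open_Int open_vimage open_ball continuous_intros)
  have cN: "convex N" unfolding N_def
    by (intro convex_Int convex_linear_vimage linear_drop_coord bounded_linear.linear[OF bounded_linear_inner_left] convex_ball)
  have yN: "y \<in> N" using d h0 by (simp add: N_def)
  have Nsub: "N \<subseteq> ball y e"
  proof
    fix z assume z: "z \<in> N"
    have "z - y = (drop_coord b k z - drop_coord b k y) + ((z - y) \<bullet> b k) *\<^sub>R b k"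
      by (simp add: drop_coord_def inner_diff_left algebra_simps)
    then have "norm (z - y) \<le> norm (drop_coord b k z - drop_coord b k y) + \<bar>(z - y) \<bullet> b k\<bar> * norm (b k)"
      by (metis norm_scaleR norm_triangle_ineq)
    also have "\<dots> < h + h"
      using z d by (intro add_strict_mono) (auto simp: N_def dist_norm norm_minus_commute norm_b[OF W(2)] inner_diff_left)
    finally show "z \<in> ball y e" by (simp add: h_def dist_norm norm_minus_commute)
  qed
  have NW: "N \<subseteq> W" "N \<subseteq> N0" using Nsub e(2) by auto
  have gclose: "\<bar>g (drop_coord b k z) - y \<bullet> b k\<bar> < h / 2" if "z \<in> N" for z
  proof -
    have "dist (drop_coord b k z) (drop_coord b k y) < d0" using that d(3) by (auto simp: N_def dist_commute)
    from d0(2)[OF this] show ?thesis unfolding dist_real_def yg .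
  qed
  have inS: "z \<in> closure G - G \<longleftrightarrow> z \<bullet> b k = g (drop_coord b k z)" if "z \<in> N" "z \<in> V" for z
    using SW that NW by blast
  define P where "P \<tau> = {z \<in> V \<inter> N. height k \<tau> g z > 0}" for \<tau> :: real
  define q where "q \<tau> = drop_coord b k y + (y \<bullet> b k + \<tau> * (3/4 * h)) *\<^sub>R b k" for \<tau> :: real
  have dd: "drop_coord b k (drop_coord b k z + a *\<^sub>R b k) = drop_coord b k z"
     "(drop_coord b k z + a *\<^sub>R b k) \<bullet> b k = a" if "z \<in> V" for z a
    using drop_coord_eq_base[OF that W(2)] drop_coord_line[OF W(2)] line_inner[OF W(2)] by simp_all
  have qN: "z \<in> N \<Longrightarrow> z \<in> V \<Longrightarrow> drop_coord b k z + (y \<bullet> b k + \<tau> * (3/4 * h)) *\<^sub>R b k \<in> V \<inter> N" if "\<tau> \<in> {-1,1}" for z \<tau>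
    using that h0 dd[of z] by (auto simp: N_def dist_real_def intro!: add_in_V drop_coord_in_V W)
  have same: "z \<in> G \<longleftrightarrow> q \<tau> \<in> G" if \<tau>: "\<tau> \<in> {-1,1}" and z: "z \<in> P \<tau>" for z \<tau>
  proof -
    have zN: "z \<in> N" "z \<in> V" and zh: "\<tau> * (z \<bullet> b k) > \<tau> * g (drop_coord b k z)"
      using z by (auto simp: P_def height_def right_diff_distrib)
    define z' where "z' = drop_coord b k z + (y \<bullet> b k + \<tau> * (3/4 * h)) *\<^sub>R b k"
    \<comment> \<open>a point of one part is joined to the reference point \<open>q \<tau>\<close> by a vertical segment inside \<open>L\<close> and then inside the slab \<open>Q\<close>, both convex
      and disjoint from the graph\<close>
    define L where "L = V \<inter> N \<inter> (drop_coord b k -` {drop_coord b k z} \<inter> (\<lambda>w. \<tau> * (w \<bullet> b k)) -` {\<tau> * g (drop_coord b k z) <..})"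
    define Q where "Q = V \<inter> N \<inter> (\<lambda>w. \<tau> * (w \<bullet> b k)) -` {\<tau> * (y \<bullet> b k) + h / 2 <..}"
    have lin: "linear (\<lambda>w. \<tau> * (w \<bullet> b k))"
      by (intro bounded_linear.linear bounded_linear_const_mult bounded_linear_inner_left)
    have t2: "\<tau> * (\<tau> * u) = u" for u using \<tau> by auto
    have z'V: "z' \<in> V \<inter> N" unfolding z'_def by (rule qN[OF \<tau> zN])
    have "\<bar>\<tau> * g (drop_coord b k z) - \<tau> * (y \<bullet> b k)\<bar> < h / 2"
      using gclose[OF zN(1)] \<tau> by (auto simp: abs_minus_commute)
    then have g1: "\<tau> * g (drop_coord b k z) < \<tau> * (y \<bullet> b k) + h / 2" by linarith
    have z'k: "\<tau> * (z' \<bullet> b k) = \<tau> * (y \<bullet> b k) + 3/4 * h"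
      unfolding z'_def dd(2)[OF zN(2)] by (simp add: distrib_left t2)
    have qk: "\<tau> * (q \<tau> \<bullet> b k) = \<tau> * (y \<bullet> b k) + 3/4 * h"
      unfolding q_def dd(2)[OF yV] by (simp add: distrib_left t2)
    have "z \<in> G \<longleftrightarrow> z' \<in> G"
    proof (rule connected_avoiding_boundary[OF GV, where C = L])
      show "convex L" unfolding L_def
        by (intro convex_Int cN subspace_imp_convex[OF subspace_V] convex_linear_vimage linear_drop_coord lin) auto
      show "L \<subseteq> V" by (auto simp: L_def)
      show "z \<in> L" using zN zh by (simp add: L_def)
      show "z' \<in> L" using z'V g1 z'k dd(1)[OF zN(2)] h0 by (simp add: L_def z'_def)
      show "L \<inter> (closure G - G) = {}"
      proof (rule ccontr)
        assume "L \<inter> (closure G - G) \<noteq> {}"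
        then obtain w where w: "w \<in> L" "w \<in> closure G - G" by blast
        then have "w \<bullet> b k = g (drop_coord b k w)" using inS[of w] by (auto simp: L_def)
        moreover have "drop_coord b k w = drop_coord b k z" using w(1) by (simp add: L_def)
        ultimately have "w \<bullet> b k = g (drop_coord b k z)" by simp
        then show False using w(1) by (auto simp: L_def)
      qed
    qed
    also have "z' \<in> G \<longleftrightarrow> q \<tau> \<in> G"
    proof (rule connected_avoiding_boundary[OF GV, where C = Q])
      show "convex Q" unfolding Q_def
        by (intro convex_Int cN subspace_imp_convex[OF subspace_V] convex_linear_vimage lin) auto
      show "Q \<subseteq> V" by (auto simp: Q_def)
      show "z' \<in> Q" using z'V z'k h0 by (simp add: Q_def)
      show "q \<tau> \<in> Q" using qN[OF \<tau> yN yV, folded q_def] qk h0 by (simp add: Q_def)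
      show "Q \<inter> (closure G - G) = {}"
      proof (rule ccontr)
        assume "Q \<inter> (closure G - G) \<noteq> {}"
        then obtain w where w: "w \<in> Q" "w \<in> closure G - G" by blast
        then have "w \<bullet> b k = g (drop_coord b k w)" using inS[of w] by (auto simp: Q_def)
        then have "\<bar>\<tau> * (w \<bullet> b k) - \<tau> * (y \<bullet> b k)\<bar> < h / 2"
          using gclose[of w] w(1) \<tau> by (auto simp: Q_def abs_minus_commute)
        moreover have "\<tau> * (y \<bullet> b k) + h / 2 < \<tau> * (w \<bullet> b k)" using w(1) by (simp add: Q_def)
        ultimately show False by linarith
      qed
    qed
    finally show ?thesis .
  qed
  have cover: "z \<in> P 1 \<or> z \<in> P (-1)" if "z \<in> N" "z \<in> V" "z \<notin> closure G - G" for z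
    using inS[OF that(1,2)] that by (auto simp: P_def height_def)
  have GsubV: "G \<subseteq> V" using openin_subset[OF GV] by simp
  obtain z1 where z1: "z1 \<in> G" "z1 \<in> N"
  proof -
    have "N \<inter> closure G \<noteq> {}" using y yN by auto
    then have "N \<inter> G \<noteq> {}" using open_Int_closure_eq_empty[OF oN] by blast
    then show ?thesis using that by blast
  qed
  have q_in: "q 1 \<in> G \<or> q (-1) \<in> G"
    using cover[of z1] same[of 1 z1] same[of "-1" z1] z1 GsubV by auto
  have q_out: "q 1 \<notin> G \<or> q (-1) \<notin> G"
  proof -
    have y0: "height k0 s0 g0 y = 0"
    proof -
      have "y \<in> (closure G - G) \<inter> N0" using y by blast
      then show ?thesis unfolding one_sided_boundary[OF os GV] by (simp add: height_def)
    qed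
    have "((\<lambda>t::real. y + (- t * s0) *\<^sub>R b k0) \<longlongrightarrow> y + (- 0 * s0) *\<^sub>R b k0) (at_right 0)" by (intro tendsto_intros)
    from topological_tendstoD[OF this oN] yN
    have "eventually (\<lambda>t. y + (- t * s0) *\<^sub>R b k0 \<in> N) (at_right 0)" by simp
    moreover have "eventually (\<lambda>t::real. t > 0) (at_right 0)" by (rule eventually_at_right_less)
    ultimately have "eventually (\<lambda>t. t > 0 \<and> y + (- t * s0) *\<^sub>R b k0 \<in> N) (at_right 0)"
      by eventually_elim simp
    then obtain t where t: "t > 0" "y + (- t * s0) *\<^sub>R b k0 \<in> N"
      using eventually_happens[of _ "at_right (0::real)"] by auto
    let ?z = "y + (- t * s0) *\<^sub>R b k0"
    have "height k0 s0 g0 ?z = height k0 s0 g0 y - t * (s0 * s0)"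
      unfolding height_def drop_coord_add[OF N0(2,2)] using N0(2)
      by (simp add: inner_add_left orth algebra_simps)
    also have "s0 * s0 = 1" using N0(4) by auto
    finally have neg: "height k0 s0 g0 ?z < 0" using y0 t by simp
    have zV: "?z \<in> V" by (intro add_in_V yV N0)
    have "?z \<notin> closure G"
    proof
      assume "?z \<in> closure G"
      then have "?z \<in> closure G \<inter> N0" using t NW by blast
      then show False unfolding one_sided_closure[OF os GV] using neg by simp
    qed
    then show ?thesis
      using cover[OF t(2) zV] same[of 1 ?z] same[of "-1" ?z] closure_subset[of G] by auto
  qed
  obtain \<tau> where \<tau>: "\<tau> \<in> {-1, 1}" "q \<tau> \<in> G" "q (- \<tau>) \<notin> G"
  proof (cases "q 1 \<in> G")
    case True
    then show ?thesis using that[of 1] q_out by simp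
  next
    case False
    then show ?thesis using that[of "-1"] q_in by simp
  qed
  have "G \<inter> N = P \<tau>"
  proof (intro equalityI subsetI)
    fix z assume z: "z \<in> G \<inter> N"
    then have "z \<in> P \<tau> \<or> z \<in> P (- \<tau>)" using cover[of z] GsubV \<tau>(1) by auto
    moreover have "z \<notin> P (- \<tau>)" using same[of "- \<tau>" z] \<tau> z by auto
    ultimately show "z \<in> P \<tau>" by simp
  next
    fix z assume "z \<in> P \<tau>"
    then show "z \<in> G \<inter> N" using same[OF \<tau>(1), of z] \<tau>(2) by (auto simp: P_def)
  qed
  then have "one_sided G N k \<tau> g" using oN W \<tau>(1) unfolding one_sided_def P_def by blast
  then show ?thesis by (rule that[OF yN NW])
qed

definition smooth_domain :: "'a set \<Rightarrow> bool" where
  "smooth_domain G \<longleftrightarrow> openin (top_of_set V) G \<and> bounded G \<and>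
     (\<forall>y\<in>closure G - G. \<exists>N k s g. y \<in> N \<and> one_sided G N k s g)"

lemma unit_exterior_normal_in_V:
  assumes sd: "smooth_domain G" and y: "y \<in> closure G - G"
  shows "unit_exterior_normal b m G y \<in> V"
proof -
  obtain N k s g where N: "y \<in> N" "one_sided G N k s g" and GV: "openin (top_of_set V) G"
    using sd y unfolding smooth_domain_def by blast
  have "y \<in> (closure G - G) \<inter> N" using y N(1) by (rule IntI)
  from unit_exterior_normal_eq[OF N(2) GV this] show ?thesis by (simp only: chart_normal_in_V)
qed

lemma patch_measures_agree:
  assumes sd: "smooth_domain G"
    and p1: "graph_patch b m (closure G - G) W1 k1 g1" and p2: "graph_patch b m (closure G - G) W2 k2 g2"
    and A: "A \<in> sets borel" "A \<subseteq> W1" "A \<subseteq> W2"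
  shows "emeasure (patch_measure k1 g1) A = emeasure (patch_measure k2 g2) A"
proof -
  let ?S = "closure G - G"
  have GV: "openin (top_of_set V) G" and bG: "bounded G" using sd by (auto simp: smooth_domain_def)
  have GB: "G \<in> sets borel" by (rule openin_borel[OF GV])
  have SB: "?S \<in> sets borel" by (intro sets.Diff borel_closed closed_closure GB)
  define \<B> where "\<B> = {B. open B \<and> (\<forall>A\<in>sets borel. A \<subseteq> B \<longrightarrow> emeasure (patch_measure k1 g1) A = emeasure (patch_measure k2 g2) A)}"
  have "A \<inter> ?S \<subseteq> \<Union>\<B>"
  proof
    fix y assume y: "y \<in> A \<inter> ?S"
    then obtain N0 k0 s0 g0 where 0: "y \<in> N0" "one_sided G N0 k0 s0 g0" using sd unfolding smooth_domain_def by blast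
    have y': "y \<in> ?S" "y \<in> W1" "y \<in> W2" using y A by blast+
    obtain N1 s1 where 1: "y \<in> N1" "one_sided G N1 k1 s1 g1"
      by (rule patch_imp_one_sided[OF GV 0(2) p1 y'(1,2) 0(1)])
    obtain N2 s2 where 2: "y \<in> N2" "one_sided G N2 k2 s2 g2"
      by (rule patch_imp_one_sided[OF GV 0(2) p2 y'(1,3) 0(1)])
    have o: "open (N1 \<inter> N2)" using 1(2) 2(2) unfolding one_sided_def by blast
    obtain r where r: "r > 0" "cball y r \<subseteq> N1 \<inter> N2"
      using open_contains_cball[THEN iffD1, OF o] 1(1) 2(1) by blast
    have "ball y r \<in> \<B>"
      unfolding \<B>_def
    proof (intro CollectI conjI ballI impI)
      fix A' assume "A' \<in> sets borel" "A' \<subseteq> ball y r"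
      then show "emeasure (patch_measure k1 g1) A' = emeasure (patch_measure k2 g2) A'"
        by (rule patch_measures_agree_on_ball[OF one_sided_subset[OF 1(2) o Int_lower1]
              one_sided_subset[OF 2(2) o Int_lower2] GV bG r])
    qed simp
    moreover have "y \<in> ball y r" using r(1) by simp
    ultimately show "y \<in> \<Union>\<B>" by (rule UnionI)
  qed
  then have "emeasure (patch_measure k1 g1) (A \<inter> ?S) = emeasure (patch_measure k2 g2) (A \<inter> ?S)"
  proof (rule emeasure_eq_by_open_cover[where \<B> = \<B>, rotated -1])
    show "A \<inter> ?S \<in> sets borel" using A(1) SB by (rule sets.Int)
    show "open B" if "B \<in> \<B>" for B using that unfolding \<B>_def by blast
    show "emeasure (patch_measure k1 g1) A' = emeasure (patch_measure k2 g2) A'"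
      if "B \<in> \<B>" "A' \<in> sets borel" "A' \<subseteq> B" for A' B
      using that unfolding \<B>_def by blast
  qed (rule sets_patch_measure)+
  then show ?thesis
    unfolding patch_measure_restrict[OF p1 A(1,2) SB] patch_measure_restrict[OF p2 A(1,3) SB] .
qed

lemma is_surface_measure_patch:
  assumes "is_surface_measure b m S M" "graph_patch b m S W k g" "A \<in> sets borel" "A \<subseteq> W"
  shows "emeasure M A = emeasure (patch_measure k g) A"
proof -
  have k: "k < m" "C_inf g" using assms(2) unfolding graph_patch_def by blast+
  have "emeasure M A = (\<integral>\<^sup>+ c. ennreal (graph_area_density b m k g c) * indicator A (graph_point b m k g c) \<partial>base_measure k)"
    using assms unfolding is_surface_measure_def by blast
  then show ?thesis using emeasure_patch_measure[OF k(2,1) assms(3)] by simp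
qed

text \<open>Countably many patches cover the boundary; cut it into disjoint pieces, each inside one
  patch, and add the patch measures. Since patch measures agree on overlaps, the sum has the right
  values on every patch. A second surface measure agrees with this one inside each patch, hence
  everywhere.\<close>

lemma is_surface_measure_surface_measure:
  assumes sd: "smooth_domain G"
  shows "is_surface_measure b m (closure G - G) (surface_measure b m (closure G - G))"
proof -
  define S where "S = closure G - G"
  have GV: "openin (top_of_set V) G" using sd by (auto simp: smooth_domain_def)
  have GB: "G \<in> sets borel" by (rule openin_borel[OF GV])
  have SB: "S \<in> sets borel" unfolding S_def by (intro sets.Diff borel_closed closed_closure GB)
  define \<P> where "\<P> = {N. \<exists>k g. graph_patch b m S N k g}"
  have op: "open N" if "N \<in> \<P>" for N using that unfolding \<P>_def graph_patch_def by blast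
  have cov: "S \<subseteq> \<Union>\<P>"
  proof
    fix y assume "y \<in> S"
    then obtain N k s g where "y \<in> N" "one_sided G N k s g" using sd unfolding smooth_domain_def S_def by blast
    then show "y \<in> \<Union>\<P>" using one_sided_imp_patch[OF _ GV] unfolding \<P>_def S_def by blast
  qed
  obtain \<P>' where P': "\<P>' \<subseteq> \<P>" "countable \<P>'" "\<Union>\<P>' = \<Union>\<P>" using Lindelof[OF op] by blast
  \<comment> \<open>the empty set is inserted since the boundary may be empty\<close>
  define N where "N = from_nat_into (insert {} \<P>')"
  have rN: "range N = insert {} \<P>'" unfolding N_def using P'(2) by (intro range_from_nat_into) auto
  have Ncase: "N n = {} \<or> (\<exists>k g. graph_patch b m S (N n) k g)" for n
  proof -
    have "N n \<in> insert {} \<P>'" unfolding rN[symmetric] by (rule rangeI)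
    then consider "N n = {}" | "N n \<in> \<P>" using P'(1) by blast
    then show ?thesis by cases (simp_all add: \<P>_def)
  qed
  then have "\<forall>n. \<exists>t. N n = {} \<or> graph_patch b m S (N n) (fst t) (snd t)" by force
  from choice[OF this] obtain t where t: "\<forall>n. N n = {} \<or> graph_patch b m S (N n) (fst (t n)) (snd (t n))" ..
  define k g where "k n = fst (t n)" and "g n = snd (t n)" for n
  have kg: "N n = {} \<or> graph_patch b m S (N n) (k n) (g n)" for n
    unfolding k_def g_def using t by (rule spec)
  have SN: "S \<subseteq> (\<Union>n. N n)" using cov unfolding rN P'(3)[symmetric] by blast
  have oN: "open (N n)" for n
  proof (cases "N n = {}")
    case False
    then have "graph_patch b m S (N n) (k n) (g n)" using kg[of n] by blast
    then show ?thesis unfolding graph_patch_def by blast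
  qed simp
  define D where "D = disjointed N"
  have Dm: "D n \<in> sets borel" for n
    unfolding D_def disjointed_def by (intro sets.Diff sets.finite_UN borel_open oN) auto
  have Dsub: "D n \<subseteq> N n" for n unfolding D_def by (rule disjointed_subset)
  have Ddis: "disjoint_family D" unfolding D_def by (rule disjoint_family_disjointed)
  have UD: "(\<Union>n. D n) = (\<Union>n. N n)" unfolding D_def by (rule UN_disjointed_eq)
  define \<mu> where "\<mu> A = (\<Sum>n. emeasure (patch_measure (k n) (g n)) (A \<inter> D n))" for A
  define M0 where "M0 = measure_of UNIV (sets borel) \<mu>"
  have setsM0: "sets M0 = sets borel" unfolding M0_def by (simp add: sets.sigma_sets_eq[of borel, simplified])
  have emM0: "emeasure M0 A = \<mu> A" if "A \<in> sets borel" for A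
  proof (rule emeasure_measure_of[OF M0_def])
    show "sets borel \<subseteq> Pow UNIV" by auto
    show "positive (sets M0) \<mu>" by (simp add: positive_def \<mu>_def)
    show "A \<in> sets M0" using that setsM0 by simp
    show "countably_additive (sets M0) \<mu>"
    proof (rule countably_additiveI)
      fix X :: "nat \<Rightarrow> 'a set" assume X: "range X \<subseteq> sets M0" "disjoint_family X"
      have XD: "emeasure (patch_measure (k n) (g n)) ((\<Union>i. X i) \<inter> D n) = (\<Sum>i. emeasure (patch_measure (k n) (g n)) (X i \<inter> D n))" for n
      proof -
        have "range (\<lambda>i. X i \<inter> D n) \<subseteq> sets (patch_measure (k n) (g n))"
          using X(1) Dm setsM0 by auto
        moreover have "disjoint_family (\<lambda>i. X i \<inter> D n)" using X(2) by (auto simp: disjoint_family_on_def)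
        ultimately have "(\<Sum>i. emeasure (patch_measure (k n) (g n)) (X i \<inter> D n)) = emeasure (patch_measure (k n) (g n)) (\<Union>i. X i \<inter> D n)"
          by (rule suminf_emeasure)
        also have "(\<Union>i. X i \<inter> D n) = (\<Union>i. X i) \<inter> D n" by auto
        finally show ?thesis by simp
      qed
      have "(\<Sum>i. \<mu> (X i)) = (\<Sum>i. \<integral>\<^sup>+n. emeasure (patch_measure (k n) (g n)) (X i \<inter> D n) \<partial>count_space UNIV)"
        unfolding \<mu>_def nn_integral_count_space_nat ..
      also have "\<dots> = (\<integral>\<^sup>+n. (\<Sum>i. emeasure (patch_measure (k n) (g n)) (X i \<inter> D n)) \<partial>count_space UNIV)"
        by (rule nn_integral_suminf[symmetric]) simp
      also have "\<dots> = \<mu> (\<Union>i. X i)"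
        unfolding \<mu>_def nn_integral_count_space_nat XD ..
      finally show "(\<Sum>i. \<mu> (X i)) = \<mu> (\<Union>i. X i)" .
    qed
  qed
  have M0: "is_surface_measure b m S M0"
    unfolding is_surface_measure_def
  proof (intro conjI allI impI)
    show "sets M0 = sets borel" by (rule setsM0)
    have "emeasure (patch_measure (k n) (g n)) (- S \<inter> D n) = 0" for n
    proof (cases "N n = {}")
      case True
      then show ?thesis using Dsub[of n] by simp
    next
      case False
      then have "graph_patch b m S (N n) (k n) (g n)" using kg[of n] by blast
      then have "emeasure (patch_measure (k n) (g n)) (- S \<inter> D n) = emeasure (patch_measure (k n) (g n)) (- S \<inter> D n \<inter> S)"
        by (rule patch_measure_restrict) (use Dsub Dm SB in auto)
      also have "- S \<inter> D n \<inter> S = {}" by auto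
      finally show ?thesis by simp
    qed
    then show "emeasure M0 (- S) = 0" using emM0[of "- S"] SB by (simp add: \<mu>_def)
  next
    fix W k' g' A assume p: "graph_patch b m S W k' g'" and A: "A \<in> sets borel" "A \<subseteq> W"
    have k': "k' < m" "C_inf g'" using p unfolding graph_patch_def by blast+
    have "emeasure M0 A = \<mu> A" by (rule emM0[OF A(1)])
    also have "\<dots> = (\<Sum>n. emeasure (patch_measure k' g') (A \<inter> D n))"
      unfolding \<mu>_def
    proof (rule suminf_cong)
      fix n
      show "emeasure (patch_measure (k n) (g n)) (A \<inter> D n) = emeasure (patch_measure k' g') (A \<inter> D n)"
      proof (cases "N n = {}")
        case True
        then show ?thesis using Dsub[of n] by simp
      next
        case False
        then have "graph_patch b m S (N n) (k n) (g n)" using kg[of n] by blast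
        then show ?thesis using p unfolding S_def
          by (rule patch_measures_agree[OF sd]) (use A Dsub Dm in auto)
      qed
    qed
    also have "\<dots> = emeasure (patch_measure k' g') (\<Union>n. A \<inter> D n)"
    proof (rule suminf_emeasure)
      show "range (\<lambda>n. A \<inter> D n) \<subseteq> sets (patch_measure k' g')" using A Dm by auto
      show "disjoint_family (\<lambda>n. A \<inter> D n)" using Ddis unfolding disjoint_family_on_def by blast
    qed
    also have "(\<Union>n. A \<inter> D n) = A \<inter> (\<Union>n. N n)" using UD by auto
    also have "emeasure (patch_measure k' g') (A \<inter> (\<Union>n. N n)) = emeasure (patch_measure k' g') (A \<inter> (\<Union>n. N n) \<inter> S)"
      by (rule patch_measure_restrict[OF p _ _ SB]) (use A oN in auto)
    also have "A \<inter> (\<Union>n. N n) \<inter> S = A \<inter> S" using SN by auto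
    also have "emeasure (patch_measure k' g') (A \<inter> S) = emeasure (patch_measure k' g') A"
      by (rule patch_measure_restrict[OF p A SB, symmetric])
    finally show "emeasure M0 A = (\<integral>\<^sup>+ c. ennreal (graph_area_density b m k' g' c) * indicator A (graph_point b m k' g' c) \<partial>base_measure k')"
      using emeasure_patch_measure[OF k'(2,1) A(1)] by simp
  qed
  have "M = M0" if M: "is_surface_measure b m S M" for M
  proof (rule measure_eqI)
    have sM: "sets M = sets borel" and nM: "emeasure M (- S) = 0" using M by (auto simp: is_surface_measure_def)
    show "sets M = sets M0" using sM setsM0 by simp
    have n0: "emeasure M0 (- S) = 0" using M0 by (simp add: is_surface_measure_def)
    have cut: "emeasure M' A = emeasure M' (A \<inter> S)"
      if "sets M' = sets borel" "emeasure M' (- S) = 0" "A \<in> sets borel" for M' A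
    proof -
      have "A \<inter> S \<union> (A - S) = A" by auto
      moreover have "A - S \<in> null_sets M'"
        by (rule null_sets_subset[of "- S"]) (use that SB in \<open>auto simp: null_sets_def\<close>)
      ultimately show ?thesis using emeasure_Un_null_set[of "A \<inter> S" M' "A - S"] that(1,3) SB by simp
    qed
    fix A assume "A \<in> sets M"
    then have A: "A \<in> sets borel" using sM by simp
    have "emeasure M (A \<inter> S) = emeasure M0 (A \<inter> S)"
    proof (rule emeasure_eq_by_open_cover[where \<B> = \<P>, OF sM setsM0 op])
      show "A \<inter> S \<in> sets borel" using A SB by auto
      show "A \<inter> S \<subseteq> \<Union>\<P>" using cov by auto
      show "emeasure M A' = emeasure M0 A'" if "B \<in> \<P>" "A' \<in> sets borel" "A' \<subseteq> B" for A' B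
      proof -
        from that(1) obtain k g where p: "graph_patch b m S B k g" by (auto simp: \<P>_def)
        then show ?thesis
          using is_surface_measure_patch[OF M p that(2,3)] is_surface_measure_patch[OF M0 p that(2,3)] by simp
      qed
    qed
    then show "emeasure M A = emeasure M0 A" using cut[OF sM nM A] cut[OF setsM0 n0 A] by simp
  qed
  then have "surface_measure b m S = M0" unfolding surface_measure_def using M0 by (intro the_equality)
  then show ?thesis using M0 by (simp add: S_def)
qed

end

section \<open>The divergence theorem on a smooth domain\<close>

text \<open>Equal to 1 on the ball of radius \<open>r\<close> and to 0 outside the ball of radius
  \<open>2 r\<close>.\<close>

definition cutoff :: "'a::euclidean_space \<Rightarrow> real \<Rightarrow> 'a \<Rightarrow> real" where
  "cutoff x r y = 1 - smooth_step ((y - x) \<bullet> (y - x) / r\<^sup>2)"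

lemma C1_dir_cutoff: assumes "r > 0" shows "C1_dir v (cutoff x r)"
proof -
  have "((\<lambda>u. 1 - smooth_step (u / r\<^sup>2)) has_real_derivative - (smooth_step' (u / r\<^sup>2) * (1 / r\<^sup>2))) (at u)" for u
  proof -
    have "((\<lambda>u. u / r\<^sup>2) has_real_derivative 1 / r\<^sup>2) (at u)"
      using DERIV_cdivide[OF DERIV_ident] .
    from DERIV_diff[OF DERIV_const DERIV_chain2[OF smooth_step_deriv this]]
    show ?thesis by simp
  qed
  then have "C1_dir v (\<lambda>y. (\<lambda>u. 1 - smooth_step (u / r\<^sup>2)) ((y - x) \<bullet> (y - x)))"
    by (rule C1_dir_compose[OF C1_dir_dist_square]) (intro continuous_intros, use assms in auto)
  then show ?thesis unfolding cutoff_def[abs_def] .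
qed

lemma cutoff_1: assumes "r > 0" "y \<in> ball x r" shows "cutoff x r y = 1"
proof -
  have "(norm (y - x))\<^sup>2 \<le> r\<^sup>2" using assms by (intro power_mono) (auto simp: dist_norm norm_minus_commute)
  then show ?thesis using assms(1) by (simp add: cutoff_def power2_norm_eq_inner smooth_step_0)
qed

lemma cutoff_0: assumes "r > 0" "y \<notin> cball x (2 * r)" shows "cutoff x r y = 0"
proof -
  have "(2 * r)\<^sup>2 \<le> (norm (y - x))\<^sup>2" using assms by (intro power_mono) (auto simp: dist_norm norm_minus_commute)
  moreover have "2 * r\<^sup>2 \<le> (2 * r)\<^sup>2" by (simp add: power_mult_distrib)
  ultimately have "2 * r\<^sup>2 \<le> (y - x) \<bullet> (y - x)"
    unfolding power2_norm_eq_inner[symmetric] by linarith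
  then have "smooth_step ((y - x) \<bullet> (y - x) / r\<^sup>2) = 1"
    using assms(1) by (intro smooth_step_1) (simp add: field_simps)
  then show ?thesis by (simp add: cutoff_def)
qed

context frame
begin

lemma admissible_mult:
  assumes ad: "admissible i Z G F F'" and G: "openin (top_of_set V) G" "bounded G"
    and p: "continuous_on UNIV \<phi>" "continuous_on UNIV \<phi>'"
      "\<And>y. ((\<lambda>t. \<phi> (y + t *\<^sub>R b i)) has_real_derivative \<phi>' y) (at 0)"
  shows "admissible i Z G (\<lambda>y. \<phi> y *\<^sub>R F y) (\<lambda>y. \<phi> y *\<^sub>R F' y + \<phi>' y *\<^sub>R F y)"
proof -
  note cont = admissibleD(1)[OF ad] and der = admissibleD(2)[OF ad] and meas = admissibleD(3)[OF ad]
  obtain B where B: "\<And>y. y \<in> G \<Longrightarrow> norm (F' y) \<le> B" using admissibleD(4)[OF ad] by blast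
  have cG: "compact (closure G)" using G by simp
  have bound: "\<exists>C. \<forall>y\<in>closure G. norm (h y) \<le> C" if "continuous_on (closure G) h" for h :: "'a \<Rightarrow> 'd::euclidean_space"
    using compact_imp_bounded[OF compact_continuous_image[OF that cG]] by (auto simp: bounded_iff)
  obtain C where C: "\<And>y. y \<in> closure G \<Longrightarrow> norm (\<phi> y) \<le> C"
    using bound[OF continuous_on_subset[OF p(1)]] by auto
  obtain C' where C': "\<And>y. y \<in> closure G \<Longrightarrow> norm (\<phi>' y *\<^sub>R F y) \<le> C'"
    using bound[of "\<lambda>y. \<phi>' y *\<^sub>R F y"] continuous_on_scaleR[OF continuous_on_subset[OF p(2) subset_UNIV] cont] by blast
  show ?thesis
    unfolding admissible_def
  proof (intro conjI ballI)
    show "continuous_on (closure G) (\<lambda>y. \<phi> y *\<^sub>R F y)"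
      by (rule continuous_on_scaleR[OF continuous_on_subset[OF p(1) subset_UNIV] cont])
    show "((\<lambda>t. \<phi> (y + t *\<^sub>R b i) *\<^sub>R F (y + t *\<^sub>R b i)) has_vector_derivative \<phi> y *\<^sub>R F' y + \<phi>' y *\<^sub>R F y) (at 0)"
      if "y \<in> G - Z" for y
      using has_vector_derivative_scaleR[OF p(3)[of y] der[OF that]] by simp
    have [measurable]: "\<phi> \<in> borel_measurable borel" "\<phi>' \<in> borel_measurable borel"
      by (intro borel_measurable_continuous_onI p)+
    have m2: "(\<lambda>y. indicator G y *\<^sub>R F y) \<in> borel_measurable borel"
      by (intro borel_measurable_continuous_on_indicator openin_borel G continuous_on_subset[OF cont] closure_subset)
    have "(\<lambda>y. \<phi> y *\<^sub>R (indicator G y *\<^sub>R F' y) + \<phi>' y *\<^sub>R (indicator G y *\<^sub>R F y)) \<in> borel_measurable borel"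
      by (intro borel_measurable_add borel_measurable_scaleR meas m2) auto
    also have "(\<lambda>y. \<phi> y *\<^sub>R (indicator G y *\<^sub>R F' y) + \<phi>' y *\<^sub>R (indicator G y *\<^sub>R F y)) =
       (\<lambda>y. indicator G y *\<^sub>R (\<phi> y *\<^sub>R F' y + \<phi>' y *\<^sub>R F y))"
      by (simp add: scaleR_add_right mult.commute)
    finally show "(\<lambda>y. indicator G y *\<^sub>R (\<phi> y *\<^sub>R F' y + \<phi>' y *\<^sub>R F y)) \<in> borel_measurable borel" .
    show "\<exists>B. \<forall>y\<in>G. norm (\<phi> y *\<^sub>R F' y + \<phi>' y *\<^sub>R F y) \<le> B"
    proof (intro exI ballI)
      fix y assume y: "y \<in> G"
      then have y': "y \<in> closure G" using closure_subset by auto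
      have "norm (\<phi> y *\<^sub>R F' y) \<le> \<bar>C\<bar> * \<bar>B\<bar>"
        unfolding norm_scaleR
        by (rule mult_mono) (use C[OF y'] B[OF y] in auto)
      then show "norm (\<phi> y *\<^sub>R F' y + \<phi>' y *\<^sub>R F y) \<le> \<bar>C\<bar> * \<bar>B\<bar> + C'"
        by (intro norm_triangle_le add_mono C'[OF y'])
    qed
  qed
qed

lemma admissible_integrable:
  assumes ad: "admissible i Z G F F'" and G: "bounded G"
  shows "integrable vol (\<lambda>y. indicator G y *\<^sub>R F' y)"
proof -
  note meas = admissibleD(3)[OF ad]
  obtain B where B: "\<And>y. y \<in> G \<Longrightarrow> norm (F' y) \<le> B" using admissibleD(4)[OF ad] by blast
  obtain R where R: "\<And>y. y \<in> G \<Longrightarrow> norm y \<le> R" using G by (auto simp: bounded_iff)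
  show ?thesis
  proof (rule integrable_vol_bounded[OF meas, where B = "\<bar>B\<bar>" and R = R])
    show "norm (indicator G y *\<^sub>R F' y) \<le> \<bar>B\<bar>" for y
      using B[of y] by (cases "y \<in> G") auto
    show "indicator G y *\<^sub>R F' y = 0" if "norm y > R" for y
      using R[of y] that by (cases "y \<in> G") auto
  qed
qed

lemma surface_integral_patch:
  fixes f :: "'a \<Rightarrow> 'c::euclidean_space"
  assumes M: "is_surface_measure b m S M" and p: "graph_patch b m S N k g"
    and f[measurable]: "f \<in> borel_measurable borel" and f0: "\<And>y. y \<notin> N \<Longrightarrow> f y = 0"
  shows "integral\<^sup>L M f = integral\<^sup>L (patch_measure k g) f"
    and "integrable M f \<longleftrightarrow> integrable (patch_measure k g) f"
proof -
  have sM[measurable_cong, simp]: "sets M = sets borel" using M by (simp add: is_surface_measure_def)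
  have N[measurable]: "N \<in> sets borel" using p by (simp add: graph_patch_def)
  let ?d = "\<lambda>y. indicator N y :: real"
  have eq: "density M (\<lambda>y. ennreal (?d y)) = density (patch_measure k g) (\<lambda>y. ennreal (?d y))"
  proof (rule measure_eqI)
    fix A assume "A \<in> sets (density M (\<lambda>y. ennreal (?d y)))"
    then have A[measurable]: "A \<in> sets borel" by simp
    have "emeasure (density M' (\<lambda>y. ennreal (?d y))) A = emeasure M' (A \<inter> N)"
      if [measurable_cong, simp]: "sets M' = sets borel" for M'
    proof -
      have "emeasure (density M' (\<lambda>y. ennreal (?d y))) A = (\<integral>\<^sup>+y. ennreal (?d y) * indicator A y \<partial>M')"
        by (subst emeasure_density) auto
      also have "\<dots> = (\<integral>\<^sup>+y. indicator (A \<inter> N) y \<partial>M')"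
        by (rule nn_integral_cong) (simp split: split_indicator)
      also have "\<dots> = emeasure M' (A \<inter> N)" by (rule nn_integral_indicator) simp
      finally show ?thesis .
    qed
    note d = this
    show "emeasure (density M (\<lambda>y. ennreal (?d y))) A = emeasure (density (patch_measure k g) (\<lambda>y. ennreal (?d y))) A"
      unfolding d[OF sM] d[OF sets_patch_measure]
      by (rule is_surface_measure_patch[OF M p]) auto
  qed simp
  have fN: "(\<lambda>y. ?d y *\<^sub>R f y) = f" using f0 by (auto simp: indicator_def)
  have 1: "integral\<^sup>L (density M' (\<lambda>y. ennreal (?d y))) f = integral\<^sup>L M' f"
    "integrable (density M' (\<lambda>y. ennreal (?d y))) f \<longleftrightarrow> integrable M' f"
    if [measurable_cong, simp]: "sets M' = sets borel" for M'
    by (subst integral_density; simp add: fN) (subst integrable_density; simp add: fN)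
  show "integral\<^sup>L M f = integral\<^sup>L (patch_measure k g) f"
    using 1(1)[OF sM] 1(1)[OF sets_patch_measure] eq by simp
  show "integrable M f \<longleftrightarrow> integrable (patch_measure k g) f"
    using 1(2)[OF sM] 1(2)[OF sets_patch_measure] eq by simp
qed

lemma smooth_domain_compact_boundary:
  assumes "smooth_domain G" shows "compact (closure G - G)"
proof -
  have GV: "openin (top_of_set V) G" and bG: "bounded G" using assms unfolding smooth_domain_def by blast+
  obtain T where T: "open T" "G = V \<inter> T" using GV by (auto simp: openin_open)
  have "closure G \<subseteq> V" using T by (intro closure_minimal closed_V) auto
  then have "closure G - G = closure G - T" using T by auto
  then show ?thesis using bG T(1) by (simp add: compact_diff)
qed

text \<open>Cover the boundary by finitely many balls inside one-sided charts and peel off one ball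
  at a time: a cutoff splits \<open>F\<close> into a part supported in a chart, for which the local
  theorem holds, and a part that vanishes near the boundary inside this ball. When no ball is left,
  \<open>F\<close> has compact support in the domain and both sides vanish. Peeling replaces a
  partition of unity.\<close>

theorem divergence_theorem:
  fixes F F' :: "'a \<Rightarrow> 'c::euclidean_space"
  assumes sd: "smooth_domain G" and i: "i < m"
    and Z: "\<And>y. finite {t. y + t *\<^sub>R b i \<in> Z}" and ad: "admissible i Z G F F'"
  defines "S \<equiv> closure G - G"
  shows "integrable (surface_measure b m S) (\<lambda>y. indicator S y *\<^sub>R ((unit_exterior_normal b m G y \<bullet> b i) *\<^sub>R F y)) \<and>
     (\<integral>y. indicator G y *\<^sub>R F' y \<partial>vol) =
     (\<integral>y. indicator S y *\<^sub>R ((unit_exterior_normal b m G y \<bullet> b i) *\<^sub>R F y) \<partial>surface_measure b m S)"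
proof -
  define M where "M = surface_measure b m S"
  have GV: "openin (top_of_set V) G" and bG: "bounded G" using sd unfolding smooth_domain_def by blast+
  have M: "is_surface_measure b m S M" unfolding M_def S_def by (rule is_surface_measure_surface_measure[OF sd])
  have cS: "compact S" unfolding S_def by (rule smooth_domain_compact_boundary[OF sd])
  define \<F> where "\<F> F = (\<lambda>y. indicator S y *\<^sub>R ((unit_exterior_normal b m G y \<bullet> b i) *\<^sub>R (F y :: 'c)))" for F
  have "\<forall>x\<in>S. \<exists>r. r > 0 \<and> (\<exists>N k s g. cball x (2 * r) \<subseteq> N \<and> one_sided G N k s g)"
  proof
    fix x assume "x \<in> S"
    then obtain N k s g where 1: "x \<in> N" "one_sided G N k s g"
      using sd unfolding smooth_domain_def S_def by blast
    have "open N" using 1(2) unfolding one_sided_def by blast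
    then obtain e where e: "e > 0" "cball x e \<subseteq> N" using 1(1) open_contains_cball by blast
    have "e / 2 > 0" "cball x (2 * (e / 2)) \<subseteq> N" using e by auto
    then show "\<exists>r. r > 0 \<and> (\<exists>N k s g. cball x (2 * r) \<subseteq> N \<and> one_sided G N k s g)" using 1(2) by blast
  qed
  from bchoice[OF this] obtain \<rho> where \<rho>: "\<forall>x\<in>S. \<rho> x > 0 \<and> (\<exists>N k s g. cball x (2 * \<rho> x) \<subseteq> N \<and> one_sided G N k s g)" ..
  \<comment> \<open>induction on the balls near whose points \<open>F\<close> need not vanish\<close>
  have claim: "integrable M (\<F> F) \<and> (\<integral>y. indicator G y *\<^sub>R F' y \<partial>vol) = integral\<^sup>L M (\<F> F)"
    if "finite C" "C \<subseteq> S" "admissible i Z G F F'"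
      "\<And>y. y \<in> S \<Longrightarrow> y \<notin> (\<Union>c\<in>C. ball c (\<rho> c)) \<Longrightarrow> \<exists>N. open N \<and> y \<in> N \<and> (\<forall>z\<in>N \<inter> closure G. F z = 0 \<and> F' z = 0)"
    for C F F'
    using that
  proof (induction C arbitrary: F F' rule: finite_induct)
    case empty
    define Y where "Y = \<Union>{N. open N \<and> (\<forall>z\<in>N \<inter> closure G. F z = 0 \<and> F' z = 0)}"
    have oY: "open Y" unfolding Y_def by (intro open_Union) auto
    have Y0: "F z = 0" "F' z = 0" if "z \<in> Y" "z \<in> closure G" for z
      using that unfolding Y_def by blast+
    have SY: "S \<subseteq> Y"
    proof
      fix y assume "y \<in> S"
      then show "y \<in> Y" using empty.prems(3)[of y] unfolding Y_def by blast
    qed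
    have "\<F> F = (\<lambda>y. 0)"
    proof
      fix y show "\<F> F y = 0"
        using Y0(1)[of y] SY by (cases "y \<in> S") (auto simp: \<F>_def S_def)
    qed
    moreover have "(\<integral>y. indicator G y *\<^sub>R F' y \<partial>vol) = 0"
    proof -
      note ad = empty.prems(2)
      obtain B where B: "\<And>y. y \<in> G \<Longrightarrow> norm (F' y) \<le> B" using admissibleD(4)[OF ad] by blast
      show ?thesis
      proof (rule integral_partial_deriv_eq_0[OF i GV, where C = "closure G - Y" and F = F and Z = Z and B = B])
        show "compact (closure G - Y)" using bG oY by (intro compact_diff) auto
        show "closure G - Y \<subseteq> G" using SY by (auto simp: S_def)
        show "F y = 0" "F' y = 0" if "y \<in> G - (closure G - Y)" for y
          using that Y0[of y] closure_subset[of G] by auto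
        show "continuous_on G F" by (rule continuous_on_subset[OF admissibleD(1)[OF ad] closure_subset])
      qed (fact admissibleD[OF ad] Z B)+
    qed
    ultimately show ?case by simp
  next
    case (insert c C)
    have cS: "c \<in> S" "C \<subseteq> S" using insert.prems(1) by auto
    obtain N k s g where \<rho>0: "\<rho> c > 0" and N: "cball c (2 * \<rho> c) \<subseteq> N" "one_sided G N k s g"
      using \<rho> cS by blast
    define \<phi> where "\<phi> = cutoff c (\<rho> c)"
    obtain \<phi>' where p: "continuous_on UNIV \<phi>" "continuous_on UNIV \<phi>'"
      "\<And>y. ((\<lambda>t. \<phi> (y + t *\<^sub>R b i)) has_real_derivative \<phi>' y) (at 0)"
      using C1_dir_cutoff[OF \<rho>0, of "b i" c] unfolding \<phi>_def by (rule C1_dirE) blast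
    define \<psi> where "\<psi> y = 1 - \<phi> y" for y
    define \<psi>' where "\<psi>' y = - \<phi>' y" for y
    have q: "continuous_on UNIV \<psi>" "continuous_on UNIV \<psi>'"
      "((\<lambda>t. \<psi> (y + t *\<^sub>R b i)) has_real_derivative \<psi>' y) (at 0)" for y
      unfolding \<psi>_def[abs_def] \<psi>'_def[abs_def] using DERIV_diff[OF DERIV_const p(3)[of y], of 1]
      by (auto intro!: continuous_intros p)
    have \<phi>1: "\<phi> y = 1" "\<phi>' y = 0" if "y \<in> ball c (\<rho> c)" for y
      using cutoff_1[OF \<rho>0] that has_real_derivative_locally_const[OF p(3) open_ball that, of 1]
      by (auto simp: \<phi>_def)
    have \<phi>0: "\<phi> y = 0" "\<phi>' y = 0" if "y \<notin> cball c (2 * \<rho> c)" for y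
    proof -
      have "open (- cball c (2 * \<rho> c))" by (simp add: open_Compl)
      from has_real_derivative_locally_const[OF p(3)[of y] this _, of 0] cutoff_0[OF \<rho>0] that
      show "\<phi> y = 0" "\<phi>' y = 0" by (auto simp: \<phi>_def)
    qed
    define F1 where "F1 y = \<phi> y *\<^sub>R F y" for y
    define F1' where "F1' y = \<phi> y *\<^sub>R F' y + \<phi>' y *\<^sub>R F y" for y
    define F2 where "F2 y = \<psi> y *\<^sub>R F y" for y
    define F2' where "F2' y = \<psi> y *\<^sub>R F' y + \<psi>' y *\<^sub>R F y" for y
    have ad1: "admissible i Z G F1 F1'"
      unfolding F1_def[abs_def] F1'_def[abs_def] by (rule admissible_mult[OF insert.prems(2) GV bG p])
    have ad2: "admissible i Z G F2 F2'"
      unfolding F2_def[abs_def] F2'_def[abs_def] by (rule admissible_mult[OF insert.prems(2) GV bG q])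
    have IH: "integrable M (\<F> F2) \<and> (\<integral>y. indicator G y *\<^sub>R F2' y \<partial>vol) = integral\<^sup>L M (\<F> F2)"
    proof (rule insert.IH[OF cS(2) ad2])
      fix y assume y: "y \<in> S" "y \<notin> (\<Union>c\<in>C. ball c (\<rho> c))"
      show "\<exists>N. open N \<and> y \<in> N \<and> (\<forall>z\<in>N \<inter> closure G. F2 z = 0 \<and> F2' z = 0)"
      proof (cases "y \<in> ball c (\<rho> c)")
        case True
        then show ?thesis
          using \<phi>1 by (intro exI[of _ "ball c (\<rho> c)"]) (auto simp: F2_def F2'_def \<psi>_def \<psi>'_def)
      next
        case False
        then have "y \<notin> (\<Union>c\<in>insert c C. ball c (\<rho> c))" using y(2) by blast
        from insert.prems(3)[OF y(1) this] obtain N where "open N" "y \<in> N" "\<forall>z\<in>N \<inter> closure G. F z = 0 \<and> F' z = 0" by blast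
        then show ?thesis by (intro exI[of _ N]) (auto simp: F2_def F2'_def)
      qed
    qed
    have loc: "integrable M (\<F> F1) \<and> (\<integral>y. indicator G y *\<^sub>R F1' y \<partial>vol) = integral\<^sup>L M (\<F> F1)"
    proof -
      have z: "F1 y = 0" "F1' y = 0" if "y \<notin> cball c (2 * \<rho> c)" for y
        using \<phi>0[OF that] by (simp_all add: F1_def F1'_def)
      have eq: "(\<lambda>y. indicator ((closure G - G) \<inter> N) y *\<^sub>R ((unit_exterior_normal b m G y \<bullet> b i) *\<^sub>R F1 y)) = \<F> F1"
      proof
        fix y
        show "indicator ((closure G - G) \<inter> N) y *\<^sub>R ((unit_exterior_normal b m G y \<bullet> b i) *\<^sub>R F1 y) = \<F> F1 y"
          using z(1)[of y] subsetD[OF N(1), of y]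
          by (cases "y \<in> cball c (2 * \<rho> c)") (simp_all add: \<F>_def S_def indicator_def)
      qed
      note L = local_divergence_measure[OF N(2) GV bG i compact_cball N(1) _ _ Z ad1, unfolded eq]
      have L1: "(\<integral>y. indicator G y *\<^sub>R F1' y \<partial>vol) = integral\<^sup>L (patch_measure k g) (\<F> F1)"
        by (rule L(1)) (use z in auto)
      have L2: "integrable (patch_measure k g) (\<F> F1)" by (rule L(2)) (use z in auto)
      have L3: "\<F> F1 \<in> borel_measurable borel" by (rule L(3)) (use z in auto)
      have out: "\<F> F1 y = 0" if "y \<notin> N" for y using z(1)[of y] subsetD[OF N(1), of y] that
        by (cases "y \<in> cball c (2 * \<rho> c)") (simp_all add: \<F>_def)
      note P = surface_integral_patch[OF M one_sided_imp_patch[OF N(2) GV, folded S_def] L3 out]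
      show ?thesis using L1 L2 P by simp
    qed
    have sum: "\<F> F = (\<lambda>y. \<F> F1 y + \<F> F2 y)"
    proof
      fix y
      have "F y = F1 y + F2 y" unfolding F1_def F2_def \<psi>_def scaleR_add_left[symmetric] by simp
      then show "\<F> F y = \<F> F1 y + \<F> F2 y" by (simp add: \<F>_def scaleR_add_right)
    qed
    have sum': "(\<lambda>y. indicator G y *\<^sub>R F' y) = (\<lambda>y. indicator G y *\<^sub>R F1' y + indicator G y *\<^sub>R F2' y)"
    proof
      fix y
      have "F1' y + F2' y = (\<phi> y *\<^sub>R F' y + \<psi> y *\<^sub>R F' y) + (\<phi>' y *\<^sub>R F y + \<psi>' y *\<^sub>R F y)"
        by (simp add: F1'_def F2'_def)
      also have "\<dots> = F' y" unfolding scaleR_add_left[symmetric] by (simp add: \<psi>_def \<psi>'_def)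
      finally show "indicator G y *\<^sub>R F' y = indicator G y *\<^sub>R F1' y + indicator G y *\<^sub>R F2' y"
        by (simp add: scaleR_add_right[symmetric])
    qed
    show ?case
      unfolding sum sum'
      using loc IH admissible_integrable[OF ad1 bG] admissible_integrable[OF ad2 bG] by simp
  qed
  have "S \<subseteq> (\<Union>c\<in>S. ball c (\<rho> c))" using \<rho> by force
  then obtain C where C: "C \<subseteq> S" "finite C" "S \<subseteq> (\<Union>c\<in>C. ball c (\<rho> c))"
    using compactE_image[OF cS, of S "\<lambda>c. ball c (\<rho> c)"] by auto
  have "integrable M (\<F> F) \<and> (\<integral>y. indicator G y *\<^sub>R F' y \<partial>vol) = integral\<^sup>L M (\<F> F)"
    by (rule claim[OF C(2,1) ad]) (use C(3) in blast)
  then show ?thesis by (simp add: M_def \<F>_def)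
qed

lemma smooth_boundary_imp_smooth_domain:
  assumes GV: "openin (top_of_set V) G" and bG: "bounded G" and sb: "smooth_boundary b m G"
  shows "smooth_domain G"
  unfolding smooth_domain_def
proof (intro conjI GV bG ballI)
  fix y assume "y \<in> closure G - G"
  then have "y \<in> coord_boundary b m G" using coord_boundary_eq[OF GV] by simp
  then obtain r k s g where r: "r > 0" "k < m" "s \<in> {-1, 1::real}" "C_inf g"
    "G \<inter> ball y r = {z \<in> V \<inter> ball y r. s * (z \<bullet> b k - g (drop_coord b k z)) > 0}"
    using sb unfolding smooth_boundary_def by blast
  have "one_sided G (ball y r) k s g"
    unfolding one_sided_def height_def using r open_ball by blast
  then show "\<exists>N k s g. y \<in> N \<and> one_sided G N k s g" using r(1) centre_in_ball by blast
qed

end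

section \<open>Octonions\<close>

lemma exhaust_8: "x = 0 \<or> x = 1 \<or> x = 2 \<or> x = 3 \<or> x = 4 \<or> x = 5 \<or> x = 6 \<or> x = 7" for x :: 8
proof (induct x)
  case (of_int z)
  then have "0 \<le> z" and "z < 8" by simp_all
  then have "z = 0 \<or> z = 1 \<or> z = 2 \<or> z = 3 \<or> z = 4 \<or> z = 5 \<or> z = 6 \<or> z = 7" by arith
  then show ?case by auto
qed

lemma forall_8: "(\<forall>i::8. P i) \<longleftrightarrow> P 0 \<and> P 1 \<and> P 2 \<and> P 3 \<and> P 4 \<and> P 5 \<and> P 6 \<and> P 7"
  by (metis exhaust_8)

lemma UNIV_8: "(UNIV :: 8 set) = {0, 1, 2, 3, 4, 5, 6, 7}"
  using exhaust_8 by auto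

lemma atMost_7: "{..7::nat} = {0, 1, 2, 3, 4, 5, 6, 7}" by auto

lemma Icc_1_7: "{Suc 0..7} = {1, 2, 3, 4, 5, 6, 7}" by auto

lemma omult_nth:
  "(x \<odot> y) $ 0 = x$0 * y$0 - x$1 * y$1 - x$2 * y$2 - x$3 * y$3 - x$4 * y$4 - x$5 * y$5 - x$6 * y$6 - x$7 * y$7"
  "(x \<odot> y) $ 1 = x$0 * y$1 + x$1 * y$0 + x$2 * y$3 - x$3 * y$2 + x$4 * y$5 - x$5 * y$4 - x$6 * y$7 + x$7 * y$6"
  "(x \<odot> y) $ 2 = x$0 * y$2 - x$1 * y$3 + x$2 * y$0 + x$3 * y$1 + x$4 * y$6 + x$5 * y$7 - x$6 * y$4 - x$7 * y$5"
  "(x \<odot> y) $ 3 = x$0 * y$3 + x$1 * y$2 - x$2 * y$1 + x$3 * y$0 + x$4 * y$7 - x$5 * y$6 + x$6 * y$5 - x$7 * y$4"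
  "(x \<odot> y) $ 4 = x$0 * y$4 - x$1 * y$5 - x$2 * y$6 - x$3 * y$7 + x$4 * y$0 + x$5 * y$1 + x$6 * y$2 + x$7 * y$3"
  "(x \<odot> y) $ 5 = x$0 * y$5 + x$1 * y$4 - x$2 * y$7 + x$3 * y$6 - x$4 * y$1 + x$5 * y$0 - x$6 * y$3 + x$7 * y$2"
  "(x \<odot> y) $ 6 = x$0 * y$6 + x$1 * y$7 + x$2 * y$4 - x$3 * y$5 - x$4 * y$2 + x$5 * y$3 + x$6 * y$0 - x$7 * y$1"
  "(x \<odot> y) $ 7 = x$0 * y$7 - x$1 * y$6 + x$2 * y$5 + x$3 * y$4 - x$4 * y$3 - x$5 * y$2 + x$6 * y$1 + x$7 * y$0"
  unfolding omult_def atMost_7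
  by (simp_all add: oct_basis_mult_def Icc_1_7 oct_eps_def oct_triples_def oe_def axis_def)

lemma oconj_nth:
  "oconj x $ 0 = x $ 0" "oconj x $ 1 = - x $ 1" "oconj x $ 2 = - x $ 2" "oconj x $ 3 = - x $ 3"
  "oconj x $ 4 = - x $ 4" "oconj x $ 5 = - x $ 5" "oconj x $ 6 = - x $ 6" "oconj x $ 7 = - x $ 7"
  unfolding oconj_def One_nat_def Icc_1_7 by (simp_all add: oe_def axis_def)

lemma inner_octonion: "(x::octonion) \<bullet> y = x$0 * y$0 + x$1 * y$1 + x$2 * y$2 + x$3 * y$3 + x$4 * y$4 + x$5 * y$5 + x$6 * y$6 + x$7 * y$7"
  unfolding inner_vec_def UNIV_8 by simp

text \<open>The one identity of octonions that the integral formula needs. It is the left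
  alternative law, combined with the fact that \<open>oconj z \<odot> z\<close> is the squared norm;
  in coordinates it is a polynomial identity.\<close>

lemma oconj_omult_omult: "oconj z \<odot> (z \<odot> f) = (z \<bullet> z) *\<^sub>R f"
  unfolding vec_eq_iff forall_8 vector_scaleR_component omult_nth oconj_nth inner_octonion real_scaleR_def
  by (intro conjI) algebra+

lemma bounded_bilinear_omult: "bounded_bilinear (\<odot>)"
proof -
  have "linear (\<lambda>y. x \<odot> y)" "linear (\<lambda>x. x \<odot> y)" for x y
    by (rule linearI; simp add: vec_eq_iff forall_8 omult_nth algebra_simps)+
  then have "bilinear (\<odot>)" by (auto simp: bilinear_def)
  then show ?thesis by (simp add: bilinear_conv_bounded_bilinear)
qed

interpretation omult_bilinear: bounded_bilinear "(\<odot>)" by (rule bounded_bilinear_omult)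

lemma linear_oconj: "linear oconj"
  by (rule linearI) (simp_all add: vec_eq_iff forall_8 oconj_nth)

lemma bounded_linear_oconj: "bounded_linear oconj"
  using linear_oconj by (simp add: linear_conv_bounded_linear)

lemma frame_slice_frame:
  assumes "p \<le> 6" "\<eta> \<in> slice_sphere p"
  shows "frame (slice_frame p \<eta>) (p + 2)"
proof
  have oe_inner: "oe i \<bullet> oe j = (if i = j then 1 else 0)" if "i \<le> 7" "j \<le> 7" for i j
  proof -
    have "i \<in> {..7}" "j \<in> {..7}" using that by auto
    then show ?thesis unfolding atMost_7
      by (auto simp: oe_def inner_axis_axis)
  qed
  obtain x where x: "\<eta> = (\<Sum>i=p+1..7. x i *\<^sub>R oe i)" "(\<Sum>i=p+1..7. (x i)\<^sup>2) = 1"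
    using assms(2) by (auto simp: slice_sphere_def)
  have \<eta>j: "\<eta> \<bullet> oe j = (if j \<in> {p+1..7} then x j else 0)" if "j \<le> 7" for j
  proof -
    have "\<eta> \<bullet> oe j = (\<Sum>i=p+1..7. x i * (if i = j then 1 else 0))"
      unfolding x(1) inner_sum_left inner_scaleR_left using that by (intro sum.cong) (auto simp: oe_inner)
    also have "\<dots> = (if j \<in> {p+1..7} then x j else 0)" by (simp add: if_distrib cong: if_cong)
    finally show ?thesis .
  qed
  have "\<eta> \<bullet> \<eta> = (\<Sum>i=p+1..7. x i * (\<eta> \<bullet> oe i))"
    by (subst (2) x(1)) (simp add: inner_sum_right)
  also have "\<dots> = (\<Sum>i=p+1..7. (x i)\<^sup>2)" by (intro sum.cong) (auto simp: \<eta>j power2_eq_square)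
  finally have \<eta>\<eta>: "\<eta> \<bullet> \<eta> = 1" using x(2) by simp
  fix i j assume "i < p + 2" "j < p + 2"
  then show "slice_frame p \<eta> i \<bullet> slice_frame p \<eta> j = (if i = j then 1 else 0)"
    using assms(1) \<eta>\<eta> \<eta>j[of i] \<eta>j[of j]
    by (auto simp: slice_frame_def oe_inner inner_commute[of "oe _" \<eta>])
qed

section \<open>The regularised Cauchy kernel and the integral formula\<close>

text \<open>Because of this value of the constant in the Cauchy kernel, the divergence of the
  regularised kernel has total mass 1.\<close>

lemma sphere_area_eq: "sphere_area p = real (p + 2) * unit_ball_vol (real (p + 2))"
proof -
  define x where "x = real (p + 2) / 2"
  have x: "x > 0" "real (p + 2) = 2 * x" by (simp_all add: x_def)
  have "Gamma (x + 1) = x * Gamma x" using x by (intro Gamma_plus1) (auto elim!: nonpos_Ints_cases)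
  moreover have "Gamma (1/2) ^ (p + 2) = pi powr x"
    by (simp add: Gamma_one_half_real powr_half_sqrt[symmetric] powr_realpow[symmetric] powr_powr x_def
        del: power_Suc power_Suc2 power_add)
  moreover have "Gamma x > 0" using x by (intro Gamma_real_pos)
  ultimately show ?thesis
    using x by (simp add: sphere_area_def unit_ball_vol_def x_def[symmetric] field_simps)
qed

lemma sphere_area_pos: "sphere_area p > 0"
  unfolding sphere_area_eq by (intro mult_pos_pos unit_ball_vol_pos) auto

lemma norm_oconj: "norm (oconj z) = norm z"
  by (simp add: norm_eq_sqrt_inner inner_octonion oconj_nth)

text \<open>The Cauchy kernel with its singularity replaced by a linear function inside the ball of
  radius \<open>\<epsilon>\<close>. It is continuous, with a kink on the sphere only.\<close>

definition reg_kernel :: "nat \<Rightarrow> real \<Rightarrow> octonion \<Rightarrow> octonion" where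
  "reg_kernel p \<epsilon> z = (1 / (sphere_area p * max (norm z) \<epsilon> ^ (p + 2))) *\<^sub>R oconj z"

text \<open>The derivative in direction \<open>v\<close> off the sphere of radius
  \<open>\<epsilon>\<close>; on the sphere itself, where the kernel has its kink, the inner formula
  is chosen.\<close>

definition reg_kernel' :: "nat \<Rightarrow> real \<Rightarrow> octonion \<Rightarrow> octonion \<Rightarrow> octonion" where
  "reg_kernel' p \<epsilon> v z = (1 / sphere_area p) *\<^sub>R
     (if norm z \<le> \<epsilon> then (1 / \<epsilon> ^ (p + 2)) *\<^sub>R oconj v
      else (1 / norm z ^ (p + 2)) *\<^sub>R oconj v - (real (p + 2) * (z \<bullet> v) / norm z ^ (p + 4)) *\<^sub>R oconj z)"

lemma reg_kernel_eq: "\<epsilon> \<le> norm z \<Longrightarrow> reg_kernel p \<epsilon> z = cauchy_kernel p z"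
  by (simp add: reg_kernel_def cauchy_kernel_def max_def)

lemma reg_kernel_deriv:
  assumes e: "\<epsilon> > 0" and z: "norm z \<noteq> \<epsilon>"
  shows "((\<lambda>t. reg_kernel p \<epsilon> (z + t *\<^sub>R v)) has_vector_derivative reg_kernel' p \<epsilon> v z) (at 0)"
proof -
  have lim: "((\<lambda>t. norm (z + t *\<^sub>R v)) \<longlongrightarrow> norm (z + 0 *\<^sub>R v)) (nhds 0)"
    by (intro tendsto_intros filterlim_ident)
  have cd: "((\<lambda>t. oconj (z + t *\<^sub>R v)) has_vector_derivative oconj v) (at 0)"
    by (rule bounded_linear.has_vector_derivative[OF bounded_linear_oconj])
       (auto intro!: derivative_eq_intros)
  consider "norm z < \<epsilon>" | "norm z > \<epsilon>" using z by linarith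
  then show ?thesis
  proof cases
    case 1
    have ev: "eventually (\<lambda>t. norm (z + t *\<^sub>R v) < \<epsilon>) (nhds 0)"
      using order_tendstoD(2)[OF lim, of \<epsilon>] 1 by simp
    have "((\<lambda>t. (1 / (sphere_area p * \<epsilon> ^ (p + 2))) *\<^sub>R oconj (z + t *\<^sub>R v)) has_vector_derivative
       (1 / (sphere_area p * \<epsilon> ^ (p + 2))) *\<^sub>R oconj v) (at 0)"
      using bounded_linear.has_vector_derivative[OF bounded_linear_scaleR_right cd] .
    also have "(1 / (sphere_area p * \<epsilon> ^ (p + 2))) *\<^sub>R oconj v = reg_kernel' p \<epsilon> v z"
      using 1 by (simp add: reg_kernel'_def)
    finally show ?thesis
    proof (rule has_vector_derivative_transform_line)
      show "\<forall>\<^sub>F t in nhds 0. (1 / (sphere_area p * \<epsilon> ^ (p + 2))) *\<^sub>R oconj (z + t *\<^sub>R v) = reg_kernel p \<epsilon> (z + t *\<^sub>R v)"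
        using ev by (rule eventually_mono) (simp add: reg_kernel_def max_def)
    qed
  next
    case 2
    have z0: "norm z > 0" using 2 e by linarith
    have ev: "eventually (\<lambda>t. norm (z + t *\<^sub>R v) > \<epsilon>) (nhds 0)"
      using order_tendstoD(1)[OF lim, of \<epsilon>] 2 by simp
    have "(\<lambda>t. (z + t *\<^sub>R v) \<bullet> (z + t *\<^sub>R v)) = (\<lambda>t. z \<bullet> z + t * (2 * (z \<bullet> v)) + t\<^sup>2 * (v \<bullet> v))"
      by (simp add: inner_add_left inner_add_right inner_commute algebra_simps power2_eq_square)
    then have d1: "((\<lambda>t. (z + t *\<^sub>R v) \<bullet> (z + t *\<^sub>R v)) has_real_derivative 2 * (z \<bullet> v)) (at 0)"
      by (auto intro!: derivative_eq_intros)
    have "((\<lambda>t. sqrt ((z + t *\<^sub>R v) \<bullet> (z + t *\<^sub>R v))) has_real_derivative (inverse (sqrt ((z + 0 *\<^sub>R v) \<bullet> (z + 0 *\<^sub>R v))) / 2) * (2 * (z \<bullet> v))) (at 0)"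
      by (rule DERIV_chain2[OF DERIV_real_sqrt d1]) (use z0 in simp)
    then have d2: "((\<lambda>t. norm (z + t *\<^sub>R v)) has_real_derivative (z \<bullet> v) / norm z) (at 0)"
      by (simp add: norm_eq_sqrt_inner[symmetric] field_simps)
    have d3: "((\<lambda>t. norm (z + t *\<^sub>R v) ^ (p + 2)) has_real_derivative real (p + 2) * norm z ^ (p + 1) * ((z \<bullet> v) / norm z)) (at 0)"
      by (rule DERIV_cong[OF DERIV_power[OF d2, of "p + 2"]]) (simp add: mult_ac)
    have nz: "norm (z + 0 *\<^sub>R v) ^ (p + 2) \<noteq> 0" using z0 by simp
    have "((\<lambda>t. inverse (norm (z + t *\<^sub>R v) ^ (p + 2))) has_real_derivative
        - (real (p + 2) * norm z ^ (p + 1) * ((z \<bullet> v) / norm z) * inverse ((norm z ^ (p + 2))\<^sup>2))) (at 0)"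
      by (rule DERIV_cong[OF DERIV_inverse_fun[OF d3 nz]]) (simp add: numeral_2_eq_2)
    also have "- (real (p + 2) * norm z ^ (p + 1) * ((z \<bullet> v) / norm z) * inverse ((norm z ^ (p + 2))\<^sup>2)) = - (real (p + 2) * (z \<bullet> v) / norm z ^ (p + 4))"
      using z0 by (simp add: field_simps power_add power2_eq_square power4_eq_xxxx)
    finally have "((\<lambda>t. inverse (norm (z + t *\<^sub>R v) ^ (p + 2)) *\<^sub>R oconj (z + t *\<^sub>R v)) has_vector_derivative
       inverse (norm z ^ (p + 2)) *\<^sub>R oconj v + (- (real (p + 2) * (z \<bullet> v) / norm z ^ (p + 4))) *\<^sub>R oconj z) (at 0)"
      using has_vector_derivative_scaleR[OF _ cd] by force
    from bounded_linear.has_vector_derivative[OF bounded_linear_scaleR_right this, of "1 / sphere_area p"]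
    have "((\<lambda>t. (1 / sphere_area p) *\<^sub>R (inverse (norm (z + t *\<^sub>R v) ^ (p + 2)) *\<^sub>R oconj (z + t *\<^sub>R v))) has_vector_derivative
       reg_kernel' p \<epsilon> v z) (at 0)"
      using 2 by (simp add: reg_kernel'_def inverse_eq_divide)
    then show ?thesis
    proof (rule has_vector_derivative_transform_line)
      show "\<forall>\<^sub>F t in nhds 0. (1 / sphere_area p) *\<^sub>R (inverse (norm (z + t *\<^sub>R v) ^ (p + 2)) *\<^sub>R oconj (z + t *\<^sub>R v)) = reg_kernel p \<epsilon> (z + t *\<^sub>R v)"
        using ev by (rule eventually_mono) (simp add: reg_kernel_def max_def inverse_eq_divide)
    qed
  qed
qed

lemma continuous_oconj [continuous_intros]: "continuous_on S f \<Longrightarrow> continuous_on S (\<lambda>x. oconj (f x))"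
  by (rule bounded_linear.continuous_on[OF bounded_linear_oconj])

lemma continuous_reg_kernel: "\<epsilon> > 0 \<Longrightarrow> continuous_on S (\<lambda>y. reg_kernel p \<epsilon> (y - x))"
  unfolding reg_kernel_def using sphere_area_pos[of p]
  by (intro continuous_intros) (auto simp: max_def)

lemma reg_kernel'_bound:
  assumes e: "\<epsilon> > 0" and v: "norm v = 1"
  shows "norm (reg_kernel' p \<epsilon> v z) \<le> (1 / sphere_area p) * (real (p + 3) / \<epsilon> ^ (p + 2))"
proof (cases "norm z \<le> \<epsilon>")
  case True
  then show ?thesis
    using sphere_area_pos[of p] e v by (simp add: reg_kernel'_def norm_oconj field_simps)
next
  case False
  then have z0: "norm z > 0" and ze: "\<epsilon> \<le> norm z" using e by linarith+
  let ?A = "(1 / norm z ^ (p + 2)) *\<^sub>R oconj v" and ?B = "(real (p + 2) * (z \<bullet> v) / norm z ^ (p + 4)) *\<^sub>R oconj z"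
  have pw: "1 / norm z ^ (p + 2) \<le> 1 / \<epsilon> ^ (p + 2)"
    using e ze by (intro frac_le power_mono zero_less_power) auto
  have "\<bar>z \<bullet> v\<bar> \<le> norm z" using Cauchy_Schwarz_ineq2[of z v] v by simp
  then have "\<bar>real (p + 2)\<bar> * \<bar>z \<bullet> v\<bar> \<le> real (p + 2) * norm z" by (intro mult_mono) auto
  then have "norm ?B \<le> real (p + 2) * norm z / norm z ^ (p + 4) * norm z"
    unfolding norm_scaleR norm_oconj abs_divide abs_mult
    by (intro mult_right_mono frac_le) (use z0 in auto)
  also have "\<dots> = real (p + 2) * (1 / norm z ^ (p + 2))"
    using z0 by (simp add: field_simps power_add power4_eq_xxxx power2_eq_square)
  also have "\<dots> \<le> real (p + 2) * (1 / \<epsilon> ^ (p + 2))" by (intro mult_left_mono pw) auto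
  finally have B: "norm ?B \<le> real (p + 2) * (1 / \<epsilon> ^ (p + 2))" .
  have A: "norm ?A \<le> 1 / \<epsilon> ^ (p + 2)" using pw v by (simp add: norm_oconj)
  have "norm (?A - ?B) \<le> 1 / \<epsilon> ^ (p + 2) + real (p + 2) * (1 / \<epsilon> ^ (p + 2))"
    using norm_triangle_ineq4[of ?A ?B] A B by linarith
  also have "\<dots> = (1 + real (p + 2)) / \<epsilon> ^ (p + 2)" by (simp only: add_divide_distrib times_divide_eq_right mult_1_right)
  also have "1 + real (p + 2) = real (p + 3)" by simp
  finally have "norm (?A - ?B) \<le> real (p + 3) / \<epsilon> ^ (p + 2)" .
  then have "(1 / sphere_area p) * norm (?A - ?B) \<le> (1 / sphere_area p) * (real (p + 3) / \<epsilon> ^ (p + 2))"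
    using sphere_area_pos[of p] by (intro mult_left_mono) auto
  moreover have "norm (reg_kernel' p \<epsilon> v z) = (1 / sphere_area p) * norm (?A - ?B)"
    using False sphere_area_pos[of p] by (simp add: reg_kernel'_def)
  ultimately show ?thesis by simp
qed

lemma borel_measurable_omult:
  assumes "f \<in> borel_measurable M" "g \<in> borel_measurable M"
  shows "(\<lambda>x. f x \<odot> g x) \<in> borel_measurable M"
  by (rule borel_measurable_continuous_Pair[OF assms])
     (intro omult_bilinear.continuous_on continuous_intros)

lemma borel_measurable_oconj [measurable]: "oconj \<in> borel_measurable borel"
  by (intro borel_measurable_continuous_onI continuous_intros)

lemma borel_measurable_reg_kernel': "(\<lambda>y. reg_kernel' p \<epsilon> v (y - x)) \<in> borel_measurable borel"
  unfolding reg_kernel'_def by measurable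

text \<open>A quadratic equation.\<close>

lemma finite_sphere_line:
  fixes x y v :: "'a::real_inner"
  assumes "norm v = 1"
  shows "finite {t. y + t *\<^sub>R v \<in> {w. norm (w - x) = \<epsilon>}}"
proof -
  define w where "w = y - x"
  define D where "D = \<epsilon>\<^sup>2 - w \<bullet> w + (w \<bullet> v)\<^sup>2"
  have "{t. y + t *\<^sub>R v \<in> {w. norm (w - x) = \<epsilon>}} \<subseteq> {sqrt D - w \<bullet> v, - sqrt D - w \<bullet> v}"
  proof
    fix t assume "t \<in> {t. y + t *\<^sub>R v \<in> {w. norm (w - x) = \<epsilon>}}"
    then have "norm (w + t *\<^sub>R v) = \<epsilon>" by (simp add: w_def algebra_simps)
    then have "\<epsilon>\<^sup>2 = (w + t *\<^sub>R v) \<bullet> (w + t *\<^sub>R v)" by (simp add: power2_norm_eq_inner[symmetric])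
    also have "\<dots> = w \<bullet> w + 2 * t * (w \<bullet> v) + t\<^sup>2 * (v \<bullet> v)"
      by (simp add: inner_add_left inner_add_right inner_commute power2_eq_square algebra_simps)
    also have "v \<bullet> v = 1" using assms by (simp add: dot_square_norm)
    finally have "(t + w \<bullet> v)\<^sup>2 = D" by (simp add: D_def power2_eq_square algebra_simps)
    then have "\<bar>t + w \<bullet> v\<bar> = sqrt D" by (metis real_sqrt_abs)
    then show "t \<in> {sqrt D - w \<bullet> v, - sqrt D - w \<bullet> v}" by (auto simp: abs_if split: if_splits)
  qed
  then show ?thesis by (rule finite_subset) simp
qed

context frame
begin

lemma ball_mean_approximates:
  fixes f :: "'a \<Rightarrow> 'c::euclidean_space"
  assumes GV: "openin (top_of_set V) G" and fc: "continuous_on (closure G) f" and xG: "x \<in> G" and e: "e > 0"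
  obtains \<epsilon> where "\<epsilon> > 0" "V \<inter> cball x \<epsilon> \<subseteq> G"
    "norm ((\<integral>y. indicator G y *\<^sub>R (if norm (y - x) \<le> \<epsilon> then (1 / (unit_ball_vol (real m) * \<epsilon> ^ m)) *\<^sub>R f y else 0) \<partial>vol) - f x) \<le> e"
proof -
  have GsubV: "G \<subseteq> V" using openin_subset[OF GV] by simp
  have xV: "x \<in> V" using xG GsubV by auto
  have GB: "G \<in> sets borel" by (rule openin_borel[OF GV])
  obtain r where r: "r > 0" "V \<inter> cball x r \<subseteq> G"
  proof -
    obtain T where T: "open T" "G = V \<inter> T" using GV by (auto simp: openin_open)
    then obtain r where "r > 0" "cball x r \<subseteq> T" using xG open_contains_cball by blast
    then show ?thesis using that T by blast
  qed
  have "\<exists>d>0. \<forall>y\<in>closure G. dist y x < d \<longrightarrow> dist (f y) (f x) < e"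
    using fc xG closure_subset[of G] e unfolding continuous_on_iff by blast
  then obtain d where d: "d > 0" "\<And>y. y \<in> closure G \<Longrightarrow> dist y x < d \<Longrightarrow> dist (f y) (f x) < e" by blast
  \<comment> \<open>the closed ball has to stay in \<open>G\<close> and in the open ball of radius \<open>d\<close> given by continuity\<close>
  define \<epsilon> where "\<epsilon> = min (r / 2) (d / 2)"
  have \<epsilon>: "\<epsilon> > 0" "\<epsilon> \<le> r" "\<epsilon> < d" using r d by (auto simp: \<epsilon>_def)
  define c where "c = 1 / (unit_ball_vol (real m) * \<epsilon> ^ m)"
  have c0: "c > 0" using \<epsilon> by (simp add: c_def)
  have volB: "emeasure vol (cball x \<epsilon>) = ennreal (1 / c)"
    using vol_cball[OF xV \<epsilon>(1)] by (simp add: c_def)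
  have mB: "measure vol (cball x \<epsilon>) = 1 / c" using volB c0 by (simp add: measure_def)
  let ?h = "\<lambda>y. indicator G y *\<^sub>R (if norm (y - x) \<le> \<epsilon> then c *\<^sub>R f y else 0)"
  define J where "J = integral\<^sup>L vol ?h"
  have ic: "integrable vol (\<lambda>y. indicator (cball x \<epsilon>) y *\<^sub>R v)" for v :: 'c
    by (rule integrable_scaleR_left, rule integrable_real_indicator) (auto simp: volB)
  have hm: "?h \<in> borel_measurable borel"
  proof -
    have "?h = (\<lambda>y. indicator (cball x \<epsilon>) y *\<^sub>R (c *\<^sub>R (indicator G y *\<^sub>R f y)))"
      by (auto simp: indicator_def dist_norm norm_minus_commute)
    moreover have "(\<lambda>y. indicator (cball x \<epsilon>) y *\<^sub>R (c *\<^sub>R (indicator G y *\<^sub>R f y))) \<in> borel_measurable borel"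
      by (intro borel_measurable_scaleR borel_measurable_indicator borel_measurable_const
          borel_measurable_continuous_on_indicator GB continuous_on_subset[OF fc] closure_subset) auto
    ultimately show ?thesis by (simp only:)
  qed
  have close: "norm (?h y - indicator (cball x \<epsilon>) y *\<^sub>R (c *\<^sub>R f x)) \<le> indicator (cball x \<epsilon>) y *\<^sub>R (c * e)" if "y \<in> V" for y
  proof (cases "y \<in> cball x \<epsilon>")
    case True
    then have yG: "y \<in> G" using r(2) \<epsilon> that by auto
    have "dist (f y) (f x) < e"
      using True \<epsilon> yG closure_subset[of G] by (intro d(2)) (auto simp: dist_commute)
    then have "c * norm (f y - f x) \<le> c * e" using c0 by (simp add: dist_norm)
    moreover have "?h y - indicator (cball x \<epsilon>) y *\<^sub>R (c *\<^sub>R f x) = c *\<^sub>R (f y - f x)"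
      using True yG by (simp add: dist_norm norm_minus_commute scaleR_diff_right)
    ultimately show ?thesis using True c0 by simp
  next
    case False
    then show ?thesis by (simp add: dist_norm norm_minus_commute)
  qed
  have AEV: "AE y in vol. norm (?h y - indicator (cball x \<epsilon>) y *\<^sub>R (c *\<^sub>R f x)) \<le> indicator (cball x \<epsilon>) y *\<^sub>R (c * e)"
    using AE_vol_V by eventually_elim (rule close)
  have ie: "integrable vol (\<lambda>y. indicator (cball x \<epsilon>) y *\<^sub>R (c * e))"
    by (rule integrable_scaleR_left, rule integrable_real_indicator) (auto simp: volB)
  have idiff: "integrable vol (\<lambda>y. ?h y - indicator (cball x \<epsilon>) y *\<^sub>R (c *\<^sub>R f x))"
  proof (rule Bochner_Integration.integrable_bound[OF ie])
    show "(\<lambda>y. ?h y - indicator (cball x \<epsilon>) y *\<^sub>R (c *\<^sub>R f x)) \<in> borel_measurable vol"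
      by (intro borel_measurable_diff borel_measurable_integrable[OF ic])
        (subst measurable_cong_sets[OF sets_vol refl], rule hm)
    show "AE y in vol. norm (?h y - indicator (cball x \<epsilon>) y *\<^sub>R (c *\<^sub>R f x)) \<le> norm (indicator (cball x \<epsilon>) y *\<^sub>R (c * e))"
      using AEV by eventually_elim (use c0 e in simp)
  qed
  have ih: "integrable vol ?h"
    using Bochner_Integration.integrable_add[OF idiff ic[of "c *\<^sub>R f x"]] by simp
  have ind: "(\<integral>y. indicator (cball x \<epsilon>) y *\<^sub>R (c *\<^sub>R v) \<partial>vol) = v" for v :: "'d::euclidean_space"
  proof -
    have "(\<integral>y. indicator (cball x \<epsilon>) y *\<^sub>R (c *\<^sub>R v) \<partial>vol) = measure vol (cball x \<epsilon>) *\<^sub>R (c *\<^sub>R v)"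
      using volB by (intro has_bochner_integral_integral_eq has_bochner_integral_indicator) auto
    then show ?thesis using mB c0 by simp
  qed
  define E where "E y = ?h y - indicator (cball x \<epsilon>) y *\<^sub>R (c *\<^sub>R f x)" for y
  have "integral\<^sup>L vol E = integral\<^sup>L vol ?h - (\<integral>y. indicator (cball x \<epsilon>) y *\<^sub>R (c *\<^sub>R f x) \<partial>vol)"
    unfolding E_def by (rule Bochner_Integration.integral_diff[OF ih ic])
  then have "J - f x = integral\<^sup>L vol E" unfolding ind J_def[symmetric] by simp
  then have "norm (J - f x) \<le> (\<integral>y. norm (E y) \<partial>vol)"
    using integral_norm_bound[of vol E] by (simp only:)
  also have "\<dots> \<le> (\<integral>y. indicator (cball x \<epsilon>) y *\<^sub>R (c * e) \<partial>vol)"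
    unfolding E_def by (rule integral_mono_AE[OF integrable_norm[OF idiff] ie AEV])
  also have "\<dots> = e" using ind[of e] by simp
  finally have "norm (J - f x) \<le> e" .
  moreover have "V \<inter> cball x \<epsilon> \<subseteq> G" using r(2) \<epsilon>(2) by auto
  ultimately show ?thesis using that[OF \<epsilon>(1)] unfolding J_def c_def by blast
qed

end

locale octonion_frame = frame b m for b :: "nat \<Rightarrow> octonion" and m :: nat
begin

text \<open>Apply the divergence theorem to \<open>E (y - x) \<odot> (b i \<odot> f y)\<close> in
  direction \<open>b i\<close> for every \<open>i\<close> and add up, with the regularised kernel
  \<open>E\<close>. On the boundary the regularised kernel is the Cauchy kernel, and the sum over
  \<open>i\<close> assembles the normal. In the interior the terms with derivatives of
  \<open>f\<close> sum to zero by the differential equation. The remaining terms contain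
  \<open>oconj (b i) \<odot> (b i \<odot> f y)\<close> and \<open>oconj z \<odot> (z \<odot> f
  y)\<close> with \<open>z = y - x\<close>; as both are multiples of \<open>f y\<close>,
  non-associativity does not interfere. They cancel outside the ball and leave a constant multiple
  of \<open>f y\<close> inside.\<close>

lemma boundary_integral_eq_ball_integral:
  assumes m: "m = p + 2" and sd: "smooth_domain G" and fc: "continuous_on (closure G) f"
    and f': "\<And>i. i < m \<Longrightarrow> continuous_on (closure G) (f' i)"
      "\<And>i y. i < m \<Longrightarrow> y \<in> G \<Longrightarrow> ((\<lambda>t. f (y + t *\<^sub>R b i)) has_vector_derivative f' i y) (at 0)"
    and Df: "\<And>y. y \<in> G \<Longrightarrow> (\<Sum>i<m. b i \<odot> f' i y) = 0"
    and xV: "x \<in> V" and e: "\<epsilon> > 0" and far: "\<And>y. y \<in> closure G - G \<Longrightarrow> \<epsilon> \<le> norm (y - x)"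
  defines "S \<equiv> closure G - G" and "n \<equiv> unit_exterior_normal b m G"
  defines "M \<equiv> surface_measure b m S" and "\<sigma> \<equiv> sphere_area p"
  shows "(\<integral>y. indicator S y *\<^sub>R (cauchy_kernel p (y - x) \<odot> (n y \<odot> f y)) \<partial>M) =
    (\<integral>y. indicator G y *\<^sub>R (if norm (y - x) \<le> \<epsilon> then (real m / (\<sigma> * \<epsilon> ^ m)) *\<^sub>R f y else 0) \<partial>vol)"
proof -
  have GV: "openin (top_of_set V) G" and bG: "bounded G" using sd unfolding smooth_domain_def by blast+
  have GsubV: "G \<subseteq> V" using openin_subset[OF GV] by simp
  have GB: "G \<in> sets borel" by (rule openin_borel[OF GV])
  have \<sigma>: "\<sigma> > 0" by (simp add: \<sigma>_def sphere_area_pos)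
  have nV: "emb (\<lambda>i. n y \<bullet> b i) = n y" if "y \<in> S" for y
    using unit_exterior_normal_in_V[OF sd, of y] that by (simp add: n_def S_def emb_inner)
  define K where "K y = reg_kernel p \<epsilon> (y - x)" for y
  define K' where "K' i y = reg_kernel' p \<epsilon> (b i) (y - x)" for i y
  define F where "F i y = K y \<odot> (b i \<odot> f y)" for i y
  define F' where "F' i y = K y \<odot> (b i \<odot> f' i y) + K' i y \<odot> (b i \<odot> f y)" for i y
  define Z where "Z = {w. norm (w - x) = \<epsilon>}"
  have Zf: "finite {t. y + t *\<^sub>R b i \<in> Z}" if "i < m" for i y
    unfolding Z_def by (rule finite_sphere_line[OF norm_b[OF that]])
  have Kc: "continuous_on A K" for A unfolding K_def by (rule continuous_reg_kernel[OF e])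
  have ad: "admissible i Z G (F i) (F' i)" if i: "i < m" for i
    unfolding admissible_def
  proof (intro conjI ballI)
    show "continuous_on (closure G) (F i)"
      unfolding F_def[abs_def] by (intro omult_bilinear.continuous_on Kc fc continuous_on_const)
    show "((\<lambda>t. F i (y + t *\<^sub>R b i)) has_vector_derivative F' i y) (at 0)" if y: "y \<in> G - Z" for y
    proof -
      have "((\<lambda>t. reg_kernel p \<epsilon> ((y - x) + t *\<^sub>R b i)) has_vector_derivative K' i y) (at 0)"
        unfolding K'_def using y by (intro reg_kernel_deriv[OF e]) (auto simp: Z_def)
      then have 1: "((\<lambda>t. K (y + t *\<^sub>R b i)) has_vector_derivative K' i y) (at 0)"
        by (simp add: K_def algebra_simps)
      have 2: "((\<lambda>t. b i \<odot> f (y + t *\<^sub>R b i)) has_vector_derivative b i \<odot> f' i y) (at 0)"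
        using bounded_linear.has_vector_derivative[OF omult_bilinear.bounded_linear_right f'(2)[OF i]] y by simp
      from omult_bilinear.has_vector_derivative[OF 1 2]
      show ?thesis by (simp add: F_def F'_def)
    qed
    have ind: "(\<lambda>y. indicator G y *\<^sub>R h y) \<in> borel_measurable borel" if "continuous_on (closure G) h" for h :: "octonion \<Rightarrow> octonion"
      by (intro borel_measurable_continuous_on_indicator GB continuous_on_subset[OF that] closure_subset)
    have "(\<lambda>y. indicator G y *\<^sub>R F' i y) = (\<lambda>y. indicator G y *\<^sub>R (K y \<odot> (b i \<odot> f' i y)) + K' i y \<odot> (indicator G y *\<^sub>R (b i \<odot> f y)))"
      by (simp add: F'_def scaleR_add_right omult_bilinear.scaleR_right)
    also have "\<dots> \<in> borel_measurable borel"
    proof (intro borel_measurable_add borel_measurable_omult)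
      show "(\<lambda>y. indicator G y *\<^sub>R (K y \<odot> (b i \<odot> f' i y))) \<in> borel_measurable borel"
        by (intro ind omult_bilinear.continuous_on Kc f'(1)[OF i] continuous_on_const)
      show "K' i \<in> borel_measurable borel" unfolding K'_def[abs_def] by (rule borel_measurable_reg_kernel')
      show "(\<lambda>y. indicator G y *\<^sub>R (b i \<odot> f y)) \<in> borel_measurable borel"
        by (intro ind omult_bilinear.continuous_on fc continuous_on_const)
    qed
    finally show "(\<lambda>y. indicator G y *\<^sub>R F' i y) \<in> borel_measurable borel" .
    have cG: "compact (closure G)" using bG by simp
    have bound: "\<exists>C. \<forall>y\<in>closure G. norm (h y) \<le> C" if "continuous_on (closure G) h" for h :: "octonion \<Rightarrow> octonion"
      using compact_imp_bounded[OF compact_continuous_image[OF that cG]] by (auto simp: bounded_iff)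
    have "continuous_on (closure G) (\<lambda>y. K y \<odot> (b i \<odot> f' i y))" "continuous_on (closure G) (\<lambda>y. b i \<odot> f y)"
      by (intro omult_bilinear.continuous_on Kc f'(1)[OF i] fc continuous_on_const)+
    from bound[OF this(1)] bound[OF this(2)] obtain C1 C2 where
      C: "\<And>y. y \<in> closure G \<Longrightarrow> norm (K y \<odot> (b i \<odot> f' i y)) \<le> C1" "\<And>y. y \<in> closure G \<Longrightarrow> norm (b i \<odot> f y) \<le> C2" by blast
    obtain Q where Q: "Q > 0" "\<And>a c. norm (a \<odot> c) \<le> norm a * norm c * Q" using omult_bilinear.pos_bounded by blast
    define L where "L = (1 / sphere_area p) * (real (p + 3) / \<epsilon> ^ (p + 2))"
    show "\<exists>B. \<forall>y\<in>G. norm (F' i y) \<le> B"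
    proof (intro exI ballI)
      fix y assume "y \<in> G"
      then have y: "y \<in> closure G" using closure_subset by auto
      have L: "norm (K' i y) \<le> L" unfolding K'_def L_def by (rule reg_kernel'_bound[OF e norm_b[OF i]])
      have "norm (K' i y \<odot> (b i \<odot> f y)) \<le> norm (K' i y) * norm (b i \<odot> f y) * Q" by (rule Q(2))
      also have "\<dots> \<le> L * C2 * Q"
        using L C(2)[OF y] Q(1) order_trans[OF norm_ge_zero L] by (intro mult_right_mono mult_mono) auto
      finally show "norm (F' i y) \<le> C1 + L * C2 * Q"
        unfolding F'_def by (intro norm_triangle_le add_mono C(1)[OF y])
    qed
  qed
  note dt = divergence_theorem[OF sd _ Zf ad, folded S_def M_def n_def]
  have sumF: "(\<Sum>i<m. indicator S y *\<^sub>R ((n y \<bullet> b i) *\<^sub>R F i y)) = indicator S y *\<^sub>R (cauchy_kernel p (y - x) \<odot> (n y \<odot> f y))" for y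
  proof (cases "y \<in> S")
    case True
    have "(\<Sum>i<m. (n y \<bullet> b i) *\<^sub>R F i y) = K y \<odot> (emb (\<lambda>i. n y \<bullet> b i) \<odot> f y)"
      by (simp add: F_def emb_def omult_bilinear.sum_left omult_bilinear.sum_right omult_bilinear.scaleR_left omult_bilinear.scaleR_right)
    also have "\<dots> = cauchy_kernel p (y - x) \<odot> (n y \<odot> f y)"
      using reg_kernel_eq[OF far, of y p, folded S_def, OF True] nV[OF True] by (simp add: K_def)
    finally show ?thesis using True by simp
  qed simp
  have sumF': "(\<Sum>i<m. F' i y) = (if norm (y - x) \<le> \<epsilon> then (real m / (\<sigma> * \<epsilon> ^ m)) *\<^sub>R f y else 0)" if y: "y \<in> G" for y
  proof -
    have yV: "y \<in> V" using y GsubV by auto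
    define z where "z = y - x"
    have zV: "z \<in> V" unfolding z_def using yV xV by (intro subspace_diff subspace_V)
    have 1: "(\<Sum>i<m. K y \<odot> (b i \<odot> f' i y)) = 0"
      using Df[OF y] by (simp add: omult_bilinear.sum_right[symmetric] omult_bilinear.zero_right)
    have cb: "oconj (b i) \<odot> (b i \<odot> f y) = f y" if "i < m" for i
      using oconj_omult_omult[of "b i" "f y"] orth[OF that that] by simp
    have zb: "(\<Sum>i<m. (z \<bullet> b i) *\<^sub>R (oconj z \<odot> (b i \<odot> f y))) = (norm z)\<^sup>2 *\<^sub>R f y"
    proof -
      have "(\<Sum>i<m. (z \<bullet> b i) *\<^sub>R (oconj z \<odot> (b i \<odot> f y))) = oconj z \<odot> (emb (\<lambda>i. z \<bullet> b i) \<odot> f y)"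
        by (simp add: emb_def omult_bilinear.sum_left omult_bilinear.sum_right omult_bilinear.scaleR_left omult_bilinear.scaleR_right)
      also have "\<dots> = (norm z)\<^sup>2 *\<^sub>R f y"
        unfolding emb_inner[OF zV] oconj_omult_omult power2_norm_eq_inner ..
      finally show ?thesis .
    qed
    have 2: "(\<Sum>i<m. K' i y \<odot> (b i \<odot> f y)) = (if norm z \<le> \<epsilon> then (real m / (\<sigma> * \<epsilon> ^ m)) *\<^sub>R f y else 0)"
    proof (cases "norm z \<le> \<epsilon>")
      case True
      have "(\<Sum>i<m. K' i y \<odot> (b i \<odot> f y)) = (\<Sum>i<m. (1 / (\<sigma> * \<epsilon> ^ m)) *\<^sub>R f y)"
        using True by (intro sum.cong)
          (auto simp: K'_def reg_kernel'_def z_def[symmetric] omult_bilinear.scaleR_left cb \<sigma>_def m)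
      also have "\<dots> = (real m / (\<sigma> * \<epsilon> ^ m)) *\<^sub>R f y"
        by (simp add: sum_constant_scaleR del: sum_constant)
      finally show ?thesis using True by simp
    next
      case False
      then have z0: "norm z > 0" using e by linarith
      have "(\<Sum>i<m. K' i y \<odot> (b i \<odot> f y)) =
         (\<Sum>i<m. (1 / \<sigma>) *\<^sub>R ((1 / norm z ^ m) *\<^sub>R f y - (real m / norm z ^ (m + 2)) *\<^sub>R ((z \<bullet> b i) *\<^sub>R (oconj z \<odot> (b i \<odot> f y)))))"
      proof (rule sum.cong[OF refl])
        fix i assume "i \<in> {..<m}"
        then have i: "i < m" by simp
        have pm: "p + 4 = m + 2" "p + 2 = m" by (simp_all add: m)
        have "K' i y = (1 / \<sigma>) *\<^sub>R ((1 / norm z ^ m) *\<^sub>R oconj (b i) - (real m * (z \<bullet> b i) / norm z ^ (m + 2)) *\<^sub>R oconj z)"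
          unfolding K'_def reg_kernel'_def z_def[symmetric] pm \<sigma>_def[symmetric] using False by simp
        then show "K' i y \<odot> (b i \<odot> f y) = (1 / \<sigma>) *\<^sub>R ((1 / norm z ^ m) *\<^sub>R f y - (real m / norm z ^ (m + 2)) *\<^sub>R ((z \<bullet> b i) *\<^sub>R (oconj z \<odot> (b i \<odot> f y))))"
          by (simp add: omult_bilinear.scaleR_left omult_bilinear.diff_left cb[OF i])
      qed
      also have "\<dots> = (1 / \<sigma>) *\<^sub>R ((real m / norm z ^ m) *\<^sub>R f y - (real m / norm z ^ (m + 2)) *\<^sub>R ((norm z)\<^sup>2 *\<^sub>R f y))"
        unfolding scaleR_sum_right[symmetric] sum_subtractf zb
        by (simp add: sum_constant_scaleR del: sum_constant)
      also have "(real m / norm z ^ (m + 2)) *\<^sub>R ((norm z)\<^sup>2 *\<^sub>R f y) = (real m / norm z ^ m) *\<^sub>R f y"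
        using z0 by (simp add: power_add power2_eq_square)
      finally show ?thesis using False by simp
    qed
    show ?thesis using 1 2 by (simp add: F'_def sum.distrib z_def)
  qed
  have "(\<integral>y. indicator S y *\<^sub>R (cauchy_kernel p (y - x) \<odot> (n y \<odot> f y)) \<partial>M) = (\<integral>y. (\<Sum>i<m. indicator S y *\<^sub>R ((n y \<bullet> b i) *\<^sub>R F i y)) \<partial>M)" unfolding sumF ..
  also have "\<dots> = (\<Sum>i<m. \<integral>y. indicator S y *\<^sub>R ((n y \<bullet> b i) *\<^sub>R F i y) \<partial>M)"
    using dt by (intro Bochner_Integration.integral_sum) auto
  also have "\<dots> = (\<Sum>i<m. \<integral>y. indicator G y *\<^sub>R F' i y \<partial>vol)"
    using dt by (intro sum.cong) auto
  also have "\<dots> = (\<integral>y. (\<Sum>i<m. indicator G y *\<^sub>R F' i y) \<partial>vol)"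
    using admissible_integrable[OF ad bG] by (intro Bochner_Integration.integral_sum[symmetric]) auto
  also have "\<dots> = (\<integral>y. indicator G y *\<^sub>R (if norm (y - x) \<le> \<epsilon> then (real m / (\<sigma> * \<epsilon> ^ m)) *\<^sub>R f y else 0) \<partial>vol)"
  proof (rule Bochner_Integration.integral_cong[OF refl])
    fix y
    show "(\<Sum>i<m. indicator G y *\<^sub>R F' i y) = indicator G y *\<^sub>R (if norm (y - x) \<le> \<epsilon> then (real m / (\<sigma> * \<epsilon> ^ m)) *\<^sub>R f y else 0)"
      using sumF'[of y] by (cases "y \<in> G") (auto simp: scaleR_sum_right[symmetric])
  qed
  finally show ?thesis .
qed

end

theorem theorem4p7:
  fixes p :: nat and \<eta> :: octonion and U :: "octonion set" and f :: "octonion \<Rightarrow> octonion"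
  assumes "p \<le> 6"
    and "\<eta> \<in> slice_sphere p"
    and "open U" and "connected U" and "bounded U"
    and "smooth_boundary (slice_frame p \<eta>) (p + 2) (slice p \<eta> U)"
    and "C1_closure (slice_frame p \<eta>) (p + 2) (slice p \<eta> U) f"
    and "\<forall>y \<in> slice p \<eta> U. slice_D p \<eta> f y = 0"
  shows "\<forall>x \<in> slice p \<eta> U.
    f x = (LINT y : slice_boundary p \<eta> U | slice_dS p \<eta> U.
             cauchy_kernel p (y - x) \<odot> (slice_normal p \<eta> U y \<odot> f y))"
proof
  fix x assume x: "x \<in> slice p \<eta> U"
  define b where "b = slice_frame p \<eta>"
  define m where "m = p + 2"
  interpret octonion_frame b m
    unfolding b_def m_def octonion_frame_def by (rule frame_slice_frame[OF assms(1,2)])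
  define G where "G = slice p \<eta> U"
  have G_eq: "G = U \<inter> V" by (simp add: G_def slice_def b_def m_def)
  have GV: "openin (top_of_set V) G" unfolding G_eq using assms(3) by (auto simp: openin_open Int_commute)
  have bG: "bounded G" unfolding G_eq using assms(5) by (simp add: bounded_Int)
  have sd: "smooth_domain G"
    by (rule smooth_boundary_imp_smooth_domain[OF GV bG]) (use assms(6) in \<open>simp add: b_def m_def G_def\<close>)
  have GsubV: "G \<subseteq> V" by (simp add: G_eq)
  define S where "S = closure G - G"
  define M where "M = surface_measure b m S"
  define n where "n = unit_exterior_normal b m G"
  have S_eq: "slice_boundary p \<eta> U = S" "slice_dS p \<eta> U = M" "slice_normal p \<eta> U = n"
    unfolding slice_dS_def M_def slice_boundary_def slice_normal_def S_def n_def
      b_def[symmetric] m_def[symmetric] G_def[symmetric] coord_boundary_eq[OF GV] by simp_all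
  have xG: "x \<in> G" and xV: "x \<in> V" using x GsubV by (auto simp: G_def)
  have fc: "continuous_on (closure G) f"
    using assms(7) coord_closure_eq[OF GsubV] by (simp add: C1_closure_def b_def m_def G_def)
  have "\<forall>i<m. \<exists>g. continuous_on (closure G) g \<and> (\<forall>y\<in>G. ((\<lambda>t. f (y + t *\<^sub>R b i)) has_vector_derivative g y) (at 0))"
    using assms(7) coord_closure_eq[OF GsubV] by (simp add: C1_closure_def b_def m_def G_def)
  then obtain f' where f': "\<And>i. i < m \<Longrightarrow> continuous_on (closure G) (f' i)"
    "\<And>i y. i < m \<Longrightarrow> y \<in> G \<Longrightarrow> ((\<lambda>t. f (y + t *\<^sub>R b i)) has_vector_derivative f' i y) (at 0)" by metis
  have Df: "(\<Sum>i<m. b i \<odot> f' i y) = 0" if y: "y \<in> G" for y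
  proof -
    have d: "dir_deriv f (b i) y = f' i y" if "i < m" for i
      unfolding dir_deriv_def by (rule vector_derivative_at[OF f'(2)[OF that y]])
    have "(\<Sum>i<m. b i \<odot> f' i y) = (\<Sum>i<p+1. b i \<odot> f' i y) + b (p+1) \<odot> f' (p+1) y"
      by (simp add: m_def)
    also have "(\<Sum>i<p+1. b i \<odot> f' i y) = (\<Sum>i\<le>p. oe i \<odot> dir_deriv f (oe i) y)"
    proof (rule sum.cong)
      fix i assume "i \<in> {..p}"
      then have "b i = oe i" "i < m" by (auto simp: b_def slice_frame_def m_def)
      then show "b i \<odot> f' i y = oe i \<odot> dir_deriv f (oe i) y" using d[of i] by simp
    qed auto
    also have "b (p+1) \<odot> f' (p+1) y = \<eta> \<odot> dir_deriv f \<eta> y"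
      using d[of "p + 1"] by (simp add: b_def slice_frame_def m_def)
    also have "(\<Sum>i\<le>p. oe i \<odot> dir_deriv f (oe i) y) + \<eta> \<odot> dir_deriv f \<eta> y = slice_D p \<eta> f y"
      by (simp add: slice_D_def)
    also have "\<dots> = 0" using assms(8) y by (simp add: G_def)
    finally show ?thesis .
  qed
  define J where "J = (\<integral>y. indicator S y *\<^sub>R (cauchy_kernel p (y - x) \<odot> (n y \<odot> f y)) \<partial>M)"
  have "norm (J - f x) \<le> e" if e: "e > 0" for e
  proof -
    obtain \<epsilon> where \<epsilon>: "\<epsilon> > 0" "V \<inter> cball x \<epsilon> \<subseteq> G"
      and mean: "norm ((\<integral>y. indicator G y *\<^sub>R (if norm (y - x) \<le> \<epsilon> then (1 / (unit_ball_vol (real m) * \<epsilon> ^ m)) *\<^sub>R f y else 0) \<partial>vol) - f x) \<le> e"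
      by (rule ball_mean_approximates[OF GV fc xG e])
    have far: "\<epsilon> \<le> norm (y - x)" if "y \<in> closure G - G" for y
    proof (rule ccontr)
      assume "\<not> ?thesis"
      then have "y \<in> cball x \<epsilon>" by (simp add: dist_norm norm_minus_commute)
      moreover have "y \<in> V" using that closure_minimal[OF GsubV closed_V] by auto
      ultimately show False using \<epsilon> that by auto
    qed
    have mean_factor: "real m / (sphere_area p * \<epsilon> ^ m) = 1 / (unit_ball_vol (real m) * \<epsilon> ^ m)"
      by (simp add: sphere_area_eq m_def)
    then show ?thesis
      using mean boundary_integral_eq_ball_integral[OF m_def sd fc f' Df xV \<epsilon>(1) far]
      unfolding mean_factor J_def S_def M_def n_def by simp
  qed
  then have "norm (J - f x) \<le> 0" by (rule field_le_epsilon[of _ 0, simplified])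
  then have "f x = J" by simp
  then show "f x = (LINT y : slice_boundary p \<eta> U | slice_dS p \<eta> U.
             cauchy_kernel p (y - x) \<odot> (slice_normal p \<eta> U y \<odot> f y))"
    unfolding S_eq J_def set_lebesgue_integral_def .
qed

end
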